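(* Let $\varepsilon>0$. Under Assumptions (1)–(5) listed in the context, the damped proximal augmented Lagrangian method (DPALM) described in the context, with $$\beta_k=\beta_0\sqrt{k+1},\qquad v_k=\frac{v_0}{\sqrt{k+1}\,(\log(k+1))^2}\quad(k\ge1)$$ for some $\beta_0>0$, $v_0>0$ (which are also the values at $k=0$), and with the APG method described in the context used as a subroutine to compute each $x^{k+1}$ such that $$\operatorname{dist}\big(0,\partial_x\widetilde{\mathcal L}_{\beta_k}(x^{k+1};y^k,z^k)\big)\le\varepsilon_k:=\min\Big\{\frac\varepsilon8,\sqrt{\frac{\rho}{2\beta_k}},1\Big\},$$ can produce an $\varepsilon$-KKT point of problem (P) by $T_1^{\rm total}$ proximal gradient steps (total number of APG iterations), where $$T_1^{\rm total}\le 2K+K\Big(2\sqrt{\frac{C_3}{\rho}}+2\sqrt{\frac{\sqrt K\beta_0C_2}{\rho}}+\frac1{\log2}\Big)\log\Big(9\varepsilon_K^{-1}D\sqrt{\frac1\rho}\,(C_3+\sqrt K\beta_0C_2)^{3/2}\Big),$$ with $K=K_1+K_2$, $$K_1:=\Big\lceil\max\Big\{\frac{C_p^2}{\beta_0^2\varepsilon^2},\frac{(4B_p^2+5C_p^2)^2}{16\beta_0^2\varepsilon^2}\Big\}\Big\rceil,\quad K_2:=\lceil5C_x\rho\,\varepsilon^{-2}\rceil,$$ $C_2:=\|A^\top A\|+mB_g(B_g+L_g)$, $C_3:=L_f+\rho+\sqrt mL_gB_p$, and $B_p,C_p,C_x$ as defined in the context.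
   Context: Problem (P): $\min_{x\in\mathbb R^d}F(x):=f(x)+h(x)$ subject to $Ax=b$, $g(x):=[g_1(x),\dots,g_m(x)]\le 0$, where $A\in\mathbb R^{n\times d}$, $b\in\mathbb R^n$, and $F$ is continuous on its domain $\mathcal X:=\mathrm{dom}(F)$. $\|\cdot\|$ is the Euclidean (spectral, for matrices) norm; $[a]_+$ is the componentwise positive part; $\log$ is natural. Assumptions. (1) $\mathcal X$ is compact with diameter $D=\max_{x_1,x_2\in\mathcal X}\|x_1-x_2\|$; $f$ is $\rho$-weakly convex on $\mathcal X$ for some $\rho>0$ (i.e. $f+\frac\rho2\|\cdot\|^2$ is convex); $h$ is closed convex and admits an efficient proximal mapping. (2) Each $g_i:\mathbb R^d\to\mathbb R$ is convex and $L_g$-smooth (gradient $L_g$-Lipschitz) on an open set containing $\mathcal X$. (3) There is $x_{\rm feas}\in\mathrm{int}(\mathcal X)$ with $Ax_{\rm feas}=b$ and $g_{\min}:=\min_{i}-g_i(x_{\rm feas})>0$. (4) There is $r_h>0$ with $\emptyset\ne\partial h(x)\subseteq\mathcal N_{\mathcal X}(x)+\{u:\|u\|\le r_h\}$ for all $x\in\mathcal X$ ($\mathcal N_{\mathcal X}$ is the normal cone). (5) $f$ is $L_f$-smooth on an open set containing $\mathcal X$. $B_g>0$ is a constant with $\max\{|g_i(x)|,\|\nabla g_i(x)\|\}\le B_g$ and $|g_i(x)-g_i(\tilde x)|\le B_g\|x-\tilde x\|$ for all $x,\tilde x\in\mathcal X$, $i\in[m]$; $B_f>0$ is a constant with $\|\nabla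 f(x)\|\le B_f$ on $\mathcal X$. For a $\rho$-weakly convex $\psi$, $\partial\psi(x):=\partial(\psi+\frac\rho2\|\cdot\|^2)(x)-\rho x$, the right-hand subdifferential being the usual convex one. Augmented Lagrangian: $\mathcal L_\beta(x;y,z)=F(x)+y^\top(Ax-b)+\frac\beta2\|Ax-b\|^2+\frac\beta2\|[g(x)+\frac z\beta]_+\|^2-\frac{\|z\|^2}{2\beta}$. DPALM: choose $x^0\in\mathcal X$, $y^0\in\mathrm{Range}(A)$, $z^0\ge0$. For $k=0,1,\dots$: let $x^{k+1}$ be an approximate minimizer of $\widetilde{\mathcal L}_{\beta_k}(x;y^k,z^k):=\mathcal L_{\beta_k}(x;y^k,z^k)+\rho\|x-x^k\|^2$; set $y^{k+1}=y^k+\alpha_k(Ax^{k+1}-b)$, $z^{k+1}=z^k+\alpha_k\max\{-z^k/\beta_k,\,g(x^{k+1})\}$ (componentwise max), with $\alpha_k=\min\big\{\beta_k,\ v_k/\sqrt{\|Ax^{k+1}-b\|^2+\|[g(x^{k+1})]_+\|^2}\big\}$ and the convention $v/0=+\infty$ for $v>0$. $\varepsilon$-KKT point: $x\in\mathcal X$ for which there exist $y\in\mathbb R^n$, $z\in\mathbb R^m_+$ with $\max\{\operatorname{dist}(0,\partial F(x)+J_g(x)^\top z+A^\top y),\ \sqrt{\|Ax-b\|^2+\|[g(x)]_+\|^2},\ \sum_{i=1}^m|z_ig_i(x)|\}\le\varepsilon$ ($J_g$ is the Jacobian of $g$). Constants ($\lambda_{\min}^+$ = smallest positive eigenvalue,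 $\mathrm{bd}$ = boundary, $\dagger$ = pseudoinverse): $\tau=\min\{\frac{g_{\min}}{2\sqrt mB_g},\operatorname{dist}(x_{\rm feas},\mathrm{bd}(\mathcal X))\}$; $\overline B=D(r_h+B_f)+2\rho D^2+D+\tau(1+r_h+B_f+2\rho D)$; $\theta=\overline B/\min\{\tau\sqrt{\lambda_{\min}^+(AA^\top)},\frac{g_{\min}}2\}$; $B_p=\max\{\|(y^0,z^0)\|,\theta\}$; $Q=D(B_f+2\rho D+r_h)$; $C_1=\frac1D+\frac1{\operatorname{dist}(x_{\rm feas},\mathrm{bd}(\mathcal X))}+\frac{B_g}{g_{\min}}$; $\widehat C_p=2\Big(B_p+\sqrt{\frac{Q^2}{g_{\min}^2}+Q^2\|(AA^\top)^\dagger A\|^2C_1^2}\Big)+1$; $C_p=2\widehat C_p$; $C_x=2\max_{x\in\mathcal X}|F(x)|+\frac1{4\beta_0}(14C_p^2+8B_pC_p+7B_p^2)+(10C_p+4B_p)\frac{v_0}{\beta_0}+\frac{\beta_0}2\big(\|Ax^0-b\|^2+\|[g(x^0)+\frac{z^0}{\beta_0}]_+\|^2\big)+|\langle y^0,Ax^0-b\rangle|$. Splitting of the subproblem: $\widetilde{\mathcal L}_{\beta_k}(x;y^k,z^k)=\tilde f^k(x)+\tilde h^k(x)$ with $\tilde f^k(x)=\mathcal L_{\beta_k}(x;y^k,z^k)+\frac\rho2\|x-x^k\|^2-h(x)$ (convex, $L_{\tilde f^k}$-smooth with $L_{\tilde f^k}=C_3+\sqrt{k+1}\beta_0C_2$)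 and $\tilde h^k(x)=h(x)+\frac\rho2\|x-x^k\|^2$ ($\rho$-strongly convex). APG method (Nesterov) for $\min\phi=\tilde f+\tilde h$ with $\tilde f$ convex and $L_{\tilde f}$-smooth, $\tilde h$ closed and $\mu$-strongly convex; here applied to $\tilde f^k,\tilde h^k$ with $\mu=\rho$, $\gamma_u=2$ and tolerance $\Delta=\varepsilon_k$. For $L>0$ let $\mathcal M_L(y)=\mathrm{prox}_{\tilde h/L}(y-\frac1L\nabla\tilde f(y))$ and $\phi'(\mathcal M_L(y))=L(y-\mathcal M_L(y))+\nabla\tilde f(\mathcal M_L(y))-\nabla\tilde f(y)$. Choose a starting point $w^0$, a starting value $L_0>0$, and $\gamma_d\ge\gamma_u>1$; set $A_0=0$ (a scalar), $u^0=w^0$, $L=L_0$, $\psi_0=\frac12\|\cdot-w^0\|^2$. For $t=0,1,\dots$: take $a>0$ with $\frac{a^2}{A_t+a}=2\frac{1+\mu A_t}{L}$ and $y=\frac{A_tw^t+au^t}{A_t+a}$; while $\langle\phi'(\mathcal M_L(y)),y-\mathcal M_L(y)\rangle<\frac1L\|\phi'(\mathcal M_L(y))\|^2$, replace $L$ by $L\gamma_u$ and recompute $a$ and $y$ by the same formulas. Then set $w^{t+1}=\mathcal M_L(y)$, $a_{t+1}=a$, $A_{t+1}=A_t+a_{t+1}$, $\psi_{t+1}(x)=\psi_t(x)+a_{t+1}[\tilde f(w^{t+1})+\langle\nabla\tilde f(w^{t+1}),x-w^{t+1}\rangle+\tilde h(x)]$, $u^{t+1}=\arg\min\psi_{t+1}$,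 and replace $L$ by $L/\gamma_d$. Output $w^{t+1}$ and stop if $\operatorname{dist}(0,\partial\phi(w^{t+1}))\le\Delta$.
   Formalization: In the bound the logarithm is replaced by its positive part max(0, log), since for large ε or small D the stated right side can be negative; the APG starting points are taken in the domain of F and the starting values L_0 at most C_3+√(k+1)β_0C_2, for all such choices. *)

theory Defs
  imports "HOL-Analysis.Analysis"
begin

definition gradient :: "('a::euclidean_space \<Rightarrow> real) \<Rightarrow> 'a \<Rightarrow> 'a" where
  "gradient f x = (THE D. GDERIV f x :> D)"

definition L_smooth_on :: "real \<Rightarrow> 'a::euclidean_space set \<Rightarrow> ('a \<Rightarrow> real) \<Rightarrow> bool" where
  "L_smooth_on L S f \<longleftrightarrow> (\<forall>x\<in>S. f differentiable (at x)) \<and> L-lipschitz_on S (gradient f)"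

text \<open>Extended-valued functions \<open>\<real>\<^sup>d \<rightarrow> \<real> \<union> {+\<infinity>}\<close> have type \<open>'a \<Rightarrow> ereal\<close>; that they avoid
  \<open>-\<infinity>\<close> is stated where they are used.\<close>

definition edom :: "('a \<Rightarrow> ereal) \<Rightarrow> 'a set" where
  "edom \<psi> = {x. \<psi> x < \<infinity>}"

definition closed_convex :: "('a::euclidean_space \<Rightarrow> ereal) \<Rightarrow> bool" where
  "closed_convex \<psi> \<longleftrightarrow>
     (let epi = {(x, t::real). \<psi> x \<le> ereal t} in closed epi \<and> convex epi)"

definition subdiff :: "('a::euclidean_space \<Rightarrow> ereal) \<Rightarrow> 'a \<Rightarrow> 'a set" where
  "subdiff \<psi> x = {v. \<bar>\<psi> x\<bar> \<noteq> \<infinity> \<and> (\<forall>u. \<psi> x + ereal (v \<bullet> (u - x)) \<le> \<psi> u)}"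

definition weak_subdiff :: "real \<Rightarrow> ('a::euclidean_space \<Rightarrow> ereal) \<Rightarrow> 'a \<Rightarrow> 'a set" where
  "weak_subdiff \<rho> \<psi> x =
     (\<lambda>v. v - \<rho> *\<^sub>R x) ` subdiff (\<lambda>u. \<psi> u + ereal (\<rho> / 2 * (norm u)\<^sup>2)) x"

definition normal_cone :: "'a::euclidean_space set \<Rightarrow> 'a \<Rightarrow> 'a set" where
  "normal_cone X x = {v. \<forall>u\<in>X. v \<bullet> (u - x) \<le> 0}"

text \<open>Distance of a set to the origin. Unlike \<^const>\<open>infdist\<close>, which is \<open>0\<close> on the empty set,
  this is \<open>+\<infinity>\<close> there.\<close>

definition dist0 :: "'a::real_normed_vector set \<Rightarrow> ereal" where
  "dist0 S = (INF v\<in>S. ereal (norm v))"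

definition prox :: "('a::euclidean_space \<Rightarrow> ereal) \<Rightarrow> 'a \<Rightarrow> 'a" where
  "prox \<psi> v = (ARG_MIN (\<lambda>x. \<psi> x + ereal (1 / 2 * (norm (x - v))\<^sup>2)) x. True)"

text \<open>Smallest positive eigenvalue; meaningful only if there is one.\<close>

definition lambda_min_pos :: "real^'n^'n \<Rightarrow> real" where
  "lambda_min_pos M = (LEAST l. 0 < l \<and> (\<exists>v. v \<noteq> 0 \<and> M *v v = l *\<^sub>R v))"

definition pseudoinverse :: "real^'n^'m \<Rightarrow> real^'m^'n" where
  "pseudoinverse M = (THE P. M ** P ** M = M \<and> P ** M ** P = P \<and>
     transpose (M ** P) = M ** P \<and> transpose (P ** M) = P ** M)"

definition matrix_norm :: "real^'n^'m \<Rightarrow> real" where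
  "matrix_norm M = onorm (\<lambda>x. M *v x)"

definition pos :: "real^'m \<Rightarrow> real^'m" where
  "pos u = (\<chi> i. max 0 (u $ i))"

definition objective :: "(real^'d \<Rightarrow> real) \<Rightarrow> (real^'d \<Rightarrow> ereal) \<Rightarrow> real^'d \<Rightarrow> ereal" where
  "objective f h x = ereal (f x) + h x"

definition residual ::
  "real^'d^'n \<Rightarrow> real^'n \<Rightarrow> (real^'d \<Rightarrow> real^'m) \<Rightarrow> real^'d \<Rightarrow> real" where
  "residual A b g x = sqrt ((norm (A *v x - b))\<^sup>2 + (norm (pos (g x)))\<^sup>2)"

definition eps_KKT ::
  "real \<Rightarrow> (real^'d \<Rightarrow> ereal) \<Rightarrow> real^'d^'n \<Rightarrow> real^'n \<Rightarrow> (real^'d \<Rightarrow> real^'m) \<Rightarrow> real \<Rightarrow> real^'d \<Rightarrow> bool"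
where
  "eps_KKT \<rho> F A b g \<epsilon> x \<longleftrightarrow> x \<in> edom F \<and>
     (\<exists>y z. 0 \<le> z \<and>
        Max {dist0 ((\<lambda>v. v + transpose (jacobian g (at x)) *v z + transpose A *v y)
                       ` weak_subdiff \<rho> F x),
             ereal (residual A b g x),
             ereal (\<Sum>i\<in>UNIV. \<bar>z $ i * g x $ i\<bar>)} \<le> ereal \<epsilon>)"

definition penalty_terms ::
  "real^'d^'n \<Rightarrow> real^'n \<Rightarrow> (real^'d \<Rightarrow> real^'m) \<Rightarrow> real \<Rightarrow> real^'n \<Rightarrow> real^'m \<Rightarrow> real^'d \<Rightarrow> real" where
  "penalty_terms A b g \<beta> y z x =
     y \<bullet> (A *v x - b) + \<beta> / 2 * (norm (A *v x - b))\<^sup>2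
     + \<beta> / 2 * (norm (pos (g x + z /\<^sub>R \<beta>)))\<^sup>2 - (norm z)\<^sup>2 / (2 * \<beta>)"

definition aug_lagrangian ::
  "(real^'d \<Rightarrow> real) \<Rightarrow> (real^'d \<Rightarrow> ereal) \<Rightarrow> real^'d^'n \<Rightarrow> real^'n \<Rightarrow> (real^'d \<Rightarrow> real^'m) \<Rightarrow>
   real \<Rightarrow> real^'n \<Rightarrow> real^'m \<Rightarrow> real^'d \<Rightarrow> ereal" where
  "aug_lagrangian f h A b g \<beta> y z x = objective f h x + ereal (penalty_terms A b g \<beta> y z x)"

definition prox_aug_lagrangian ::
  "(real^'d \<Rightarrow> real) \<Rightarrow> (real^'d \<Rightarrow> ereal) \<Rightarrow> real^'d^'n \<Rightarrow> real^'n \<Rightarrow> (real^'d \<Rightarrow> real^'m) \<Rightarrow>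
   real \<Rightarrow> real \<Rightarrow> real^'n \<Rightarrow> real^'m \<Rightarrow> real^'d \<Rightarrow> real^'d \<Rightarrow> ereal" where
  "prox_aug_lagrangian f h A b g \<rho> \<beta> y z xk x =
     aug_lagrangian f h A b g \<beta> y z x + ereal (\<rho> * (norm (x - xk))\<^sup>2)"

text \<open>The subproblem splits as \<open>smooth_part + composite_part\<close>. The smooth part is the augmented
  Lagrangian without \<open>h\<close>; it is written without subtracting \<open>h\<close>, which would give
  \<open>\<infinity> - \<infinity>\<close> off the domain.\<close>

definition smooth_part ::
  "(real^'d \<Rightarrow> real) \<Rightarrow> real^'d^'n \<Rightarrow> real^'n \<Rightarrow> (real^'d \<Rightarrow> real^'m) \<Rightarrow>
   real \<Rightarrow> real \<Rightarrow> real^'n \<Rightarrow> real^'m \<Rightarrow> real^'d \<Rightarrow> real^'d \<Rightarrow> real" where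
  "smooth_part f A b g \<rho> \<beta> y z xk x =
     f x + penalty_terms A b g \<beta> y z x + \<rho> / 2 * (norm (x - xk))\<^sup>2"

definition composite_part ::
  "(real^'d \<Rightarrow> ereal) \<Rightarrow> real \<Rightarrow> real^'d \<Rightarrow> real^'d \<Rightarrow> ereal" where
  "composite_part h \<rho> xk x = h x + ereal (\<rho> / 2 * (norm (x - xk))\<^sup>2)"

definition prox_grad ::
  "('a::euclidean_space \<Rightarrow> real) \<Rightarrow> ('a \<Rightarrow> ereal) \<Rightarrow> real \<Rightarrow> 'a \<Rightarrow> 'a" where
  "prox_grad ft ht L y = prox (\<lambda>x. ht x / ereal L) (y - (1 / L) *\<^sub>R gradient ft y)"

definition grad_map ::
  "('a::euclidean_space \<Rightarrow> real) \<Rightarrow> ('a \<Rightarrow> ereal) \<Rightarrow> real \<Rightarrow> 'a \<Rightarrow> 'a" where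
  "grad_map ft ht L y =
     (let p = prox_grad ft ht L y in L *\<^sub>R (y - p) + gradient ft p - gradient ft y)"

definition apg_weight :: "real \<Rightarrow> real \<Rightarrow> real \<Rightarrow> real" where
  "apg_weight \<mu> A L = (THE a. 0 < a \<and> a\<^sup>2 / (A + a) = 2 * ((1 + \<mu> * A) / L))"

definition apg_point :: "real \<Rightarrow> real \<Rightarrow> real \<Rightarrow> 'a::euclidean_space \<Rightarrow> 'a \<Rightarrow> 'a" where
  "apg_point \<mu> A L w u =
     (let a = apg_weight \<mu> A L in (A *\<^sub>R w + a *\<^sub>R u) /\<^sub>R (A + a))"

definition apg_accept ::
  "('a::euclidean_space \<Rightarrow> real) \<Rightarrow> ('a \<Rightarrow> ereal) \<Rightarrow> real \<Rightarrow> 'a \<Rightarrow> bool" where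
  "apg_accept ft ht L y \<longleftrightarrow>
     grad_map ft ht L y \<bullet> (y - prox_grad ft ht L y) \<ge> 1 / L * (norm (grad_map ft ht L y))\<^sup>2"

text \<open>\<open>apg ft ht \<mu> \<gamma>u \<gamma>d \<Delta> w0 L0 T out\<close>: started from \<open>w0\<close>, \<open>L0\<close>, the scheme stops after
  exactly \<open>T\<close> iterations and returns \<open>out\<close>. \<open>L t\<close> is the value with which iteration \<open>t\<close> starts
  its line search, \<open>M t\<close> the value it accepts, that is, the first acceptable one among
  \<open>L t * \<gamma>u ^ i\<close>. Trial steps of the line search are not counted in \<open>T\<close>.\<close>

definition apg ::
  "('a::euclidean_space \<Rightarrow> real) \<Rightarrow> ('a \<Rightarrow> ereal) \<Rightarrow> real \<Rightarrow> real \<Rightarrow> real \<Rightarrow> real \<Rightarrow>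
   'a \<Rightarrow> real \<Rightarrow> nat \<Rightarrow> 'a \<Rightarrow> bool" where
  "apg ft ht \<mu> \<gamma>u \<gamma>d \<Delta> w0 L0 T out \<longleftrightarrow> 1 \<le> T \<and>
     (\<exists>(w :: nat \<Rightarrow> 'a) (u :: nat \<Rightarrow> 'a) (A :: nat \<Rightarrow> real) (a :: nat \<Rightarrow> real)
       (L :: nat \<Rightarrow> real) (M :: nat \<Rightarrow> real) (\<psi> :: nat \<Rightarrow> 'a \<Rightarrow> ereal).
        w 0 = w0 \<and> u 0 = w0 \<and> A 0 = 0 \<and> L 0 = L0 \<and>
        \<psi> 0 = (\<lambda>x. ereal (1 / 2 * (norm (x - w0))\<^sup>2)) \<and>
        (\<forall>t<T.
           (\<exists>j. M t = L t * \<gamma>u ^ j \<and>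
              (\<forall>i\<le>j. apg_accept ft ht (L t * \<gamma>u ^ i) (apg_point \<mu> (A t) (L t * \<gamma>u ^ i) (w t) (u t))
                       \<longleftrightarrow> i = j)) \<and>
           w (Suc t) = prox_grad ft ht (M t) (apg_point \<mu> (A t) (M t) (w t) (u t)) \<and>
           a (Suc t) = apg_weight \<mu> (A t) (M t) \<and>
           A (Suc t) = A t + a (Suc t) \<and>
           \<psi> (Suc t) = (\<lambda>x. \<psi> t x + ereal (a (Suc t)) *
              (ereal (ft (w (Suc t)) + gradient ft (w (Suc t)) \<bullet> (x - w (Suc t))) + ht x)) \<and>
           is_arg_min (\<psi> (Suc t)) (\<lambda>_. True) (u (Suc t)) \<and>
           L (Suc t) = M t / \<gamma>d \<and>
           (dist0 (subdiff (\<lambda>x. ereal (ft x) + ht x) (w (Suc t))) \<le> ereal \<Delta> \<longleftrightarrow> Suc t = T)) \<and>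
        out = w T)"

text \<open>The residual \<open>0\<close> is treated separately because the step size convention is
  \<open>v / 0 = +\<infinity>\<close> for \<open>v > 0\<close>.\<close>

definition damped_step ::
  "real^'d^'n \<Rightarrow> real^'n \<Rightarrow> (real^'d \<Rightarrow> real^'m) \<Rightarrow> real \<Rightarrow> real \<Rightarrow> real^'d \<Rightarrow> real" where
  "damped_step A b g \<beta> v x =
     (if residual A b g x = 0 then \<beta> else min \<beta> (v / residual A b g x))"

definition dpalm ::
  "(real^'d \<Rightarrow> real) \<Rightarrow> (real^'d \<Rightarrow> ereal) \<Rightarrow> real^'d^'n \<Rightarrow> real^'n \<Rightarrow> (real^'d \<Rightarrow> real^'m) \<Rightarrow> real \<Rightarrow>
   (nat \<Rightarrow> real) \<Rightarrow> (nat \<Rightarrow> real) \<Rightarrow> (nat \<Rightarrow> real) \<Rightarrow> real^'d \<Rightarrow> real^'n \<Rightarrow> real^'m \<Rightarrow>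
   (nat \<Rightarrow> real^'d) \<Rightarrow> (nat \<Rightarrow> real^'n) \<Rightarrow> (nat \<Rightarrow> real^'m) \<Rightarrow> bool" where
  "dpalm f h A b g \<rho> \<beta> v \<delta> x0 y0 z0 x y z \<longleftrightarrow>
     x 0 = x0 \<and> y 0 = y0 \<and> z 0 = z0 \<and>
     (\<forall>k. let \<alpha> = damped_step A b g (\<beta> k) (v k) (x (Suc k)) in
        dist0 (subdiff (prox_aug_lagrangian f h A b g \<rho> (\<beta> k) (y k) (z k) (x k)) (x (Suc k)))
          \<le> ereal (\<delta> k) \<and>
        y (Suc k) = y k + \<alpha> *\<^sub>R (A *v x (Suc k) - b) \<and>
        z (Suc k) = z k + \<alpha> *\<^sub>R (\<chi> i. max (- (z k $ i) / \<beta> k) (g (x (Suc k)) $ i)))"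

definition dpalm_apg ::
  "(real^'d \<Rightarrow> real) \<Rightarrow> (real^'d \<Rightarrow> ereal) \<Rightarrow> real^'d^'n \<Rightarrow> real^'n \<Rightarrow> (real^'d \<Rightarrow> real^'m) \<Rightarrow> real \<Rightarrow>
   (nat \<Rightarrow> real) \<Rightarrow> (nat \<Rightarrow> real) \<Rightarrow> (nat \<Rightarrow> real) \<Rightarrow> real^'d \<Rightarrow> real^'n \<Rightarrow> real^'m \<Rightarrow>
   real \<Rightarrow> real \<Rightarrow> (nat \<Rightarrow> real^'d) \<Rightarrow> (nat \<Rightarrow> real) \<Rightarrow>
   (nat \<Rightarrow> real^'d) \<Rightarrow> (nat \<Rightarrow> real^'n) \<Rightarrow> (nat \<Rightarrow> real^'m) \<Rightarrow> (nat \<Rightarrow> nat) \<Rightarrow> bool" where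
  "dpalm_apg f h A b g \<rho> \<beta> v \<delta> x0 y0 z0 \<gamma>u \<gamma>d w0 L0 x y z T \<longleftrightarrow>
     dpalm f h A b g \<rho> \<beta> v \<delta> x0 y0 z0 x y z \<and>
     (\<forall>k. apg (smooth_part f A b g \<rho> (\<beta> k) (y k) (z k) (x k)) (composite_part h \<rho> (x k))
            \<rho> \<gamma>u \<gamma>d (\<delta> k) (w0 k) (L0 k) (T k) (x (Suc k)))"

end

theory Submission
  imports Defs
begin

text \<open>Testing the stationarity of a subproblem at the Slater point shows that the norm of the
  undamped multiplier update exceeds neither the norm of the current multipliers nor \<open>\<theta>\<close>.
  The damped update is a convex combination, so all multipliers stay bounded by \<open>B\<^sub>p\<close>. Hence the
  constraint violation and the complementarity error are \<open>O(1 / \<beta>\<^sub>k)\<close>, which is small from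
  iteration \<open>K\<^sub>1\<close> on. For stationarity, each subproblem decreases the augmented Lagrangian by
  about \<open>\<rho>\<close> times the squared step length, while the increase caused by the changes of the
  multipliers and of \<open>\<beta>\<close> telescopes or is summable by the choice of the damping; so the step
  cannot be large in all of the next \<open>K\<^sub>2\<close> iterations.

  The number of inner iterations comes from Nesterov's estimate sequence argument. The smooth parts
  are convex and smooth only near the compact domain, so that the acceptance test of the line search
  needs cocoercivity of the gradient on a convex set instead of the whole space.\<close>

section \<open>Convexity and cocoercivity\<close>

text \<open>The data are controlled on the compact set \<open>X\<close> only, and \<open>h\<close>
  is infinite outside it. Each subgradient condition is therefore kept as an inequality between real
  functions, tested at points of \<open>X\<close>, and smooth summands are carried across it by
  one-sided directional derivatives.

  One constant \<open>M\<close> bounds both the current and the undamped multipliers. Their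
  difference is \<beta> times the constraint step, so the residual, the complementarity error and
  the lower bound of the penalty all follow from \<open>M\<close>.

  The proximal term has modulus \<open>2 * \<rho>\<close>, twice what weak convexity takes away. One
  half makes the smooth part of the subproblem convex, the other makes the composite part strongly
  convex; this gives the linear rate of the inner scheme and the descent of the outer one.

  Descent is counted from an iteration \<open>K1 \<ge> 1\<close>: after one update the penalty at
  the iterate is already of order \<open>M^2 / \<beta>\<close>, and the formula for the damping,
  whose logarithm vanishes at \<open>k = 0\<close>, is available.\<close>

lemma gradient_eqI: "GDERIV f x :> D \<Longrightarrow> gradient f x = D"
  unfolding gradient_def
proof (rule the_equality)
  fix E assume "GDERIV f x :> D" "GDERIV f x :> E"
  hence "(\<lambda>d. d \<bullet> E) = (\<lambda>d. d \<bullet> D)"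
    unfolding gderiv_def by (metis has_derivative_unique)
  thus "E = D" by (metis inner_commute vector_eq_ldot)
qed

lemma has_derivative_gradient:
  fixes f :: "'a::euclidean_space \<Rightarrow> real"
  assumes "f differentiable (at x)"
  shows "(f has_derivative (\<lambda>d. gradient f x \<bullet> d)) (at x)"
proof -
  obtain f' where f': "(f has_derivative f') (at x)"
    using assms unfolding differentiable_def by blast
  define D where "D = (\<Sum>i\<in>Basis. f' i *\<^sub>R i)"
  have lin: "linear f'" using f' has_derivative_linear by blast
  have "f' = (\<lambda>d. d \<bullet> D)"
  proof
    fix d
    have "f' d = f' (\<Sum>i\<in>Basis. (d \<bullet> i) *\<^sub>R i)" by (simp add: euclidean_representation)
    also have "\<dots> = (\<Sum>i\<in>Basis. (d \<bullet> i) * f' i)"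
      using lin by (simp add: linear_sum linear_cmul)
    also have "\<dots> = d \<bullet> D" unfolding D_def by (simp add: inner_sum_right mult.commute)
    finally show "f' d = d \<bullet> D" .
  qed
  with f' have "GDERIV f x :> D" unfolding gderiv_def by simp
  moreover from this have "gradient f x = D" by (rule gradient_eqI)
  ultimately show ?thesis unfolding gderiv_def by (simp add: inner_commute)
qed

lemma gradient_eq_derivative:
  fixes f :: "'a::euclidean_space \<Rightarrow> real"
  assumes "(f has_derivative (\<lambda>d. s \<bullet> d)) (at x)"
  shows "gradient f x = s"
  using assms by (intro gradient_eqI) (simp add: gderiv_def inner_commute)

text \<open>Along the segment from \<open>x\<close> to \<open>u\<close> the difference quotient of
  \<open>S\<close> tends to its derivative, while convexity bounds that of \<open>G\<close> by
  \<open>G u - G x\<close>. This sum rule for subgradients lets \<open>S\<close> be nonconvex and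
  differentiable at \<open>x\<close> alone; it serves to move smooth terms out of optimality
  conditions.\<close>

lemma convex_directional:
  fixes G S :: "'a::euclidean_space \<Rightarrow> real"
  assumes G: "convex_on X G" and S: "(S has_derivative (\<lambda>d. s \<bullet> d)) (at x)"
    and x: "x \<in> X" and u: "u \<in> X"
    and min: "\<And>u. u \<in> X \<Longrightarrow> G x + S x + v \<bullet> (u - x) \<le> G u + S u"
  shows "G x + (v - s) \<bullet> (u - x) \<le> G u"
proof -
  define d where "d = u - x"
  have "((\<lambda>t. S (x + t *\<^sub>R d)) has_derivative (\<lambda>t. s \<bullet> (t *\<^sub>R d))) (at 0)"
    by (rule has_derivative_compose[of "\<lambda>t. x + t *\<^sub>R d" "\<lambda>t. t *\<^sub>R d" 0 UNIV S "\<lambda>d. s \<bullet> d"])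
       (auto intro!: derivative_eq_intros S)
  hence "((\<lambda>t. S (x + t *\<^sub>R d)) has_real_derivative (s \<bullet> d)) (at 0)"
    unfolding has_field_derivative_def by (simp add: mult_commute_abs)
  hence "((\<lambda>t. (S (x + t *\<^sub>R d) - S x) / t) \<longlongrightarrow> s \<bullet> d) (at 0)"
    by (simp add: has_field_derivative_iff)
  hence lim: "((\<lambda>t. (S (x + t *\<^sub>R d) - S x) / t) \<longlongrightarrow> s \<bullet> d) (at_right 0)"
    by (rule filterlim_mono) (auto simp: at_within_le_nhds at_le)
  have "\<forall>\<^sub>F t in at_right 0. v \<bullet> d - (G u - G x) \<le> (S (x + t *\<^sub>R d) - S x) / t"
  proof -
    have "\<forall>\<^sub>F t in at_right (0::real). t \<in> {0<..<1}" by (rule eventually_at_right_real) simp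
    then show ?thesis
    proof eventually_elim
      fix t :: real assume "t \<in> {0<..<1}"
      hence t: "0 < t" "t < 1" by auto
      have eq: "x + t *\<^sub>R d = (1 - t) *\<^sub>R x + t *\<^sub>R u"
        unfolding d_def by (simp add: algebra_simps)
      have "x + t *\<^sub>R d \<in> X" unfolding eq
        using G x u t convexD_alt[of X x u t] by (auto simp: convex_on_def)
      moreover have "G (x + t *\<^sub>R d) \<le> (1 - t) * G x + t * G u" unfolding eq
        using convex_onD[OF G, of t x u] t x u by auto
      ultimately have "G x + S x + t * (v \<bullet> d) \<le> (1 - t) * G x + t * G u + S (x + t *\<^sub>R d)"
        using min[of "x + t *\<^sub>R d"] by (simp add: inner_scaleR_right)
      hence "t * (v \<bullet> d - (G u - G x)) \<le> S (x + t *\<^sub>R d) - S x" by (simp add: algebra_simps)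
      thus "v \<bullet> d - (G u - G x) \<le> (S (x + t *\<^sub>R d) - S x) / t"
        using t by (simp add: field_simps)
    qed
  qed
  hence "v \<bullet> d - (G u - G x) \<le> s \<bullet> d"
    by (intro tendsto_lowerbound[OF lim]) auto
  thus ?thesis unfolding d_def by (simp add: inner_diff_left)
qed

text \<open>For \<open>S = - f\<close> the sum is constantly zero, so the condition of
  \<open>convex_directional\<close> holds trivially with \<open>v = 0\<close>.\<close>

lemma convex_gradient_le:
  fixes f :: "'a::euclidean_space \<Rightarrow> real"
  assumes "convex_on X f" "(f has_derivative (\<lambda>d. s \<bullet> d)) (at x)" "x \<in> X" "u \<in> X"
  shows "f x + s \<bullet> (u - x) \<le> f u"
  using convex_directional[of X f "\<lambda>y. - f y" "- s" x u 0] assms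
  by (auto intro: derivative_eq_intros)

lemma has_derivative_sq_norm_diff:
  fixes c :: "'a::euclidean_space"
  shows "((\<lambda>x. m / 2 * (norm (x - c))\<^sup>2) has_derivative (\<lambda>d. (m *\<^sub>R (x - c)) \<bullet> d)) (at x)"
  unfolding power2_norm_eq_inner
  by (auto intro!: derivative_eq_intros simp: inner_commute algebra_simps)

text \<open>The quadratic takes the role of the smooth summand in \<open>convex_directional\<close>;
  completing the square at \<open>x\<close> then returns the extra term.\<close>

lemma strongly_convex_subgradient:
  fixes H :: "'a::euclidean_space \<Rightarrow> real"
  assumes cv: "convex_on X (\<lambda>x. H x - m / 2 * (norm x)\<^sup>2)"
    and "x \<in> X" "u \<in> X" "\<And>u. u \<in> X \<Longrightarrow> H x + v \<bullet> (u - x) \<le> H u"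
  shows "H x + v \<bullet> (u - x) + m / 2 * (norm (u - x))\<^sup>2 \<le> H u"
proof -
  have "(H x - m / 2 * (norm x)\<^sup>2) + (v - m *\<^sub>R x) \<bullet> (u - x) \<le> H u - m / 2 * (norm u)\<^sup>2"
    using convex_directional[OF cv has_derivative_sq_norm_diff[of m 0, unfolded diff_zero], of x u v] assms
    by simp
  thus ?thesis by (simp add: power2_norm_eq_inner algebra_simps inner_commute)
qed

lemma smooth_descent:
  fixes f :: "'a::euclidean_space \<Rightarrow> real"
  assumes "convex U" and d: "\<And>x. x \<in> U \<Longrightarrow> (f has_derivative (\<lambda>d. G x \<bullet> d)) (at x)"
    and lip: "\<And>x y. x \<in> U \<Longrightarrow> y \<in> U \<Longrightarrow> norm (G x - G y) \<le> L * norm (x - y)"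
    and x: "x \<in> U" and y: "y \<in> U"
  shows "f y \<le> f x + G x \<bullet> (y - x) + L / 2 * (norm (y - x))\<^sup>2"
proof -
  define d where "d = y - x"
  \<comment> \<open>\<open>f\<close> along the segment minus its quadratic upper model; the
    Lipschitz bound makes the derivative nonpositive.\<close>
  define p where "p t = f (x + t *\<^sub>R d) - t * (G x \<bullet> d) - L / 2 * t\<^sup>2 * (norm d)\<^sup>2" for t
  have mem: "x + t *\<^sub>R d \<in> U" if "0 \<le> t" "t \<le> 1" for t
    using convexD_alt[OF \<open>convex U\<close> x y that] by (simp add: d_def algebra_simps)
  have "p 1 \<le> p 0"
  proof (rule DERIV_nonpos_imp_nonincreasing[of 0 1 p])
    fix t :: real assume t: "t \<ge> 0" "t \<le> 1"
    have "((\<lambda>t. f (x + t *\<^sub>R d)) has_derivative (\<lambda>s. G (x + t *\<^sub>R d) \<bullet> (s *\<^sub>R d))) (at t)"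
      by (rule has_derivative_compose[of "\<lambda>t. x + t *\<^sub>R d" "\<lambda>t. t *\<^sub>R d" t UNIV f
             "\<lambda>e. G (x + t *\<^sub>R d) \<bullet> e"])
         (auto intro!: derivative_eq_intros d mem t)
    hence 1: "((\<lambda>t. f (x + t *\<^sub>R d)) has_real_derivative (G (x + t *\<^sub>R d) \<bullet> d)) (at t)"
      unfolding has_field_derivative_def by (simp add: mult_commute_abs)
    have "(p has_real_derivative
             (G (x + t *\<^sub>R d) \<bullet> d - G x \<bullet> d - L * t * (norm d)\<^sup>2)) (at t)"
      unfolding p_def by (auto intro!: derivative_eq_intros 1)
    moreover have "G (x + t *\<^sub>R d) \<bullet> d - G x \<bullet> d \<le> norm (G (x + t *\<^sub>R d) - G x) * norm d"
      by (metis inner_diff_left norm_cauchy_schwarz)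
    moreover have "norm (G (x + t *\<^sub>R d) - G x) * norm d \<le> (L * norm (t *\<^sub>R d)) * norm d"
      by (rule mult_right_mono) (use lip[OF mem[OF t] x] in auto)
    ultimately show "\<exists>y. (p has_real_derivative y) (at t) \<and> y \<le> 0"
      using t by (intro exI conjI) (auto simp: power2_eq_square)
  qed simp
  thus ?thesis unfolding p_def d_def by simp
qed

context
  fixes f :: "'a::euclidean_space \<Rightarrow> real" and G and U and L :: real
  assumes U: "convex U" "convex_on U f" and L: "0 < L"
    and d: "\<And>x. x \<in> U \<Longrightarrow> (f has_derivative (\<lambda>d. G x \<bullet> d)) (at x)"
    and lip: "\<And>x y. x \<in> U \<Longrightarrow> y \<in> U \<Longrightarrow> norm (G x - G y) \<le> L * norm (x - y)"
begin

text \<open>The function \<open>f\<close> tilted by \<open>- G x\<close> is minimal at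
  \<open>x\<close>, and a gradient step of length \<open>1 / L\<close> from \<open>y\<close> lowers
  it by the quadratic term. The third assumption keeps this step inside \<open>U\<close>, where
  descent and convexity are available.\<close>

lemma cocoercive_one_sided:
  assumes x: "x \<in> U" and y: "y \<in> U" and z: "y - (1 / L) *\<^sub>R (G y - G x) \<in> U"
  shows "f x + G x \<bullet> (y - x) + 1 / (2 * L) * (norm (G y - G x))\<^sup>2 \<le> f y"
proof -
  define e where "e = G y - G x"
  have a: "f x + G x \<bullet> (y - (1 / L) *\<^sub>R e - x) \<le> f (y - (1 / L) *\<^sub>R e)"
    using convex_gradient_le[OF U(2) d[OF x] x z] unfolding e_def .
  have b: "f (y - (1 / L) *\<^sub>R e) \<le> f y - (1 / L) * (G y \<bullet> e) + L / 2 * (norm ((1 / L) *\<^sub>R e))\<^sup>2"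
    using smooth_descent[OF U(1) d lip y z] unfolding e_def by simp
  have c: "L / 2 * (norm ((1 / L) *\<^sub>R e))\<^sup>2 = 1 / (2 * L) * (e \<bullet> e)"
    using L by (simp add: power_mult_distrib power_divide power2_norm_eq_inner)
       (simp add: power2_eq_square)
  have "G y \<bullet> e = e \<bullet> e + G x \<bullet> e" unfolding e_def by (simp add: inner_diff_left)
  with a b c have "f x + G x \<bullet> (y - x) - (1/L) * (G x \<bullet> e) \<le> f y - (1/L) * (e \<bullet> e) - (1/L) * (G x \<bullet> e) + 1/(2*L) * (e \<bullet> e)"
    by (simp add: inner_diff_right distrib_left add_divide_distrib)
  moreover have "(1/L) * (e \<bullet> e) = 2 * (1/(2*L) * (e \<bullet> e))" using L by simp
  ultimately show ?thesis unfolding power2_norm_eq_inner e_def[symmetric] by linarith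
qed

text \<open>Adding the one-sided bound to its mirror image cancels the function values. By the
  Lipschitz bound the trial points lie within \<open>norm (x - y)\<close> of \<open>y\<close> and of
  \<open>x\<close>, which explains the two balls.\<close>

lemma cocoercive_local:
  assumes x: "x \<in> U" and y: "y \<in> U" and r: "cball x (norm (x - y)) \<subseteq> U" "cball y (norm (x - y)) \<subseteq> U"
  shows "1 / L * (norm (G x - G y))\<^sup>2 \<le> (G x - G y) \<bullet> (x - y)"
proof -
  have n: "norm ((1 / L) *\<^sub>R (G x - G y)) \<le> norm (x - y)"
    using lip[OF x y] L by (simp add: divide_le_eq mult.commute del: scaleR_diff_right scaleR_right_diff_distrib)
  have "y - (1 / L) *\<^sub>R (G y - G x) \<in> U"
    by (rule subsetD[OF r(2)]) (use n in \<open>simp add: dist_norm norm_minus_commute\<close>)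
  note 1 = cocoercive_one_sided[OF x y this]
  have "x - (1 / L) *\<^sub>R (G x - G y) \<in> U"
    by (rule subsetD[OF r(1)]) (use n in \<open>simp add: dist_norm norm_minus_commute\<close>)
  note 2 = cocoercive_one_sided[OF y x this]
  have "1 / L * (norm (G x - G y))\<^sup>2 = 2 * (1 / (2*L) * (norm (G x - G y))\<^sup>2)" using L by simp
  with 1 2 show ?thesis
    by (simp add: norm_minus_commute[of "G y"] algebra_simps)
qed

text \<open>The usual proof of cocoercivity needs auxiliary points outside the segment. They stay
  inside the open set if the two points are close enough, and cocoercivity on short pieces of the
  segment adds up to the whole segment by the Cauchy-Schwarz inequality.\<close>

lemma cocoercive_open:
  assumes "open U" and x: "x \<in> U" and y: "y \<in> U"
  shows "1 / L * (norm (G x - G y))\<^sup>2 \<le> (G x - G y) \<bullet> (x - y)"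
proof -
  have "closed_segment x y \<subseteq> U" using U x y by (simp add: closed_segment_subset)
  then obtain r where r: "r > 0" "\<And>p. p \<in> closed_segment x y \<Longrightarrow> ball p r \<subseteq> U"
    using compact_subset_open_imp_ball_epsilon_subset[OF compact_segment[of x y] \<open>open U\<close>]
    by (metis UN_subset_iff)
  obtain N :: nat where N: "norm (x - y) / r < real N" using reals_Archimedean2 by blast
  have Npos: "0 < N" using N r
    by (metis divide_nonneg_pos gr0I norm_ge_zero of_nat_0 not_le)
  define p where "p i = x + (real i / real N) *\<^sub>R (y - x)" for i
  have seg: "p i \<in> closed_segment x y" if "i \<le> N" for i
    using that Npos unfolding p_def in_segment
    by (intro exI[of _ "real i / real N"]) (auto simp: algebra_simps)
  have step: "p i - p (Suc i) = (1 / real N) *\<^sub>R (x - y)" for i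
    unfolding p_def by (simp add: algebra_simps add_divide_distrib)
  have small: "norm (p i - p (Suc i)) < r" for i
    unfolding step using N r Npos by (simp add: divide_less_eq mult.commute del: scaleR_right_diff_distrib)
  define e where "e i = G (p i) - G (p (Suc i))" for i
  have loc: "1 / L * (norm (e i))\<^sup>2 \<le> e i \<bullet> ((1 / real N) *\<^sub>R (x - y))" if "i < N" for i
  proof -
    have "p i \<in> U" "p (Suc i) \<in> U" using r seg[of i] seg[of "Suc i"] that by force+
    moreover have "cball (p i) (norm (p i - p (Suc i))) \<subseteq> U" "cball (p (Suc i)) (norm (p i - p (Suc i))) \<subseteq> U"
      using r(2)[OF seg[of i]] r(2)[OF seg[of "Suc i"]] small[of i] that
      by (auto simp: subset_iff)
    ultimately show ?thesis unfolding e_def using cocoercive_local step by metis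
  qed
  have sum_e: "(\<Sum>i<N. e i) = G x - G y"
  proof -
    have "(\<Sum>i<n. e i) = G (p 0) - G (p n)" for n by (induction n) (auto simp: e_def)
    thus ?thesis using Npos unfolding p_def by simp
  qed
  \<comment> \<open>Cauchy-Schwarz over the \<open>N\<close> pieces costs a factor \<open>N\<close>;
    each piece carries \<open>(x - y) / N\<close>, which pays it back.\<close>
  have "(norm (G x - G y))\<^sup>2 \<le> (\<Sum>i<N. norm (e i))\<^sup>2"
    unfolding sum_e[symmetric] by (intro power_mono norm_sum) auto
  also have "\<dots> \<le> (\<Sum>i<N. (norm (e i))\<^sup>2) * real N"
    using sum_squared_le_sum_of_squares[of "\<lambda>i. norm (e i)" "{..<N}"] by simp
  finally have "1 / L * (norm (G x - G y))\<^sup>2 \<le> 1 / L * ((\<Sum>i<N. (norm (e i))\<^sup>2) * real N)"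
    using L by (intro mult_left_mono) auto
  also have "\<dots> = real N * (\<Sum>i<N. 1 / L * (norm (e i))\<^sup>2)"
    by (simp add: sum_distrib_left sum_distrib_right mult_ac)
  also have "\<dots> \<le> real N * (\<Sum>i<N. e i \<bullet> ((1 / real N) *\<^sub>R (x - y)))"
    by (intro mult_left_mono sum_mono loc) auto
  also have "\<dots> = (G x - G y) \<bullet> (x - y)"
    unfolding sum_e[symmetric] using Npos
    by (simp add: inner_sum_left sum_divide_distrib[symmetric])
  finally show ?thesis .
qed

end

text \<open>Contraction towards an interior point \<open>c\<close> moves both points into the open
  set \<open>interior X\<close>, where the previous result applies. The Lipschitz bound makes
  \<open>G\<close> continuous on \<open>X\<close>, so the inequality passes to the limit.\<close>

lemma cocoercive_closed:
  fixes f :: "'a::euclidean_space \<Rightarrow> real"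
  assumes X: "convex X" "convex_on X f" "interior X \<noteq> {}" and L: "0 < L"
    and d: "\<And>x. x \<in> X \<Longrightarrow> (f has_derivative (\<lambda>d. G x \<bullet> d)) (at x)"
    and lip: "\<And>x y. x \<in> X \<Longrightarrow> y \<in> X \<Longrightarrow> norm (G x - G y) \<le> L * norm (x - y)"
    and x: "x \<in> X" and y: "y \<in> X"
  shows "1 / L * (norm (G x - G y))\<^sup>2 \<le> (G x - G y) \<bullet> (x - y)"
proof -
  obtain c where c: "c \<in> interior X" using X by auto
  define q where "q z n = z - (1 / real (Suc n)) *\<^sub>R (z - c)" for z n
  have qint: "q z n \<in> interior X" if "z \<in> X" for z n
    unfolding q_def using mem_interior_convex_shrink[OF X(1) c that, of "1 / real (Suc n)"] by auto
  hence qX: "q z n \<in> X" if "z \<in> X" for z n using that interior_subset by blast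
  have lim: "q z \<longlonglongrightarrow> z" for z
  proof -
    have "(\<lambda>n. z - (1 / real (Suc n)) *\<^sub>R (z - c)) \<longlonglongrightarrow> z - 0 *\<^sub>R (z - c)"
      by (intro tendsto_intros LIMSEQ_inverse_real_of_nat[unfolded inverse_eq_divide])
    thus ?thesis unfolding q_def by (simp add: fun_eq_iff)
  qed
  have cont: "continuous_on X G"
    using lip L by (intro lipschitz_on_continuous_on[of L] lipschitz_onI) (auto simp: dist_norm)
  have limG: "(\<lambda>n. G (q z n)) \<longlonglongrightarrow> G z" if "z \<in> X" for z
    using cont that qX[OF that] lim[of z] by (auto simp: continuous_on_sequentially comp_def)
  have "1 / L * (norm (G (q x n) - G (q y n)))\<^sup>2 \<le> (G (q x n) - G (q y n)) \<bullet> (q x n - q y n)" for n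
    by (rule cocoercive_open[of "interior X" f L G])
       (use X L d lip qint x y interior_subset[of X] in
         \<open>auto intro: convex_on_subset convex_interior simp: subset_iff\<close>)
  moreover have "(\<lambda>n. 1 / L * (norm (G (q x n) - G (q y n)))\<^sup>2) \<longlonglongrightarrow> 1 / L * (norm (G x - G y))\<^sup>2"
    by (intro tendsto_intros limG x y)
  moreover have "(\<lambda>n. (G (q x n) - G (q y n)) \<bullet> (q x n - q y n)) \<longlonglongrightarrow> (G x - G y) \<bullet> (x - y)"
    by (intro tendsto_intros limG x y lim)
  ultimately show ?thesis by (intro LIMSEQ_le) auto
qed

section \<open>The accelerated proximal gradient method\<close>

definition extend_inf :: "'a set \<Rightarrow> ('a \<Rightarrow> real) \<Rightarrow> 'a \<Rightarrow> ereal" where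
  "extend_inf X r x = (if x \<in> X then ereal (r x) else \<infinity>)"

lemma subdiff_extend_inf_iff:
  "v \<in> subdiff (extend_inf X r) x \<longleftrightarrow> x \<in> X \<and> (\<forall>u\<in>X. r x + v \<bullet> (u - x) \<le> r u)"
  unfolding subdiff_def extend_inf_def by auto

lemma is_arg_min_extend_inf:
  assumes "X \<noteq> {}" and in_X: "\<And>x. x \<in> X \<Longrightarrow> \<Psi> x = ereal (r x)" and out_X: "\<And>x. x \<notin> X \<Longrightarrow> \<Psi> x = \<infinity>"
  shows "is_arg_min \<Psi> (\<lambda>_. True) p \<longleftrightarrow> p \<in> X \<and> (\<forall>u\<in>X. r p \<le> r u)"
proof
  assume *: "is_arg_min \<Psi> (\<lambda>_. True) p"
  obtain q where q: "q \<in> X" using assms by auto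
  have le: "\<Psi> p \<le> \<Psi> u" for u using * by (auto simp: is_arg_min_def not_less)
  have "p \<in> X" using le[of q] in_X[OF q] out_X[of p] by fastforce
  moreover have "r p \<le> r u" if "u \<in> X" for u
    using le[of u] in_X[OF that] in_X[OF \<open>p \<in> X\<close>] by simp
  ultimately show "p \<in> X \<and> (\<forall>u\<in>X. r p \<le> r u)" by blast
next
  assume *: "p \<in> X \<and> (\<forall>u\<in>X. r p \<le> r u)"
  have "\<not> \<Psi> u < \<Psi> p" for u
    using * in_X out_X by (cases "u \<in> X") (auto simp: not_less)
  thus "is_arg_min \<Psi> (\<lambda>_. True) p" by (auto simp: is_arg_min_def)
qed

lemma dist0_leI: "v \<in> S \<Longrightarrow> norm v \<le> \<delta> \<Longrightarrow> dist0 S \<le> ereal \<delta>"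
  unfolding dist0_def by (rule INF_lower2) auto

text \<open>The infimum in \<open>dist0\<close> is attained: the subdifferential is an intersection
  of closed half-spaces, and it is nonempty because \<open>dist0 {}\<close> is infinite.
  Nonemptiness also places \<open>x\<close> in \<open>X\<close>.\<close>

lemma dist0_subdiff_extend_inf_leD:
  fixes r :: "'a::euclidean_space \<Rightarrow> real"
  assumes "dist0 (subdiff (extend_inf X r) x) \<le> ereal \<delta>"
  obtains v where "x \<in> X" "\<And>u. u \<in> X \<Longrightarrow> r x + v \<bullet> (u - x) \<le> r u" "norm v \<le> \<delta>"
proof -
  define S where "S = subdiff (extend_inf X r) x"
  have ne: "S \<noteq> {}" using assms unfolding dist0_def S_def by (auto simp: top_ereal_def)
  hence x: "x \<in> X" unfolding S_def by (auto simp: subdiff_extend_inf_iff)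
  have "S = (\<Inter>u\<in>X. {v. v \<bullet> (u - x) \<le> r u - r x})"
    unfolding S_def using x by (auto simp: subdiff_extend_inf_iff algebra_simps)
  also have "closed \<dots>" by (intro closed_INT ballI closed_Collect_le continuous_intros)
  finally have "closed S" .
  then obtain v where v: "v \<in> S" "\<And>w. w \<in> S \<Longrightarrow> dist 0 v \<le> dist 0 w"
    using distance_attains_inf ne by blast
  have "ereal (norm v) \<le> dist0 S" unfolding dist0_def using v by (intro INF_greatest) auto
  with assms have "norm v \<le> \<delta>" unfolding S_def[symmetric] by (metis ereal_less_eq(3) order_trans)
  with v x that show ?thesis unfolding S_def by (auto simp: subdiff_extend_inf_iff)
qed

text \<open>The derivative of the difference is \<open>x^2 / ((1 + x) (2 + x)^2)\<close>. For
  \<open>s > 0\<close> the bound reads \<open>1 / ln (1 + s) \<le> 1 / s + 1 / 2\<close>, which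
  turns a geometric rate into an iteration count; \<open>s = 1\<close> gives
  \<open>ln 2 \<ge> 2 / 3\<close>.\<close>

lemma ln_one_plus_ge:
  fixes s :: real assumes "0 \<le> s" shows "2 * s / (2 + s) \<le> ln (1 + s)"
proof -
  define p where "p x = ln (1 + x) - 2 * x / (2 + x)" for x :: real
  have "p 0 \<le> p s"
  proof (rule DERIV_nonneg_imp_nondecreasing[OF assms])
    fix x :: real assume x: "0 \<le> x" "x \<le> s"
    have "(p has_real_derivative (1 / (1 + x) - 4 / (2 + x)\<^sup>2)) (at x)"
      unfolding p_def using x
      by (auto intro!: derivative_eq_intros simp: power2_eq_square field_simps)
    moreover have "1 / (1 + x) - 4 / (2 + x)\<^sup>2 = x\<^sup>2 / ((1 + x) * (2 + x)\<^sup>2)"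
      using x by (simp add: divide_simps) (simp add: power2_eq_square algebra_simps)
    ultimately show "\<exists>y. (p has_real_derivative y) (at x) \<and> 0 \<le> y" using x by auto
  qed
  thus ?thesis unfolding p_def by simp
qed

text \<open>\<open>apg_weight\<close> is a definite description, so existence and uniqueness of the
  positive root of \<open>a^2 = c (A + a)\<close> come before any use of it.\<close>

lemma apg_weight_eq:
  assumes "0 \<le> A" "0 < \<mu>" "0 < M"
  shows "0 < apg_weight \<mu> A M" (is ?pos)
    and "(apg_weight \<mu> A M)\<^sup>2 = 2 * (1 + \<mu> * A) / M * (A + apg_weight \<mu> A M)" (is ?eq)
proof -
  define c where "c = 2 * ((1 + \<mu> * A) / M)"
  have c: "0 < c" unfolding c_def using assms by (auto intro!: divide_pos_pos add_pos_nonneg)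
  define a where "a = (c + sqrt (c\<^sup>2 + 4 * c * A)) / 2"
  have iff: "0 < a' \<and> a'\<^sup>2 / (A + a') = c \<longleftrightarrow> 0 < a' \<and> a'\<^sup>2 = c * (A + a')" for a' :: real
    using assms by (cases "0 < a'") (simp_all add: divide_eq_eq)
  have "c\<^sup>2 + 4 * c * A \<ge> 0" using c assms by simp
  hence aeq: "0 < a \<and> a\<^sup>2 = c * (A + a)" unfolding a_def using c
    by (auto simp: power2_eq_square field_simps add_pos_nonneg)
  \<comment> \<open>Two distinct roots would sum to \<open>c\<close>, but a positive root is at
    least \<open>c\<close>.\<close>
  have uniq: "a' = a" if "0 < a' \<and> a'\<^sup>2 = c * (A + a')" for a'
  proof (rule ccontr)
    assume ne: "a' \<noteq> a"
    have "(a' - a) * (a' + a) = c * (a' - a)" using that aeq by (simp add: power2_eq_square algebra_simps)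
    with ne have "a' + a = c" by simp
    moreover have "a * a \<ge> c * a" using aeq c assms by (simp add: power2_eq_square distrib_left)
    hence "a \<ge> c" using aeq by simp
    ultimately show False using that by simp
  qed
  have "apg_weight \<mu> A M = a" unfolding apg_weight_def c_def[symmetric] iff
    using aeq uniq by (intro the_equality) blast+
  thus ?pos ?eq using aeq unfolding c_def by simp_all
qed

text \<open>The difference \<open>(A + a) - A\<close> factors over the square roots, so
  \<open>a \<le> 2 sqrt (A + a) (sqrt (A + a) - sqrt A)\<close>. Compared with the assumed lower
  bound for \<open>a\<close>, one factor \<open>sqrt (A + a)\<close> cancels.\<close>

lemma sqrt_growth:
  fixes A a :: real
  assumes "0 \<le> A" "0 < a" "0 < L" "0 < \<mu>" "\<mu> * A / L * (A + a) \<le> a\<^sup>2"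
  shows "(1 + sqrt (\<mu> / L) / 2) * sqrt A \<le> sqrt (A + a)"
proof -
  define p where "p = sqrt (A + a)"
  define q where "q = sqrt A"
  have p: "0 < p" "p\<^sup>2 = A + a" and q: "0 \<le> q" "q\<^sup>2 = A" "q \<le> p"
    unfolding p_def q_def using assms by auto
  define s where "s = sqrt (\<mu> / L)"
  have s: "0 \<le> s" "s\<^sup>2 = \<mu> / L" unfolding s_def using assms by auto
  have "(s * q * p)\<^sup>2 \<le> a\<^sup>2"
    using assms(5) s p q by (simp add: power_mult_distrib)
  hence "s * q * p \<le> a" using assms(2) by (metis abs_le_square_iff abs_of_pos abs_le_D1)
  also have "a = (p - q) * (p + q)" using p q by (simp add: power2_eq_square algebra_simps)
  also have "\<dots> \<le> (p - q) * (2 * p)" using q by (intro mult_left_mono) auto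
  finally have "(s * q) * p \<le> (2 * (p - q)) * p" by (simp add: algebra_simps)
  hence "s * q \<le> 2 * (p - q)" using p by simp
  thus ?thesis unfolding p_def[symmetric] q_def[symmetric] s_def[symmetric] by (simp add: algebra_simps)
qed

lemma convex_on_norm_sq:
  fixes X :: "'a::real_inner set"
  assumes "convex X" "0 \<le> c"
  shows "convex_on X (\<lambda>x. c * (norm x)\<^sup>2)"
proof (rule convex_onI[OF _ assms(1)])
  fix t :: real and x y :: 'a
  assume t: "0 < t" "t < 1"
  have "(1 - t) * (norm x)\<^sup>2 + t * (norm y)\<^sup>2 - (norm ((1 - t) *\<^sub>R x + t *\<^sub>R y))\<^sup>2
      = t * (1 - t) * (norm (x - y))\<^sup>2"
    by (simp add: power2_norm_eq_inner inner_add_left inner_add_right inner_diff_left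
        inner_diff_right inner_commute algebra_simps)
  also have "\<dots> \<ge> 0" using t by simp
  finally have "c * (norm ((1 - t) *\<^sub>R x + t *\<^sub>R y))\<^sup>2 \<le> c * ((1 - t) * (norm x)\<^sup>2 + t * (norm y)\<^sup>2)"
    using assms(2) by (intro mult_left_mono) auto
  thus "c * (norm ((1 - t) *\<^sub>R x + t *\<^sub>R y))\<^sup>2 \<le> (1 - t) * (c * (norm x)\<^sup>2) + t * (c * (norm y)\<^sup>2)"
    by (simp add: algebra_simps)
qed

lemma convex_on_affine: "convex X \<Longrightarrow> convex_on X (\<lambda>x. c + v \<bullet> x)" for v :: "'a::real_inner"
  by (intro convex_onI)
     (auto simp: inner_add_right inner_scaleR_right algebra_simps)

text \<open>What an iteration hands to the next one: \<open>w\<close>, \<open>u\<close>,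
  \<open>A\<close>, \<open>L\<close> and \<psi>, bundled for the dependent choice that builds a
  run.\<close>

type_synonym 'a apg_state = "'a \<times> 'a \<times> real \<times> real \<times> ('a \<Rightarrow> ereal)"

text \<open>Cocoercivity is assumed in place of a Lipschitz gradient: it is exactly what the
  acceptance test asks for, and on a set other than the whole space it needs its own
  argument.\<close>

locale composite_problem =
  fixes X :: "'a::euclidean_space set" and ft hr :: "'a \<Rightarrow> real" and \<mu> Lc D :: real
  assumes X_compact: "compact X" and X_nonempty: "X \<noteq> {}"
    and ft_convex: "convex_on X ft"
    and ft_diff: "\<And>x. x \<in> X \<Longrightarrow> ft differentiable (at x)"
    and cocoercive: "\<And>x y. x \<in> X \<Longrightarrow> y \<in> X \<Longrightarrow>
      1 / Lc * (norm (gradient ft x - gradient ft y))\<^sup>2 \<le> (gradient ft x - gradient ft y) \<bullet> (x - y)"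
    and hr_cont: "continuous_on X hr"
    and hr_strongly_convex: "convex_on X (\<lambda>x. hr x - \<mu> / 2 * (norm x)\<^sup>2)"
    and \<mu>_pos: "0 < \<mu>" and \<mu>_le: "\<mu> \<le> Lc"
    and diam: "\<And>x y. x \<in> X \<Longrightarrow> y \<in> X \<Longrightarrow> norm (x - y) \<le> D"
begin

lemma Lc_pos: "0 < Lc" using \<mu>_pos \<mu>_le by simp

abbreviation "ht \<equiv> extend_inf X hr"

lemma X_convex: "convex X" using ft_convex by (simp add: convex_on_def)

lemma hr_convex: "convex_on X hr"
proof -
  have "convex_on X (\<lambda>x. (hr x - \<mu> / 2 * (norm x)\<^sup>2) + \<mu> / 2 * (norm x)\<^sup>2)"
    using \<mu>_pos X_convex
    by (intro convex_on_add hr_strongly_convex convex_on_norm_sq) auto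
  thus ?thesis by simp
qed

lemma ft_has_derivative: "x \<in> X \<Longrightarrow> (ft has_derivative (\<lambda>d. gradient ft x \<bullet> d)) (at x)"
  by (intro has_derivative_gradient ft_diff)

lemma ft_tangent: "x \<in> X \<Longrightarrow> u \<in> X \<Longrightarrow> ft x + gradient ft x \<bullet> (u - x) \<le> ft u"
  by (rule convex_gradient_le[OF ft_convex ft_has_derivative])

lemma prox_ht:
  fixes v :: 'a
  assumes "0 < L"
  defines "p \<equiv> prox (\<lambda>x. ht x / ereal L) v"
  shows "p \<in> X" and "\<And>u. u \<in> X \<Longrightarrow> hr p + (L *\<^sub>R (v - p)) \<bullet> (u - p) \<le> hr u"
proof -
  let ?\<Psi> = "\<lambda>x. ht x / ereal L + ereal (1 / 2 * (norm (x - v))\<^sup>2)"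
  let ?r = "\<lambda>x. hr x / L + 1 / 2 * (norm (x - v))\<^sup>2"
  have iff: "is_arg_min ?\<Psi> (\<lambda>_. True) q \<longleftrightarrow> q \<in> X \<and> (\<forall>u\<in>X. ?r q \<le> ?r u)" for q
    using X_nonempty assms(1) by (intro is_arg_min_extend_inf) (auto simp: extend_inf_def)
  have "continuous_on X ?r" using assms(1) by (intro continuous_intros hr_cont) auto
  then obtain q where "q \<in> X" "\<forall>u\<in>X. ?r q \<le> ?r u"
    using continuous_attains_inf[OF X_compact X_nonempty] by blast
  hence "is_arg_min ?\<Psi> (\<lambda>_. True) q" using iff by blast
  hence "is_arg_min ?\<Psi> (\<lambda>_. True) p" unfolding p_def prox_def arg_min_def by (rule someI)
  hence p: "p \<in> X" "\<And>u. u \<in> X \<Longrightarrow> ?r p \<le> ?r u" using iff by auto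
  show "p \<in> X" by fact
  fix u assume u: "u \<in> X"
  have "convex_on X (\<lambda>x. (1 / L) * hr x)" using hr_convex assms(1) by (intro convex_on_cmul) auto
  from convex_directional[OF this has_derivative_sq_norm_diff[of 1 v] p(1) u, of 0] p(2)
  have "hr p / L + (v - p) \<bullet> (u - p) \<le> hr u / L" by simp
  hence "L * (hr p / L + (v - p) \<bullet> (u - p)) \<le> L * (hr u / L)"
    using assms(1) by (intro mult_left_mono) auto
  thus "hr p + (L *\<^sub>R (v - p)) \<bullet> (u - p) \<le> hr u" using assms(1) by (simp add: distrib_left)
qed

text \<open>Optimality of the proximal point. Added to the tangent of \<open>ft\<close>, it makes
  \<open>grad_map\<close> a subgradient of \<open>ft + hr\<close> there, so that the norm of
  \<open>grad_map\<close> bounds the stationarity.\<close>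

lemma grad_map_subgradient:
  assumes "0 < L" "y \<in> X"
  shows "prox_grad ft ht L y \<in> X"
    and "\<And>u. u \<in> X \<Longrightarrow> hr (prox_grad ft ht L y) +
      (grad_map ft ht L y - gradient ft (prox_grad ft ht L y)) \<bullet> (u - prox_grad ft ht L y) \<le> hr u"
proof -
  note * = prox_ht[OF assms(1), where v = "y - (1 / L) *\<^sub>R gradient ft y", folded prox_grad_def]
  show "prox_grad ft ht L y \<in> X" by (rule *)
  fix u assume "u \<in> X"
  have "grad_map ft ht L y - gradient ft (prox_grad ft ht L y)
      = L *\<^sub>R (y - (1 / L) *\<^sub>R gradient ft y - prox_grad ft ht L y)"
    using assms(1) unfolding grad_map_def Let_def by (simp add: scaleR_diff_right)
  with *(2)[OF \<open>u \<in> X\<close>] show "hr (prox_grad ft ht L y) +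
      (grad_map ft ht L y - gradient ft (prox_grad ft ht L y)) \<bullet> (u - prox_grad ft ht L y) \<le> hr u"
    by simp
qed

text \<open>With \<open>d = y - p\<close> and \<open>e\<close> the difference of the gradients,
  \<open>grad_map\<close> is \<open>L d - e\<close>, and expanding the square reduces the acceptance
  test to \<open>e \<bullet> d \<ge> 1 / L * (norm e)^2\<close>, which is cocoercivity.\<close>

lemma apg_accept_large:
  assumes L: "Lc \<le> L" and y: "y \<in> X"
  shows "apg_accept ft ht L y"
proof -
  have Lpos: "0 < L" using L Lc_pos by simp
  define p where "p = prox_grad ft ht L y"
  have p: "p \<in> X" unfolding p_def by (rule grad_map_subgradient[OF Lpos y])
  define d where "d = y - p"
  define e where "e = gradient ft y - gradient ft p"
  have gm: "grad_map ft ht L y = L *\<^sub>R d - e"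
    unfolding grad_map_def Let_def d_def e_def p_def by simp
  have "1 / L * (norm e)\<^sup>2 \<le> 1 / Lc * (norm e)\<^sup>2"
    using L Lc_pos by (intro mult_right_mono) (auto simp: frac_le)
  also have "\<dots> \<le> e \<bullet> d" unfolding e_def d_def by (rule cocoercive[OF y p])
  finally have ed: "1 / L * (norm e)\<^sup>2 \<le> e \<bullet> d" .
  have "1 / L * (norm (L *\<^sub>R d - e))\<^sup>2 = L * (d \<bullet> d) - 2 * (e \<bullet> d) + 1 / L * (norm e)\<^sup>2"
    using Lpos by (simp add: power2_norm_eq_inner inner_diff_left inner_diff_right inner_commute field_simps)
  also have "\<dots> \<le> L * (d \<bullet> d) - e \<bullet> d" using ed by simp
  also have "\<dots> = (L *\<^sub>R d - e) \<bullet> d" by (simp add: inner_diff_left)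
  finally show ?thesis unfolding apg_accept_def gm p_def[symmetric] d_def .
qed

lemma apg_point_eq:
  assumes "0 \<le> A" "0 < M"
  shows "(A + apg_weight \<mu> A M) *\<^sub>R apg_point \<mu> A M w u = A *\<^sub>R w + apg_weight \<mu> A M *\<^sub>R u"
  using apg_weight_eq(1)[OF assms(1) \<mu>_pos assms(2)] assms unfolding apg_point_def Let_def by simp

lemma apg_point_in:
  assumes "0 \<le> A" "0 < M" "w \<in> X" "u \<in> X"
  shows "apg_point \<mu> A M w u \<in> X"
proof -
  define a where "a = apg_weight \<mu> A M"
  have a: "0 < a" unfolding a_def by (rule apg_weight_eq(1)[OF assms(1) \<mu>_pos assms(2)])
  have "(A / (A + a)) *\<^sub>R w + (a / (A + a)) *\<^sub>R u \<in> X"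
    using assms a by (intro convexD[OF X_convex]) (auto simp: add_divide_distrib[symmetric])
  thus ?thesis unfolding apg_point_def Let_def a_def[symmetric]
    by (simp add: scaleR_add_right divide_inverse mult.commute)
qed

section \<open>Single iterations and the estimate sequence\<close>

definition phi :: "'a \<Rightarrow> real" where "phi x = ft x + hr x"

abbreviation "stationarity x \<equiv> dist0 (subdiff (extend_inf X phi) x)"

lemma phi_extend_inf: "(\<lambda>x. ereal (ft x) + ht x) = extend_inf X phi"
  by (auto simp: extend_inf_def phi_def fun_eq_iff)

text \<open>One pass of the loop as a relation between states, for \<open>\<gamma>u = 2\<close>. The
  stopping test is left out, so that a run may be continued beyond its stopping index.\<close>

definition apg_step where
  "apg_step \<gamma>d w u A L \<psi> w' u' A' a M L' \<psi>' \<longleftrightarrow>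
     (\<exists>j. M = L * 2 ^ j \<and>
        (\<forall>i\<le>j. apg_accept ft ht (L * 2 ^ i) (apg_point \<mu> A (L * 2 ^ i) w u) \<longleftrightarrow> i = j)) \<and>
     w' = prox_grad ft ht M (apg_point \<mu> A M w u) \<and>
     a = apg_weight \<mu> A M \<and> A' = A + a \<and>
     \<psi>' = (\<lambda>x. \<psi> x + ereal a * (ereal (ft w' + gradient ft w' \<bullet> (x - w')) + ht x)) \<and>
     is_arg_min \<psi>' (\<lambda>_. True) u' \<and> L' = M / \<gamma>d"

abbreviation "apg_step_at \<gamma>d w u A a L M \<psi> t \<equiv> apg_step \<gamma>d (w t) (u t) (A t) (L t) (\<psi> t)
   (w (Suc t)) (u (Suc t)) (A (Suc t)) (a (Suc t)) (M t) (L (Suc t)) (\<psi> (Suc t))"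

text \<open>Nesterov's estimate sequence with both of its bounds. Off \<open>X\<close> the model
  must only avoid \<open>-\<infinity>\<close>: the initial model is finite everywhere, and the value
  \<open>\<infinity>\<close> appears with the first summand \<open>ht\<close>.\<close>

definition estimate where
  "estimate w0 w u A \<psi> \<longleftrightarrow> (\<exists>r. (\<forall>x\<in>X. \<psi> x = ereal (r x)) \<and> (\<forall>x. x \<notin> X \<longrightarrow> \<psi> x \<noteq> -\<infinity>) \<and>
     continuous_on X r \<and> convex_on X (\<lambda>x. r x - (1 + \<mu> * A) / 2 * (norm x)\<^sup>2) \<and>
     (\<forall>x\<in>X. A * phi w + (1 + \<mu> * A) / 2 * (norm (x - u))\<^sup>2 \<le> r x) \<and>
     (\<forall>x\<in>X. r x \<le> A * phi x + 1 / 2 * (norm (x - w0))\<^sup>2))"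

definition apg_inv where
  "apg_inv w0 w u A L \<psi> \<longleftrightarrow> w \<in> X \<and> u \<in> X \<and> 0 \<le> A \<and> 0 < L \<and> L \<le> Lc \<and> estimate w0 w u A \<psi>"

lemma phi_strong_min:
  assumes "x \<in> X" "\<And>u. u \<in> X \<Longrightarrow> phi x \<le> phi u" "u \<in> X"
  shows "phi x + \<mu> / 2 * (norm (u - x))\<^sup>2 \<le> phi u"
proof -
  have "convex_on X (\<lambda>x. ft x + (hr x - \<mu> / 2 * (norm x)\<^sup>2))"
    by (intro convex_on_add ft_convex hr_strongly_convex)
  hence "convex_on X (\<lambda>x. phi x - \<mu> / 2 * (norm x)\<^sup>2)" by (simp add: phi_def algebra_simps)
  from strongly_convex_subgradient[OF this assms(1,3), of 0] assms(2) show ?thesis by simp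
qed

lemma apg_inv_init:
  assumes "w0 \<in> X" "0 < L0" "L0 \<le> Lc"
  shows "apg_inv w0 w0 w0 0 L0 (\<lambda>x. ereal (1 / 2 * (norm (x - w0))\<^sup>2))"
proof -
  have eq: "(\<lambda>x. 1 / 2 * (norm (x - w0))\<^sup>2 - (1 + \<mu> * 0) / 2 * (norm x)\<^sup>2)
      = (\<lambda>x. (norm w0)\<^sup>2 / 2 + (- w0) \<bullet> x)"
    by (rule HOL.ext) (simp add: power2_norm_eq_inner inner_diff_left inner_diff_right inner_commute field_simps)
  have cv: "convex_on X (\<lambda>x. 1 / 2 * (norm (x - w0))\<^sup>2 - (1 + \<mu> * 0) / 2 * (norm x)\<^sup>2)"
    unfolding eq by (rule convex_on_affine[OF X_convex])
  show ?thesis unfolding apg_inv_def estimate_def using assms cv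
    by (auto intro!: exI[of _ "\<lambda>x. 1 / 2 * (norm (x - w0))\<^sup>2"] continuous_intros)
qed

text \<open>The last rejected value lies below \<open>Lc\<close>, since from \<open>Lc\<close> on
  every value is accepted, and the accepted one is twice as large. Without a rejection the bound
  comes from \<open>L \<le> Lc\<close> in the invariant.\<close>

lemma line_search_bound:
  assumes inv: "apg_inv w0 w u A L \<psi>" and step: "apg_step \<gamma>d w u A L \<psi> w' u' A' a M L' \<psi>'"
  shows "0 < M" "M \<le> 2 * Lc" "apg_accept ft ht M (apg_point \<mu> A M w u)"
proof -
  have L: "0 < L" "L \<le> Lc" and wu: "w \<in> X" "u \<in> X" "0 \<le> A" using inv by (auto simp: apg_inv_def)
  obtain j where j: "M = L * 2 ^ j"
      "\<And>i. i \<le> j \<Longrightarrow> apg_accept ft ht (L * 2 ^ i) (apg_point \<mu> A (L * 2 ^ i) w u) \<longleftrightarrow> i = j"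
    using step unfolding apg_step_def by blast
  show "0 < M" using j L by simp
  show "apg_accept ft ht M (apg_point \<mu> A M w u)" using j by simp
  show "M \<le> 2 * Lc"
  proof (cases j)
    case 0
    thus ?thesis using j L by simp
  next
    case (Suc i)
    have "\<not> apg_accept ft ht (L * 2 ^ i) (apg_point \<mu> A (L * 2 ^ i) w u)" using j(2)[of i] Suc by simp
    hence "L * 2 ^ i < Lc"
      using apg_accept_large[of "L * 2 ^ i"] apg_point_in[of A "L * 2 ^ i" w u] wu L
      by (meson not_le mult_pos_pos zero_less_numeral zero_less_power)
    thus ?thesis using j Suc by simp
  qed
qed

text \<open>Nesterov's estimate sequence: the model \<open>\<psi>\<close> stays above \<open>A \<phi>(w)\<close> because the
  acceptance test absorbs the error of minimizing the model over the whole space.\<close>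

lemma apg_step_estimate:
  assumes inv: "apg_inv w0 w u A L \<psi>" and step: "apg_step \<gamma>d w u A L \<psi> w' u' A' a M L' \<psi>'"
    and \<gamma>d: "2 \<le> \<gamma>d"
  shows "apg_inv w0 w' u' A' L' \<psi>'"
proof -
  note M = line_search_bound[OF inv step]
  define y where "y = apg_point \<mu> A M w u"
  have wu: "w \<in> X" "u \<in> X" "0 \<le> A" and est: "estimate w0 w u A \<psi>" using inv by (auto simp: apg_inv_def)
  have w': "w' = prox_grad ft ht M y" and a: "a = apg_weight \<mu> A M" and A': "A' = A + a"
    and \<psi>': "\<psi>' = (\<lambda>x. \<psi> x + ereal a * (ereal (ft w' + gradient ft w' \<bullet> (x - w')) + ht x))"
    and u': "is_arg_min \<psi>' (\<lambda>_. True) u'" and L': "L' = M / \<gamma>d"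
    using step unfolding apg_step_def y_def by auto
  obtain r where r: "\<And>x. x \<in> X \<Longrightarrow> \<psi> x = ereal (r x)" "\<And>x. x \<notin> X \<Longrightarrow> \<psi> x \<noteq> -\<infinity>"
     "continuous_on X r" "convex_on X (\<lambda>x. r x - (1 + \<mu> * A) / 2 * (norm x)\<^sup>2)"
     "\<And>x. x \<in> X \<Longrightarrow> A * phi w + (1 + \<mu> * A) / 2 * (norm (x - u))\<^sup>2 \<le> r x"
     "\<And>x. x \<in> X \<Longrightarrow> r x \<le> A * phi x + 1 / 2 * (norm (x - w0))\<^sup>2"
    using est unfolding estimate_def by blast
  have apos: "0 < a" and aeq: "a\<^sup>2 = 2 * (1 + \<mu> * A) / M * A'"
    using apg_weight_eq[OF wu(3) \<mu>_pos M(1)] unfolding a A' by auto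
  have y: "y \<in> X" unfolding y_def using wu M by (intro apg_point_in) auto
  have yeq: "A' *\<^sub>R y = A *\<^sub>R w + a *\<^sub>R u" unfolding A' a y_def using apg_point_eq wu M by blast
  have w'X: "w' \<in> X" unfolding w' by (rule grad_map_subgradient[OF M(1) y])
  define g where "g = grad_map ft ht M y"
  have sub: "hr w' + (g - gradient ft w') \<bullet> (x - w') \<le> hr x" if "x \<in> X" for x
    using grad_map_subgradient(2)[OF M(1) y that] unfolding g_def w' .
  have acc: "1 / M * (norm g)\<^sup>2 \<le> g \<bullet> (y - w')"
    using M(3) unfolding apg_accept_def g_def w' y_def .
  define lin where "lin x = ft w' + gradient ft w' \<bullet> (x - w')" for x
  define r' where "r' x = r x + a * (lin x + hr x)" for x
  have in_X: "\<psi>' x = ereal (r' x)" if "x \<in> X" for x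
    using that r(1) unfolding \<psi>' r'_def lin_def by (simp add: extend_inf_def)
  have out_X: "\<psi>' x = \<infinity>" if "x \<notin> X" for x
    using that r(2)[OF that] apos unfolding \<psi>' by (cases "\<psi> x") (auto simp: extend_inf_def)
  have u'min: "u' \<in> X" "\<And>x. x \<in> X \<Longrightarrow> r' u' \<le> r' x"
    using u' is_arg_min_extend_inf[of X \<psi>' r' u'] X_nonempty in_X out_X by simp_all
  have cv: "convex_on X (\<lambda>x. r' x - (1 + \<mu> * A') / 2 * (norm x)\<^sup>2)"
  proof -
    let ?c = "\<lambda>x. (r x - (1 + \<mu> * A) / 2 * (norm x)\<^sup>2) + a * ((hr x - \<mu> / 2 * (norm x)\<^sup>2)
        + ((ft w' - gradient ft w' \<bullet> w') + gradient ft w' \<bullet> x))"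
    have *: "convex_on X ?c"
      using apos X_convex by (intro convex_on_add r(4) convex_on_cmul hr_strongly_convex convex_on_affine) auto
    have eq: "?c
        = (\<lambda>x. r' x - (1 + \<mu> * A') / 2 * (norm x)\<^sup>2)"
      unfolding r'_def A' lin_def
      by (rule HOL.ext) (simp add: inner_diff_right algebra_simps add_divide_distrib)
    show ?thesis using * unfolding eq .
  qed
  have lower: "A' * phi w' \<le> r' x" if x: "x \<in> X" for x
  proof -
    have ft1: "ft w' + gradient ft w' \<bullet> (w - w') \<le> ft w" by (rule ft_tangent[OF w'X wu(1)])
    have "phi w' + g \<bullet> (w - w') \<le> phi w"
      using ft1 sub[OF wu(1)] unfolding phi_def by (simp add: inner_diff_left)
    hence 1: "A * (phi w' + g \<bullet> (w - w')) \<le> A * phi w" using wu by (intro mult_left_mono)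
    have "phi w' + g \<bullet> (x - w') \<le> lin x + hr x"
      using sub[OF x] unfolding phi_def lin_def by (simp add: inner_diff_left)
    hence 2: "a * (phi w' + g \<bullet> (x - w')) \<le> a * (lin x + hr x)" using apos by (intro mult_left_mono) auto
    \<comment> \<open>The weights of \<open>y\<close> are those of the two tangent inequalities, so
      \<open>w\<close> and \<open>u\<close> recombine to \<open>A' y\<close>.\<close>
    have "A * (g \<bullet> (w - w')) + a * (g \<bullet> (x - w')) = g \<bullet> (A *\<^sub>R w + a *\<^sub>R u - A' *\<^sub>R w' + a *\<^sub>R (x - u))"
      unfolding A' by (simp add: inner_diff_right inner_add_right algebra_simps)
    also have "\<dots> = A' * (g \<bullet> (y - w')) + a * (g \<bullet> (x - u))"
      unfolding yeq[symmetric] by (simp add: inner_diff_right inner_add_right algebra_simps)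
    finally have 3: "A * (g \<bullet> (w - w')) + a * (g \<bullet> (x - w')) = A' * (g \<bullet> (y - w')) + a * (g \<bullet> (x - u))" .
    have m: "0 < 1 + \<mu> * A" using \<mu>_pos wu by (simp add: add_pos_nonneg)
    have A'nn: "0 \<le> A'" unfolding A' using wu apos by simp
    \<comment> \<open>The equation for \<open>a\<close> is made for this place: completing the
      square leaves \<open>a^2 / (2 m) = A' / M\<close> times \<open>(norm g)^2\<close>, just what
      the acceptance test supplies in 5.\<close>
    have 4: "- (A' * (1 / M * (norm g)\<^sup>2)) \<le> a * (g \<bullet> (x - u)) + (1 + \<mu> * A) / 2 * (norm (x - u))\<^sup>2"
    proof -
      define m where "m = 1 + \<mu> * A"
      have mp: "0 < m" unfolding m_def by fact
      define d where "d = x - u"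
      have "0 \<le> m / 2 * (norm (d + (a / m) *\<^sub>R g))\<^sup>2" using mp by simp
      also have "\<dots> = m / 2 * (norm d)\<^sup>2 + a * (g \<bullet> d) + a\<^sup>2 / (2 * m) * (norm g)\<^sup>2"
        unfolding power2_norm_eq_inner using mp
        by (simp add: inner_add_left inner_add_right inner_commute power2_eq_square field_simps)
      also have "a\<^sup>2 / (2 * m) = A' / M" unfolding aeq m_def[symmetric] using mp M by (simp add: field_simps)
      finally show ?thesis unfolding m_def d_def by simp
    qed
    have 5: "A' * (1 / M * (norm g)\<^sup>2) \<le> A' * (g \<bullet> (y - w'))" using acc A'nn by (rule mult_left_mono)
    have "A' * phi w' = A * phi w' + a * phi w'" unfolding A' by (simp add: algebra_simps)
    with 1 2 3 4 5 r(5)[OF x] show ?thesis unfolding r'_def by (simp add: algebra_simps)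
  qed
  \<comment> \<open>Quadratic growth of the model around its minimizer \<open>u'\<close> restores
    the squared distance in the lower bound.\<close>
  have "A' * phi w' + (1 + \<mu> * A') / 2 * (norm (x - u'))\<^sup>2 \<le> r' x" if "x \<in> X" for x
    using strongly_convex_subgradient[OF cv u'min(1) that, of 0] u'min lower[OF u'min(1)] by simp
  moreover have "r' x \<le> A' * phi x + 1 / 2 * (norm (x - w0))\<^sup>2" if "x \<in> X" for x
  proof -
    have "lin x + hr x \<le> phi x" unfolding lin_def phi_def using ft_tangent[OF w'X that] by simp
    hence "a * (lin x + hr x) \<le> a * phi x" using apos by (intro mult_left_mono) auto
    with r(6)[OF that] show ?thesis unfolding r'_def A' by (simp add: algebra_simps)
  qed
  moreover have "continuous_on X r'" unfolding r'_def lin_def by (intro continuous_intros r hr_cont)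
  ultimately have "estimate w0 w' u' A' \<psi>'" unfolding estimate_def
    using in_X out_X cv by (intro exI[of _ r']) auto
  moreover have "0 < L'" unfolding L' using M \<gamma>d by simp
  \<comment> \<open>Division by \<open>\<gamma>d \<ge> 2\<close> offsets the overshoot of the line
    search, which keeps \<open>L \<le> Lc\<close> invariant.\<close>
  moreover have "2 * Lc \<le> \<gamma>d * Lc" using \<gamma>d Lc_pos by simp
  hence "L' \<le> Lc" unfolding L' using M(2) \<gamma>d by (simp add: pos_divide_le_eq mult.commute)
  ultimately show ?thesis unfolding apg_inv_def using w'X u'min wu apos A' by auto
qed

lemma apg_iff_steps:
  "apg ft ht \<mu> 2 \<gamma>d \<Delta> w0 L0 T out \<longleftrightarrow> 1 \<le> T \<and>
     (\<exists>w u A a L M \<psi>. w 0 = w0 \<and> u 0 = w0 \<and> A 0 = 0 \<and> L 0 = L0 \<and>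
        \<psi> 0 = (\<lambda>x. ereal (1 / 2 * (norm (x - w0))\<^sup>2)) \<and>
        (\<forall>t<T. apg_step_at \<gamma>d w u A a L M \<psi> t \<and>
           (stationarity (w (Suc t)) \<le> ereal \<Delta> \<longleftrightarrow> Suc t = T)) \<and>
        out = w T)"
  unfolding apg_def apg_step_def phi_extend_inf by (simp only: conj_assoc)

lemma apg_stepsI:
  assumes "w 0 = w0" "u 0 = w0" "A 0 = 0" "L 0 = L0" "\<psi> 0 = (\<lambda>x. ereal (1 / 2 * (norm (x - w0))\<^sup>2))"
    and "\<And>t. apg_step_at \<gamma>d w u A a L M \<psi> t"
    and "\<And>t. t < T \<Longrightarrow> stationarity (w (Suc t)) \<le> ereal \<Delta> \<longleftrightarrow> Suc t = T"
    and "1 \<le> T" "out = w T"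
  shows "apg ft ht \<mu> 2 \<gamma>d \<Delta> w0 L0 T out"
  unfolding apg_iff_steps using assms by blast

lemma apg_step_exists:
  assumes inv: "apg_inv w0 w u A L \<psi>"
  shows "\<exists>w' u' A' a M L' \<psi>'. apg_step \<gamma>d w u A L \<psi> w' u' A' a M L' \<psi>'"
proof -
  have L: "0 < L" "L \<le> Lc" and wu: "w \<in> X" "u \<in> X" "0 \<le> A" and est: "estimate w0 w u A \<psi>"
    using inv by (auto simp: apg_inv_def)
  define acc where "acc i \<longleftrightarrow> apg_accept ft ht (L * 2 ^ i) (apg_point \<mu> A (L * 2 ^ i) w u)" for i :: nat
  obtain n where "Lc / L < 2 ^ n" using real_arch_pow[of 2 "Lc / L"] by auto
  hence "Lc \<le> L * 2 ^ n" using L by (simp add: field_simps)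
  hence "acc n" unfolding acc_def using wu L by (intro apg_accept_large apg_point_in) auto
  define j where "j = (LEAST i. acc i)"
  have j: "\<forall>i\<le>j. acc i \<longleftrightarrow> i = j"
    unfolding j_def using LeastI[of acc, OF \<open>acc n\<close>] not_less_Least[of _ acc] le_neq_implies_less by blast
  define M where "M = L * 2 ^ j"
  have M: "0 < M" unfolding M_def using L by simp
  define y where "y = apg_point \<mu> A M w u"
  have y: "y \<in> X" unfolding y_def using wu M by (intro apg_point_in) auto
  define w' where "w' = prox_grad ft ht M y"
  have w': "w' \<in> X" unfolding w'_def by (rule grad_map_subgradient[OF M y])
  define a where "a = apg_weight \<mu> A M"
  have a: "0 < a" unfolding a_def by (rule apg_weight_eq(1)[OF wu(3) \<mu>_pos M])
  define \<psi>' where "\<psi>' = (\<lambda>x. \<psi> x + ereal a * (ereal (ft w' + gradient ft w' \<bullet> (x - w')) + ht x))"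
  obtain r where r: "\<And>x. x \<in> X \<Longrightarrow> \<psi> x = ereal (r x)" "\<And>x. x \<notin> X \<Longrightarrow> \<psi> x \<noteq> -\<infinity>"
     "continuous_on X r" using est unfolding estimate_def by blast
  define r' where "r' x = r x + a * (ft w' + gradient ft w' \<bullet> (x - w') + hr x)" for x
  have in_X: "\<psi>' x = ereal (r' x)" if "x \<in> X" for x
    using that r(1) unfolding \<psi>'_def r'_def by (simp add: extend_inf_def)
  have out_X: "\<psi>' x = \<infinity>" if "x \<notin> X" for x
    using that r(2)[OF that] a unfolding \<psi>'_def by (cases "\<psi> x") (auto simp: extend_inf_def)
  have "continuous_on X r'" unfolding r'_def by (intro continuous_intros r hr_cont)
  then obtain u' where "u' \<in> X" "\<forall>x\<in>X. r' u' \<le> r' x"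
    using continuous_attains_inf[OF X_compact X_nonempty] by blast
  hence "is_arg_min \<psi>' (\<lambda>_. True) u'"
    using is_arg_min_extend_inf[of X \<psi>' r' u'] X_nonempty in_X out_X by simp
  hence "apg_step \<gamma>d w u A L \<psi> w' u' (A + a) a M (M / \<gamma>d) \<psi>'"
    unfolding apg_step_def w'_def[unfolded y_def, symmetric] a_def[symmetric] \<psi>'_def[symmetric]
    using M_def j unfolding acc_def by blast
  thus ?thesis by blast
qed

lemma norm_weighted_le:
  fixes p q :: 'a
  assumes "0 \<le> A" "0 < a" "norm p \<le> R" "norm q \<le> R" "(A + a) *\<^sub>R z = A *\<^sub>R p + a *\<^sub>R q"
  shows "norm z \<le> R"
proof -
  have "(A + a) * norm z = norm ((A + a) *\<^sub>R z)" using assms(1,2) by simp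
  also have "\<dots> \<le> A * norm p + a * norm q" unfolding assms(5) using assms(1,2) norm_triangle_ineq
    by (metis abs_of_nonneg abs_of_pos norm_scaleR)
  also have "\<dots> \<le> A * R + a * R" using assms by (intro add_mono mult_left_mono) auto
  also have "\<dots> = (A + a) * R" by (simp add: algebra_simps)
  finally show ?thesis using assms(1,2) by (simp add: mult_le_cancel_left)
qed

text \<open>Near-optimality of the iterates turns into a small subgradient: the acceptance test bounds
  \<open>grad_map\<close> by the step length, and by strong convexity both \<open>w\<close> and the minimizer \<open>u\<close>
  of the model are within \<open>D / sqrt (\<mu> A)\<close> of the solution.\<close>

lemma apg_step_stationarity:
  assumes inv: "apg_inv w0 w u A L \<psi>" and step: "apg_step \<gamma>d w u A L \<psi> w' u' A' a M L' \<psi>'"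
    and \<gamma>d: "2 \<le> \<gamma>d" and A: "0 < A" and w0: "w0 \<in> X"
  shows "stationarity w' \<le> ereal (4 * Lc * D / sqrt (\<mu> * A))"
proof -
  have inv': "apg_inv w0 w' u' A' L' \<psi>'" by (rule apg_step_estimate[OF inv step \<gamma>d])
  note M = line_search_bound[OF inv step]
  have wu: "w \<in> X" "u \<in> X" using inv by (auto simp: apg_inv_def)
  define y where "y = apg_point \<mu> A M w u"
  have y: "y \<in> X" unfolding y_def using wu M A by (intro apg_point_in) auto
  have w'eq: "w' = prox_grad ft ht M y" and a: "a = apg_weight \<mu> A M" and A': "A' = A + a"
    using step unfolding apg_step_def y_def by auto
  have apos: "0 < a" unfolding a using apg_weight_eq(1)[OF _ \<mu>_pos M(1)] A by simp
  define g where "g = grad_map ft ht M y"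
  have w': "w' \<in> X" unfolding w'eq by (rule grad_map_subgradient[OF M(1) y])
  have "continuous_on X phi"
    unfolding phi_def using ft_diff
    by (intro continuous_on_add differentiable_imp_continuous_on hr_cont)
       (auto simp: differentiable_on_def differentiable_at_withinI)
  then obtain xs where xs: "xs \<in> X" "\<And>x. x \<in> X \<Longrightarrow> phi xs \<le> phi x"
    using continuous_attains_inf[OF X_compact X_nonempty] by blast
  define R where "R = D / sqrt (\<mu> * A)"
  have near: "norm (w1 - xs) \<le> D / sqrt (\<mu> * A1)" "norm (u1 - xs) \<le> D / sqrt (\<mu> * A1)"
    if inv1: "apg_inv w0 w1 u1 A1 L1 \<psi>1" and A1: "0 < A1" for w1 u1 A1 L1 \<psi>1
  proof -
    have X1: "w1 \<in> X" "u1 \<in> X" and est: "estimate w0 w1 u1 A1 \<psi>1" using inv1 by (auto simp: apg_inv_def)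
    have "norm (xs - w0) \<le> D" using diam xs w0 by blast
    hence "(norm (xs - w0))\<^sup>2 \<le> D\<^sup>2" by (rule power_mono) simp
    \<comment> \<open>The two bounds of the estimate sequence, compared at the solution
      \<open>xs\<close>.\<close>
    moreover have "A1 * phi w1 + (1 + \<mu> * A1) / 2 * (norm (xs - u1))\<^sup>2 \<le> A1 * phi xs + 1 / 2 * (norm (xs - w0))\<^sup>2"
      using est xs(1) unfolding estimate_def by (meson order_trans)
    moreover have "A1 * (phi xs + \<mu> / 2 * (norm (w1 - xs))\<^sup>2) \<le> A1 * phi w1"
      using phi_strong_min[OF xs X1(1)] A1 by (intro mult_left_mono) auto
    moreover have "A1 * (phi xs + \<mu> / 2 * (norm (w1 - xs))\<^sup>2)
        = A1 * phi xs + \<mu> * A1 * (norm (w1 - xs))\<^sup>2 / 2" by (simp add: algebra_simps)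
    moreover have "(1 + \<mu> * A1) / 2 * (norm (xs - u1))\<^sup>2 = (1 + \<mu> * A1) * (norm (u1 - xs))\<^sup>2 / 2"
      by (simp add: norm_minus_commute)
    ultimately have main: "\<mu> * A1 * (norm (w1 - xs))\<^sup>2 + (1 + \<mu> * A1) * (norm (u1 - xs))\<^sup>2 \<le> D\<^sup>2"
      by linarith
    have D: "0 \<le> D" using diam[OF w0 w0] by simp
    have p: "0 < \<mu> * A1" using \<mu>_pos A1 by simp
    have b: "norm z \<le> D / sqrt (\<mu> * A1)" if "\<mu> * A1 * (norm z)\<^sup>2 \<le> D\<^sup>2" for z :: 'a
    proof -
      have "(sqrt (\<mu> * A1) * norm z)\<^sup>2 \<le> D\<^sup>2" using that p by (simp add: power_mult_distrib)
      hence "sqrt (\<mu> * A1) * norm z \<le> D" using D by (rule power2_le_imp_le)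
      thus ?thesis using p by (simp add: pos_le_divide_eq mult.commute)
    qed
    have nn: "0 \<le> \<mu> * A1 * (norm (w1 - xs))\<^sup>2" "0 \<le> \<mu> * A1 * (norm (u1 - xs))\<^sup>2" "0 \<le> (norm (u1 - xs))\<^sup>2"
      using p by simp_all
    have sp: "(1 + \<mu> * A1) * (norm (u1 - xs))\<^sup>2 = (norm (u1 - xs))\<^sup>2 + \<mu> * A1 * (norm (u1 - xs))\<^sup>2"
      by (simp add: algebra_simps)
    have "\<mu> * A1 * (norm (w1 - xs))\<^sup>2 \<le> D\<^sup>2" using main nn sp by linarith
    thus "norm (w1 - xs) \<le> D / sqrt (\<mu> * A1)" by (rule b)
    have "\<mu> * A1 * (norm (u1 - xs))\<^sup>2 \<le> D\<^sup>2" using main nn sp by linarith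
    thus "norm (u1 - xs) \<le> D / sqrt (\<mu> * A1)" by (rule b)
  qed
  have D: "0 \<le> D" using diam[OF w0 w0] by simp
  have yR: "norm (y - xs) \<le> R"
  proof (rule norm_weighted_le[of A a "w - xs" R "u - xs"])
    show "(A + a) *\<^sub>R (y - xs) = A *\<^sub>R (w - xs) + a *\<^sub>R (u - xs)"
      using apg_point_eq[of A M w u] A M(1) unfolding y_def a
      by (simp add: scaleR_diff_right scaleR_add_left)
  qed (use near[OF inv A] A apos in \<open>auto simp: R_def\<close>)
  \<comment> \<open>\<open>w'\<close> is governed by the larger weight \<open>A'\<close>, so it lies
    in the ball of radius \<open>R\<close> as well.\<close>
  have "norm (w' - xs) \<le> D / sqrt (\<mu> * A')" using near(1)[OF inv'] A apos unfolding A' by simp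
  also have "\<dots> \<le> R" unfolding R_def A' using D A apos \<mu>_pos
    by (intro divide_left_mono) (auto intro!: mult_pos_pos)
  finally have "norm (y - w') \<le> 2 * R" using yR norm_triangle_ineq4[of "y - xs" "w' - xs"] by simp
  have "norm g \<le> M * norm (y - w')"
  proof (cases "g = 0")
    case False
    have "1 / M * (norm g)\<^sup>2 \<le> g \<bullet> (y - w')"
      using M(3) unfolding apg_accept_def g_def w'eq y_def .
    also have "\<dots> \<le> norm g * norm (y - w')" by (rule norm_cauchy_schwarz)
    finally have "norm g * norm g \<le> norm g * (M * norm (y - w'))"
      using M by (simp add: power2_eq_square field_simps)
    thus ?thesis using False by simp
  qed (use M in simp)
  \<comment> \<open>One factor 2 is the overshoot of the line search, the other the two radii
    between \<open>y\<close> and \<open>w'\<close>.\<close>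
  also have "\<dots> \<le> (2 * Lc) * (2 * R)"
    using M \<open>norm (y - w') \<le> 2 * R\<close> Lc_pos by (intro mult_mono) auto
  finally have gn: "norm g \<le> 4 * Lc * D / sqrt (\<mu> * A)" unfolding R_def by simp
  have "g \<in> subdiff (extend_inf X phi) w'"
    unfolding subdiff_extend_inf_iff
  proof (intro conjI w' ballI)
    fix x assume x: "x \<in> X"
    have "hr w' + (g - gradient ft w') \<bullet> (x - w') \<le> hr x"
      using grad_map_subgradient(2)[OF M(1) y x] unfolding g_def w'eq .
    with ft_tangent[OF w' x] show "phi w' + g \<bullet> (x - w') \<le> phi x"
      unfolding phi_def by (simp add: inner_diff_left)
  qed
  thus ?thesis using gn by (rule dist0_leI)
qed

section \<open>Convergence rate and iteration count\<close>

lemma apg_growth: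
  assumes inv: "apg_inv w0 w u A L \<psi>" and step: "apg_step \<gamma>d w u A L \<psi> w' u' A' a M L' \<psi>'"
  shows "(1 + sqrt (\<mu> / Lc) / 2) * sqrt A \<le> sqrt A'" "1 / Lc \<le> A'"
proof -
  note M = line_search_bound[OF inv step]
  have A: "0 \<le> A" using inv by (auto simp: apg_inv_def)
  have a: "a = apg_weight \<mu> A M" and A': "A' = A + a" using step unfolding apg_step_def by auto
  have apos: "0 < a" and aeq: "a\<^sup>2 = 2 * (1 + \<mu> * A) / M * (A + a)"
    using apg_weight_eq[OF A \<mu>_pos M(1)] unfolding a by auto
  have inv_le: "1 / Lc \<le> 2 / M" using M Lc_pos by (simp add: field_simps)
  have nn: "0 \<le> \<mu> * A" using \<mu>_pos A by simp
  have "\<mu> * A / Lc * (A + a) \<le> 2 * (1 + \<mu> * A) / M * (A + a)"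
  proof (rule mult_right_mono)
    have "\<mu> * A * (1 / Lc) \<le> (1 + \<mu> * A) * (2 / M)"
      using inv_le nn Lc_pos by (intro mult_mono) auto
    thus "\<mu> * A / Lc \<le> 2 * (1 + \<mu> * A) / M" by (simp add: mult.commute)
  qed (use A apos in simp)
  thus "(1 + sqrt (\<mu> / Lc) / 2) * sqrt A \<le> sqrt A'"
    unfolding A' using A apos \<mu>_pos Lc_pos aeq by (intro sqrt_growth) auto
  \<comment> \<open>The geometric bound says nothing at \<open>A = 0\<close>, where the scheme
    begins; this lower bound on the weight starts the growth.\<close>
  have "(1 / Lc) * a \<le> 2 * (1 + \<mu> * A) / M * (A + a)"
  proof (rule mult_mono)
    have "2 / M \<le> 2 * (1 + \<mu> * A) / M" using nn M by (simp add: divide_right_mono)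
    thus "1 / Lc \<le> 2 * (1 + \<mu> * A) / M" using inv_le by linarith
  qed (use A apos nn M in auto)
  hence "1 / Lc * a \<le> a * a" unfolding aeq[symmetric] by (simp add: power2_eq_square)
  hence "1 / Lc \<le> a" using apos by (simp only: mult_le_cancel_right_pos)
  thus "1 / Lc \<le> A'" unfolding A' using A by simp
qed

text \<open>After the first iteration has lifted \<open>A\<close> to at least \<open>1 / Lc\<close>,
  each further one gains a factor in \<open>sqrt A\<close>. The stationarity of an iterate is read
  off from the accumulated weight before it, so \<open>t\<close> factors are available at index
  \<open>t + 2\<close>.\<close>

lemma apg_run:
  assumes w0: "w0 \<in> X" and L0: "0 < L0" "L0 \<le> Lc" and \<gamma>d: "2 \<le> \<gamma>d"
    and init: "w 0 = w0" "u 0 = w0" "A 0 = 0" "L 0 = L0" "\<psi> 0 = (\<lambda>x. ereal (1 / 2 * (norm (x - w0))\<^sup>2))"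
    and steps: "\<And>t. t < N \<Longrightarrow> apg_step_at \<gamma>d w u A a L M \<psi> t"
    and t: "Suc t < N"
  shows "stationarity (w (Suc (Suc t)))
    \<le> ereal (4 * Lc * sqrt Lc * D / sqrt \<mu> / (1 + sqrt (\<mu> / Lc) / 2) ^ t)"
proof -
  define q where "q = 1 + sqrt (\<mu> / Lc) / 2"
  have q: "1 \<le> q" unfolding q_def using \<mu>_pos Lc_pos by simp
  have inv: "apg_inv w0 (w s) (u s) (A s) (L s) (\<psi> s)" if "s \<le> N" for s
    using that
  proof (induction s)
    case 0
    then show ?case unfolding init by (intro apg_inv_init w0 L0)
  next
    case (Suc s)
    then show ?case using apg_step_estimate[OF _ steps \<gamma>d] by simp
  qed
  have growth: "q ^ s / sqrt Lc \<le> sqrt (A (Suc s))" if "s < N" for s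
    using that
  proof (induction s)
    case 0
    have "1 / Lc \<le> A (Suc 0)" using apg_growth(2)[OF inv steps] 0 by simp
    hence "sqrt (1 / Lc) \<le> sqrt (A (Suc 0))" by (rule real_sqrt_le_mono)
    thus ?case by (simp add: real_sqrt_divide)
  next
    case (Suc s)
    have "q ^ Suc s / sqrt Lc \<le> q * sqrt (A (Suc s))"
      using mult_left_mono[OF Suc.IH, of q] Suc.prems q by simp
    also have "\<dots> \<le> sqrt (A (Suc (Suc s)))"
      unfolding q_def using apg_growth(1)[OF inv steps] Suc.prems by simp
    finally show ?case .
  qed
  have t': "t < N" "Suc t \<le> N" using t by auto
  have pos: "0 < q ^ t / sqrt Lc" using q Lc_pos by simp
  hence sA: "0 < sqrt (A (Suc t))" using growth[OF t'(1)] by linarith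
  have D: "0 \<le> D" using diam[OF w0 w0] by simp
  have "stationarity (w (Suc (Suc t))) \<le> ereal (4 * Lc * D / sqrt (\<mu> * A (Suc t)))"
    using apg_step_stationarity[OF inv[OF t'(2)] steps[OF t] \<gamma>d _ w0] sA by simp
  also have "4 * Lc * D / sqrt (\<mu> * A (Suc t)) = 4 * Lc * D / sqrt \<mu> / sqrt (A (Suc t))"
    by (simp add: real_sqrt_mult)
  also have "\<dots> \<le> 4 * Lc * D / sqrt \<mu> / (q ^ t / sqrt Lc)"
    using growth[OF t'(1)] D \<mu>_pos Lc_pos by (intro divide_left_mono mult_pos_pos[OF sA pos]) auto
  also have "\<dots> = 4 * Lc * sqrt Lc * D / sqrt \<mu> / q ^ t" by simp
  finally show ?thesis unfolding q_def by simp
qed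

text \<open>The iteration is continued for ever by dependent choice, without the stopping test.
  Geometric decay of the stationarity makes the test succeed at some point, and the run is cut at
  its first success.\<close>

lemma apg_exists:
  assumes w0: "w0 \<in> X" and L0: "0 < L0" "L0 \<le> Lc" and \<gamma>d: "2 \<le> \<gamma>d" and \<Delta>: "0 < \<Delta>"
  shows "\<exists>T out. apg ft ht \<mu> 2 \<gamma>d \<Delta> w0 L0 T out"
proof -
  define w where "w = (fst :: 'a apg_state \<Rightarrow> 'a)"
  define u where "u s = fst (snd s)" for s :: "'a apg_state"
  define A where "A s = fst (snd (snd s))" for s :: "'a apg_state"
  define L where "L s = fst (snd (snd (snd s)))" for s :: "'a apg_state"
  define \<psi> where "\<psi> s = snd (snd (snd (snd s)))" for s :: "'a apg_state"
  note proj = w_def u_def A_def L_def \<psi>_def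
  let ?init = "(w0, w0, 0, L0, \<lambda>x. ereal (1 / 2 * (norm (x - w0))\<^sup>2))"
  define P where "P n s \<longleftrightarrow> apg_inv w0 (w s) (u s) (A s) (L s) (\<psi> s) \<and> (n = 0 \<longrightarrow> s = ?init)" for n :: nat and s
  define Q where "Q s s' \<longleftrightarrow> (\<exists>a M. apg_step \<gamma>d (w s) (u s) (A s) (L s) (\<psi> s) (w s') (u s') (A s') a M (L s') (\<psi> s'))" for s s'
  have "\<exists>s. \<forall>n. P n (s n) \<and> Q (s n) (s (Suc n))"
  proof (rule dependent_nat_choice)
    show "\<exists>s. P 0 s"
      using apg_inv_init[OF w0 L0] unfolding P_def proj by (intro exI[of _ ?init]) simp
  next
    fix s and n :: nat
    assume "P n s"
    hence inv: "apg_inv w0 (w s) (u s) (A s) (L s) (\<psi> s)" unfolding P_def by blast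
    obtain w' u' A' a M L' \<psi>' where st: "apg_step \<gamma>d (w s) (u s) (A s) (L s) (\<psi> s) w' u' A' a M L' \<psi>'"
      using apg_step_exists[OF inv] by blast
    have "P (Suc n) (w', u', A', L', \<psi>')"
      using apg_step_estimate[OF inv st \<gamma>d] unfolding P_def proj by simp
    moreover have "Q s (w', u', A', L', \<psi>')"
      using st unfolding Q_def by (intro exI[of _ a] exI[of _ M]) (simp add: proj)
    ultimately show "\<exists>s'. P (Suc n) s' \<and> Q s s'" by blast
  qed
  then obtain s where s: "\<And>n. P n (s n)" "\<And>n. Q (s n) (s (Suc n))" by blast
  have s0: "s 0 = ?init" using s(1)[of 0] unfolding P_def by blast
  obtain a' M where steps: "\<And>n. apg_step \<gamma>d (w (s n)) (u (s n)) (A (s n)) (L (s n)) (\<psi> (s n))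
             (w (s (Suc n))) (u (s (Suc n))) (A (s (Suc n))) (a' n) (M n) (L (s (Suc n))) (\<psi> (s (Suc n)))"
    using s(2) unfolding Q_def by metis
  \<comment> \<open>The choice yields the weight of step \<open>n\<close> under the index
    \<open>n\<close>, whereas the scheme stores it at \<open>Suc n\<close>.\<close>
  define a where "a n = a' (n - 1)" for n
  have steps: "apg_step_at \<gamma>d (\<lambda>n. w (s n)) (\<lambda>n. u (s n)) (\<lambda>n. A (s n)) a
      (\<lambda>n. L (s n)) M (\<lambda>n. \<psi> (s n)) n" for n
    using steps[of n] unfolding a_def by simp
  have init: "w (s 0) = w0" "u (s 0) = w0" "A (s 0) = 0" "L (s 0) = L0"
      "\<psi> (s 0) = (\<lambda>x. ereal (1 / 2 * (norm (x - w0))\<^sup>2))"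
    unfolding proj s0 by simp_all
  define stop where "stop t \<longleftrightarrow> stationarity (w (s (Suc t))) \<le> ereal \<Delta>" for t
  define c where "c = 4 * Lc * sqrt Lc * D / sqrt \<mu>"
  define q where "q = 1 + sqrt (\<mu> / Lc) / 2"
  have q: "1 < q" unfolding q_def using \<mu>_pos Lc_pos by simp
  obtain n where "c / \<Delta> < q ^ n" using real_arch_pow[OF q] by blast
  hence "c / q ^ n \<le> \<Delta>" using \<Delta> q by (simp add: field_simps)
  moreover have "stationarity (w (s (Suc (Suc n)))) \<le> ereal (c / q ^ n)"
    unfolding c_def q_def
    by (rule apg_run[where w = "\<lambda>n. w (s n)" and u = "\<lambda>n. u (s n)" and A = "\<lambda>n. A (s n)"
          and L = "\<lambda>n. L (s n)" and \<psi> = "\<lambda>n. \<psi> (s n)" and N = "Suc (Suc n)", OF w0 L0 \<gamma>d init steps]) simp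
  ultimately have "stop (Suc n)" unfolding stop_def by (meson ereal_less_eq(3) order_trans)
  define t where "t = (LEAST t. stop t)"
  have t: "\<forall>i\<le>t. stop i \<longleftrightarrow> i = t"
    unfolding t_def using LeastI[of stop, OF \<open>stop (Suc n)\<close>] not_less_Least[of _ stop] le_neq_implies_less by blast
  have "apg ft ht \<mu> 2 \<gamma>d \<Delta> w0 L0 (Suc t) (w (s (Suc t)))"
    by (rule apg_stepsI[where w = "\<lambda>n. w (s n)" and u = "\<lambda>n. u (s n)" and A = "\<lambda>n. A (s n)"
          and L = "\<lambda>n. L (s n)" and \<psi> = "\<lambda>n. \<psi> (s n)", OF init steps])
       (use t in \<open>auto simp: stop_def\<close>)
  thus ?thesis by blast
qed

text \<open>The last iterate but one fails the test, so the rate is still above \<Delta> at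
  \<open>t = T - 3\<close>; this bounds \<open>(1 + s) ^ t\<close> by \<open>4 * G\<close>. The
  coefficient \<open>2 * sqrt (Lc / \<mu>)\<close> is \<open>1 / s\<close>.\<close>

lemma apg_complexity:
  assumes w0: "w0 \<in> X" and L0: "0 < L0" "L0 \<le> Lc" and \<gamma>d: "2 \<le> \<gamma>d" and \<Delta>: "0 < \<Delta>"
    and run: "apg ft ht \<mu> 2 \<gamma>d \<Delta> w0 L0 T out"
  shows "real T \<le> 2 + (2 * sqrt (Lc / \<mu>) + 1 / ln 2) *
    max 0 (ln (9 / \<Delta> * D * sqrt (1 / \<mu>) * Lc powr (3 / 2)))"
proof (cases "T \<le> 2")
  case True
  have "0 \<le> (2 * sqrt (Lc / \<mu>) + 1 / ln 2) * max 0 (ln (9 / \<Delta> * D * sqrt (1 / \<mu>) * Lc powr (3 / 2)))"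
    using \<mu>_pos Lc_pos by (intro mult_nonneg_nonneg add_nonneg_nonneg) auto
  with True show ?thesis by linarith
next
  case False
  then obtain t where T: "T = t + 3" by (metis add.commute le_add_diff_inverse not_less_eq_eq numeral_2_eq_2 numeral_3_eq_3)
  have "Lc powr (3 / 2) = Lc powr 1 * Lc powr (1 / 2)" unfolding powr_add[symmetric] by simp
  hence Lpowr: "Lc powr (3 / 2) = Lc * sqrt Lc" using Lc_pos by (simp add: powr_half_sqrt)
  define s where "s = sqrt (\<mu> / Lc) / 2"
  have s: "0 < s" "s \<le> 1 / 2" unfolding s_def using \<mu>_pos Lc_pos \<mu>_le by auto
  define c where "c = 4 * Lc * sqrt Lc * D / sqrt \<mu>"
  define G where "G = D * sqrt (1 / \<mu>) * Lc powr (3 / 2) / \<Delta>"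
  obtain w u A a L M \<psi> where init: "w 0 = w0" "u 0 = w0" "A 0 = 0" "L 0 = L0"
      "\<psi> 0 = (\<lambda>x. ereal (1 / 2 * (norm (x - w0))\<^sup>2))"
    and steps: "\<And>t. t < T \<Longrightarrow> apg_step_at \<gamma>d w u A a L M \<psi> t"
    and stop: "\<And>t. t < T \<Longrightarrow> stationarity (w (Suc t)) \<le> ereal \<Delta> \<longleftrightarrow> Suc t = T"
    using run unfolding apg_iff_steps by blast
  have "stationarity (w (Suc (Suc t)))
      \<le> ereal (4 * Lc * sqrt Lc * D / sqrt \<mu> / (1 + sqrt (\<mu> / Lc) / 2) ^ t)"
    by (rule apg_run[OF w0 L0 \<gamma>d init steps, of T]) (simp_all add: T)
  moreover have "\<not> stationarity (w (Suc (Suc t))) \<le> ereal \<Delta>"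
    using stop[of "Suc t"] T by simp
  ultimately have "\<Delta> < c / (1 + s) ^ t"
    unfolding s_def c_def by (meson ereal_less_eq(3) not_le order_trans)
  hence "\<Delta> * (1 + s) ^ t < c" using s by (simp add: pos_less_divide_eq)
  hence "(1 + s) ^ t < c / \<Delta>" using \<Delta> by (simp add: pos_less_divide_eq mult.commute)
  also have "c / \<Delta> = 4 * (Lc * sqrt Lc * D / sqrt \<mu> / \<Delta>)" unfolding c_def by simp
  also have "Lc * sqrt Lc * D / sqrt \<mu> / \<Delta> = G" unfolding G_def Lpowr by (simp add: real_sqrt_divide)
  finally have qG: "(1 + s) ^ t < 4 * G" .
  have "1 \<le> (1 + s) ^ t" using s by simp
  hence G: "1 < 4 * G" using qG by simp
  have "real t * ln (1 + s) = ln ((1 + s) ^ t)" using s by (simp add: ln_realpow)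
  also have "\<dots> < ln (4 * G)" using qG G s by simp
  finally have tl: "real t * ln (1 + s) < ln (4 * G)" .
  have "2 * s / (2 + s) \<le> ln (1 + s)" using s by (intro ln_one_plus_ge) simp
  hence "real t * (2 * s / (2 + s)) \<le> real t * ln (1 + s)" by (rule mult_left_mono) simp
  hence "real t * (2 * s / (2 + s)) < ln (4 * G)" using tl by simp
  hence "real t < (1 / s + 1 / 2) * ln (4 * G)" using s by (simp add: field_simps)
  moreover have "1 / s = 2 * sqrt (Lc / \<mu>)"
    unfolding s_def using \<mu>_pos Lc_pos by (simp add: real_sqrt_divide)
  moreover have ln2: "0 < ln (2::real)" "ln (2::real) \<le> 1" using ln_le_minus_one[of 2] by auto
  moreover have l4: "0 < ln (4 * G)" using G by simp
  moreover have "ln (9 * G) = ln (4 * G) + ln (9 / 4)"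
    using G ln_mult_pos[of "4 * G" "9 / 4"] by simp
  moreover have "5 / 9 \<le> ln (9 / 4 :: real)"
    using ln_le_minus_one[of "4 / 9 :: real"] ln_inverse[of "9 / 4 :: real"] by simp
  \<comment> \<open>Passing from 4 to 9 in the logarithm pays for the remaining iteration:
    \<open>1 / s \<ge> 2\<close> and \<open>ln (9 / 4) \<ge> 5 / 9\<close> give a gain above
    1.\<close>
  moreover have "1 + (1 / s + 1 / 2) * ln (4 * G) \<le> (1 / s + 1 / ln 2) * ln (9 * G)"
  proof -
    have i: "2 \<le> 1 / s" using s by (simp add: field_simps)
    have j: "1 \<le> 1 / ln (2::real)" using ln2 by (simp add: field_simps)
    have "(1 / s + 1 / 2) * ln (4 * G) \<le> (1 / s + 1 / ln 2) * ln (4 * G)"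
      using l4 j by (intro mult_right_mono) auto
    moreover have "2 * (5 / 9) \<le> (1 / s + 1 / ln 2) * ln (9 / 4)"
      by (rule mult_mono) (use i j \<open>5 / 9 \<le> ln (9 / 4 :: real)\<close> in linarith)+
    ultimately show ?thesis
      unfolding \<open>ln (9 * G) = ln (4 * G) + ln (9 / 4)\<close> distrib_left by linarith
  qed
  ultimately have "real T \<le> 2 + (2 * sqrt (Lc / \<mu>) + 1 / ln 2) * ln (9 * G)" and "0 \<le> ln (9 * G)"
    unfolding T by (auto simp: mult.commute)
  moreover have "9 / \<Delta> * D * sqrt (1 / \<mu>) * Lc powr (3 / 2) = 9 * G" unfolding G_def by simp
  ultimately show ?thesis by simp
qed

end

section \<open>The penalty terms\<close>

lemma has_real_derivative_pos_sq:
  "((\<lambda>s. (max 0 s)\<^sup>2) has_real_derivative 2 * max 0 s) (at (s::real))"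
proof -
  consider "0 < s" | "s < 0" | "s = 0" by linarith
  thus ?thesis
  proof cases
    case 1
    have "((\<lambda>s. s\<^sup>2) has_real_derivative 2 * s) (at s)" by (auto intro!: derivative_eq_intros)
    from has_field_derivative_transform_within_open[OF this, of "{0<..}" "\<lambda>s. (max 0 s)\<^sup>2"] 1
    show ?thesis by (auto simp: max_def)
  next
    case 2
    have "((\<lambda>s. 0) has_real_derivative 0) (at s)" by simp
    from has_field_derivative_transform_within_open[OF this, of "{..<0}" "\<lambda>s. (max 0 s)\<^sup>2"] 2
    show ?thesis by (auto simp: max_def)
  next
    case 3
    have "((\<lambda>h. (max 0 h)\<^sup>2 / h) \<longlongrightarrow> 0) (at (0::real))"
    proof (rule Lim_null_comparison)
      have "norm ((max 0 h)\<^sup>2 / h) \<le> \<bar>h\<bar>" for h :: real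
        by (auto simp: max_def power2_eq_square)
      thus "\<forall>\<^sub>F h in at 0. norm ((max 0 h)\<^sup>2 / h) \<le> \<bar>h\<bar>" by simp
      show "((\<lambda>h. \<bar>h\<bar>) \<longlongrightarrow> 0) (at (0::real))" by (rule tendsto_rabs_zero) (rule tendsto_ident_at)
    qed
    thus ?thesis unfolding 3 by (simp add: DERIV_def)
  qed
qed

lemma convex_on_pos_sq:
  fixes q :: "'a::real_vector \<Rightarrow> real"
  assumes q: "convex_on X q"
  shows "convex_on X (\<lambda>x. (max 0 (q x))\<^sup>2)"
proof (rule convex_onI)
  fix t :: real and x y
  assume t: "0 < t" "t < 1" and xy: "x \<in> X" "y \<in> X"
  let ?p = "\<lambda>x. max 0 (q x)"
  have "q ((1 - t) *\<^sub>R x + t *\<^sub>R y) \<le> (1 - t) * q x + t * q y"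
    using convex_onD[OF q, of t x y] t xy by simp
  also have "\<dots> \<le> (1 - t) * ?p x + t * ?p y" using t by (intro add_mono mult_left_mono) auto
  finally have "?p ((1 - t) *\<^sub>R x + t *\<^sub>R y) \<le> (1 - t) * ?p x + t * ?p y"
    using t by (auto intro!: add_nonneg_nonneg mult_nonneg_nonneg)
  hence "(?p ((1 - t) *\<^sub>R x + t *\<^sub>R y))\<^sup>2 \<le> ((1 - t) * ?p x + t * ?p y)\<^sup>2" by (intro power_mono) auto
  also have "\<dots> = (1 - t) * (?p x)\<^sup>2 + t * (?p y)\<^sup>2 - t * (1 - t) * (?p x - ?p y)\<^sup>2"
    by (simp add: power2_eq_square algebra_simps)
  also have "\<dots> \<le> (1 - t) * (?p x)\<^sup>2 + t * (?p y)\<^sup>2" using t by simp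
  finally show "(?p ((1 - t) *\<^sub>R x + t *\<^sub>R y))\<^sup>2 \<le> (1 - t) * (?p x)\<^sup>2 + t * (?p y)\<^sup>2" .
qed (use q in \<open>simp add: convex_on_def\<close>)

lemma norm_sq_vec: "(norm (u :: real^'m))\<^sup>2 = (\<Sum>i\<in>UNIV. (u $ i)\<^sup>2)"
  unfolding power2_norm_eq_inner inner_vec_def by (simp add: power2_eq_square)

text \<open>Scaling by \<beta> moves it into the positive part, where the undamped multiplier
  becomes visible.\<close>

lemma penalty_terms_eq:
  assumes "0 < \<beta>"
  shows "penalty_terms A b g \<beta> y z x = y \<bullet> (A *v x - b) + \<beta> / 2 * (norm (A *v x - b))\<^sup>2
    + (1 / (2 * \<beta>) * (\<Sum>i\<in>UNIV. (max 0 (z $ i + \<beta> * g x $ i))\<^sup>2) - (norm z)\<^sup>2 / (2 * \<beta>))"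
proof -
  have "(max 0 (g x $ i + z $ i / \<beta>))\<^sup>2 = (max 0 (z $ i + \<beta> * g x $ i))\<^sup>2 / \<beta>\<^sup>2" for i
  proof -
    have "max 0 (g x $ i + z $ i / \<beta>) = max 0 (z $ i + \<beta> * g x $ i) / \<beta>"
      using assms by (auto simp: max_def field_simps)
    thus ?thesis by (simp add: power_divide)
  qed
  hence "(norm (pos (g x + z /\<^sub>R \<beta>)))\<^sup>2 = (\<Sum>i\<in>UNIV. (max 0 (z $ i + \<beta> * g x $ i))\<^sup>2) / \<beta>\<^sup>2"
    unfolding norm_sq_vec pos_def by (simp add: divide_inverse mult.commute sum_distrib_left)
  thus ?thesis unfolding penalty_terms_def using assms by (simp add: power2_eq_square)
qed

lemma inner_transpose: "(transpose A *v y) \<bullet> d = y \<bullet> (A *v d)" for A :: "real^'d^'n"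
  by (simp add: transpose_matrix_vector dot_lmul_matrix)

definition cgrad :: "(real^'d \<Rightarrow> real^'m) \<Rightarrow> 'm \<Rightarrow> real^'d \<Rightarrow> real^'d" where
  "cgrad g i x = gradient (\<lambda>x. g x $ i) x"

text \<open>With \<open>mult_ineq\<close>, the multipliers of a full step \<beta>, without damping.
  The gradient of the penalty terms is that of the ordinary Lagrangian terms at these values, and
  they are the witnesses in the KKT conditions.\<close>

definition mult_eq :: "real^'d^'n \<Rightarrow> real^'n \<Rightarrow> real \<Rightarrow> real^'n \<Rightarrow> real^'d \<Rightarrow> real^'n" where
  "mult_eq A b \<beta> y x = y + \<beta> *\<^sub>R (A *v x - b)"

definition mult_ineq :: "(real^'d \<Rightarrow> real^'m) \<Rightarrow> real \<Rightarrow> real^'m \<Rightarrow> real^'d \<Rightarrow> real^'m" where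
  "mult_ineq g \<beta> z x = (\<chi> i. max 0 (z $ i + \<beta> * g x $ i))"

definition penalty_grad where
  "penalty_grad A b g \<beta> y z x = transpose A *v mult_eq A b \<beta> y x
     + (\<Sum>i\<in>UNIV. (mult_ineq g \<beta> z x $ i) *\<^sub>R cgrad g i x)"

lemma has_derivative_penalty:
  fixes g :: "real^'d \<Rightarrow> real^'m"
  assumes \<beta>: "0 < \<beta>" and g: "\<And>i. (\<lambda>x. g x $ i) differentiable (at x)"
  shows "(penalty_terms A b g \<beta> y z has_derivative (\<lambda>d. penalty_grad A b g \<beta> y z x \<bullet> d)) (at x)"
proof -
  have gi: "((\<lambda>x. g x $ i) has_derivative (\<lambda>d. cgrad g i x \<bullet> d)) (at x)" for i
    unfolding cgrad_def by (rule has_derivative_gradient[OF g])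
  have pi: "((\<lambda>x. (max 0 (z $ i + \<beta> * g x $ i))\<^sup>2) has_derivative
      (\<lambda>d. 2 * max 0 (z $ i + \<beta> * g x $ i) * (\<beta> * (cgrad g i x \<bullet> d)))) (at x)" for i
    by (rule has_derivative_compose[where f = "\<lambda>x. z $ i + \<beta> * g x $ i" and g = "\<lambda>s. (max 0 s)\<^sup>2"])
       (auto intro!: derivative_eq_intros gi has_real_derivative_pos_sq[unfolded has_field_derivative_def])
  have Ax: "((\<lambda>x. A *v x - b) has_derivative (\<lambda>d. A *v d)) (at x)"
    by (auto intro!: derivative_eq_intros bounded_linear_imp_has_derivative matrix_vector_mul_bounded_linear)
  have 1: "(penalty_terms A b g \<beta> y z has_derivative (\<lambda>d.
      y \<bullet> (A *v d) + \<beta> / 2 * ((A *v x - b) \<bullet> (A *v d) + (A *v d) \<bullet> (A *v x - b))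
      + (1 / (2 * \<beta>) * (\<Sum>i\<in>UNIV. 2 * max 0 (z $ i + \<beta> * g x $ i) * (\<beta> * (cgrad g i x \<bullet> d))) - 0))) (at x)"
    unfolding penalty_terms_eq[OF \<beta>, abs_def] power2_norm_eq_inner
    by (intro has_derivative_add has_derivative_diff has_derivative_const has_derivative_sum
          has_derivative_mult_right has_derivative_inner_right has_derivative_inner Ax pi)
  have 2: "1 / (2 * \<beta>) * (2 * c * (\<beta> * e)) = c * e" for c e using \<beta> by simp
  have "penalty_grad A b g \<beta> y z x \<bullet> d = y \<bullet> (A *v d) + \<beta> / 2 * ((A *v x - b) \<bullet> (A *v d) + (A *v d) \<bullet> (A *v x - b))
      + (1 / (2 * \<beta>) * (\<Sum>i\<in>UNIV. 2 * max 0 (z $ i + \<beta> * g x $ i) * (\<beta> * (cgrad g i x \<bullet> d))) - 0)" for d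
    unfolding penalty_grad_def mult_eq_def mult_ineq_def
    by (simp only: inner_add_left inner_transpose inner_sum_left sum_distrib_left 2 inner_scaleR_left
          vec_lambda_beta inner_commute[of "A *v d"]) simp
  with 1 show ?thesis by presburger
qed

lemma norm_mult_le:
  fixes M :: "real^'n^'m"
  shows "norm (M *v x) \<le> matrix_norm M * norm x"
  unfolding matrix_norm_def by (rule onorm) (rule matrix_vector_mul_bounded_linear)

lemma sum_abs_le_sqrt_card:
  fixes z :: "real^'m"
  shows "(\<Sum>i\<in>UNIV. \<bar>z $ i\<bar>) \<le> sqrt (real CARD('m)) * norm z"
proof -
  have "(\<Sum>i\<in>UNIV. \<bar>z $ i\<bar>)\<^sup>2 \<le> (\<Sum>i\<in>UNIV. (\<bar>z $ i\<bar>)\<^sup>2) * real CARD('m)"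
    using sum_squared_le_sum_of_squares[of "\<lambda>i. \<bar>z $ i\<bar>" "UNIV :: 'm set"] by simp
  also have "\<dots> = (sqrt (real CARD('m)) * norm z)\<^sup>2"
    by (simp add: power_mult_distrib norm_sq_vec mult.commute)
  finally show ?thesis by (rule power2_le_imp_le) simp
qed

text \<open>Origin of \<open>C\<^sub>2\<close> and of the last term of \<open>C\<^sub>3\<close>: per
  unit of distance, a product of multiplier and constraint gradient varies by at most
  \<open>\<beta> B_g\<close> times \<open>B_g\<close> through the first factor and
  \<open>(z_i + \<beta> B_g) L_g\<close> through the second, and the entries of \<open>z\<close> sum
  to at most \<open>sqrt m\<close> times \<open>norm z\<close>.\<close>

lemma penalty_grad_lipschitz:
  fixes g :: "real^'d \<Rightarrow> real^'m"
  assumes \<beta>: "0 < \<beta>" and z: "0 \<le> z" and x: "x \<in> X" and x': "x' \<in> X"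
    and bound: "\<And>x i. x \<in> X \<Longrightarrow> \<bar>g x $ i\<bar> \<le> B_g" "\<And>x i. x \<in> X \<Longrightarrow> norm (cgrad g i x) \<le> B_g"
    and lip: "\<And>x x' i. x \<in> X \<Longrightarrow> x' \<in> X \<Longrightarrow> \<bar>g x $ i - g x' $ i\<bar> \<le> B_g * norm (x - x')"
    and glip: "\<And>x x' i. x \<in> X \<Longrightarrow> x' \<in> X \<Longrightarrow> norm (cgrad g i x - cgrad g i x') \<le> L_g * norm (x - x')"
    and "0 \<le> L_g" "0 < B_g"
  shows "norm (penalty_grad A b g \<beta> y z x - penalty_grad A b g \<beta> y z x')
    \<le> (\<beta> * (matrix_norm (transpose A ** A) + real CARD('m) * B_g * (B_g + L_g))
        + sqrt (real CARD('m)) * L_g * norm z) * norm (x - x')"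
proof -
  let ?N = "norm (x - x')"
  let ?m = "\<lambda>i x. mult_ineq g \<beta> z x $ i"
  let ?t = "\<lambda>i x. ?m i x *\<^sub>R cgrad g i x"
  have zi: "0 \<le> z $ i" for i using z by (simp add: less_eq_vec_def)
  have i: "norm (?t i x - ?t i x')
      \<le> (\<beta> * (B_g * (B_g + L_g)) + L_g * \<bar>z $ i\<bar>) * ?N" for i
  proof -
    have "?t i x - ?t i x'
        = (?m i x - ?m i x') *\<^sub>R cgrad g i x + ?m i x' *\<^sub>R (cgrad g i x - cgrad g i x')"
      by (simp add: algebra_simps)
    hence "norm (?t i x - ?t i x')
        \<le> \<bar>?m i x - ?m i x'\<bar> * norm (cgrad g i x) + \<bar>?m i x'\<bar> * norm (cgrad g i x - cgrad g i x')"
      by (metis norm_scaleR norm_triangle_ineq)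
    also have "\<dots> \<le> (\<beta> * (B_g * ?N)) * B_g + (z $ i + \<beta> * B_g) * (L_g * ?N)"
    proof (intro add_mono mult_mono)
      have "\<bar>?m i x - ?m i x'\<bar> \<le> \<bar>\<beta> * g x $ i - \<beta> * g x' $ i\<bar>"
        unfolding mult_ineq_def by (auto simp: max_def)
      also have "\<dots> = \<beta> * \<bar>g x $ i - g x' $ i\<bar>" using \<beta> by (simp add: right_diff_distrib[symmetric] abs_mult)
      also have "\<dots> \<le> \<beta> * (B_g * ?N)" using lip[OF x x'] \<beta> by (intro mult_left_mono) auto
      finally show "\<bar>?m i x - ?m i x'\<bar> \<le> \<beta> * (B_g * ?N)" .
      have "\<beta> * g x' $ i \<le> \<beta> * B_g" using bound(1)[OF x', of i] \<beta> by (intro mult_left_mono) auto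
      thus "\<bar>?m i x'\<bar> \<le> z $ i + \<beta> * B_g" unfolding mult_ineq_def using zi[of i] \<beta> assms by (auto simp: max_def)
    qed (use bound glip x x' zi[of i] \<beta> assms in auto)
    finally show ?thesis using zi[of i] by (simp add: algebra_simps)
  qed
  have "mult_eq A b \<beta> y x - mult_eq A b \<beta> y x' = \<beta> *\<^sub>R (A *v (x - x'))"
    unfolding mult_eq_def by (simp add: matrix_vector_mult_diff_distrib scaleR_diff_right)
  hence "norm (transpose A *v mult_eq A b \<beta> y x - transpose A *v mult_eq A b \<beta> y x')
      = \<beta> * norm ((transpose A ** A) *v (x - x'))"
    unfolding matrix_vector_mult_diff_distrib[symmetric] using \<beta>
    by (simp only: matrix_vector_mult_scaleR matrix_vector_mul_assoc norm_scaleR abs_of_pos)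
  also have "\<dots> \<le> \<beta> * (matrix_norm (transpose A ** A) * ?N)"
    using \<beta> by (intro mult_left_mono norm_mult_le) auto
  finally have 1: "norm (transpose A *v mult_eq A b \<beta> y x - transpose A *v mult_eq A b \<beta> y x')
      \<le> \<beta> * (matrix_norm (transpose A ** A) * ?N)" .
  have "norm (\<Sum>i\<in>UNIV. ?t i x - ?t i x')
      \<le> (\<Sum>i\<in>UNIV. (\<beta> * (B_g * (B_g + L_g)) + L_g * \<bar>z $ i\<bar>) * ?N)"
    by (rule sum_norm_le) (rule i)
  also have "\<dots> = (\<beta> * (real CARD('m) * B_g * (B_g + L_g)) + L_g * (\<Sum>i\<in>UNIV. \<bar>z $ i\<bar>)) * ?N"
    by (simp add: sum.distrib sum_distrib_right[symmetric] sum_distrib_left[symmetric] algebra_simps)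
  also have "\<dots> \<le> (\<beta> * (real CARD('m) * B_g * (B_g + L_g)) + L_g * (sqrt (real CARD('m)) * norm z)) * ?N"
    using assms by (intro mult_right_mono add_left_mono mult_left_mono sum_abs_le_sqrt_card) auto
  finally have 2: "norm (\<Sum>i\<in>UNIV. ?t i x - ?t i x') \<le> \<dots>" .
  have "penalty_grad A b g \<beta> y z x - penalty_grad A b g \<beta> y z x'
      = (transpose A *v mult_eq A b \<beta> y x - transpose A *v mult_eq A b \<beta> y x')
        + (\<Sum>i\<in>UNIV. ?t i x - ?t i x')"
    unfolding penalty_grad_def by (simp add: sum_subtractf)
  hence "norm (penalty_grad A b g \<beta> y z x - penalty_grad A b g \<beta> y z x')
      \<le> norm (transpose A *v mult_eq A b \<beta> y x - transpose A *v mult_eq A b \<beta> y x')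
        + norm (\<Sum>i\<in>UNIV. ?t i x - ?t i x')"
    by (simp add: norm_triangle_ineq)
  with 1 2 show ?thesis by (simp add: algebra_simps)
qed

lemma convex_on_sum_fun:
  assumes "finite I" "convex X" "\<And>i. i \<in> I \<Longrightarrow> convex_on X (f i)"
  shows "convex_on X (\<lambda>x. \<Sum>i\<in>I. f i x)"
  using assms by (induction I) (auto intro!: convex_on_add simp: convex_on_const)

lemma convex_on_penalty:
  fixes g :: "real^'d \<Rightarrow> real^'m"
  assumes \<beta>: "0 < \<beta>" and X: "convex X" and g: "\<And>i. convex_on X (\<lambda>x. g x $ i)"
  shows "convex_on X (penalty_terms A b g \<beta> y z)"
proof -
  have lin: "convex_on X (\<lambda>x. c + y \<bullet> (A *v x - b))" for c y
    using convex_on_affine[OF X, of "c - y \<bullet> b" "transpose A *v y"]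
    by (simp add: dot_lmul_matrix inner_diff_right algebra_simps)
  have quad: "convex_on X (\<lambda>x. \<beta> / 2 * (norm (A *v x - b))\<^sup>2)"
  proof (rule convex_onI[OF _ X])
    fix t :: real and u v
    assume t: "0 < t" "t < 1"
    have e: "A *v ((1 - t) *\<^sub>R u + t *\<^sub>R v) - b = (1 - t) *\<^sub>R (A *v u - b) + t *\<^sub>R (A *v v - b)"
      by (simp add: matrix_vector_right_distrib matrix_vector_mult_scaleR algebra_simps)
    show "\<beta> / 2 * (norm (A *v ((1 - t) *\<^sub>R u + t *\<^sub>R v) - b))\<^sup>2
        \<le> (1 - t) * (\<beta> / 2 * (norm (A *v u - b))\<^sup>2) + t * (\<beta> / 2 * (norm (A *v v - b))\<^sup>2)"
      unfolding e using convex_onD[OF convex_on_norm_sq[OF convex_UNIV, of "\<beta> / 2"], of t] \<beta> t by simp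
  qed
  have ineq: "convex_on X (\<lambda>x. 1 / (2 * \<beta>) * (\<Sum>i\<in>UNIV. (max 0 (z $ i + \<beta> * g x $ i))\<^sup>2))"
    using \<beta> X by (intro convex_on_cmul convex_on_sum_fun convex_on_pos_sq convex_on_add g)
      (auto simp: convex_on_const)
  have "convex_on X (\<lambda>x. (- ((norm z)\<^sup>2 / (2 * \<beta>)) + y \<bullet> (A *v x - b)) + \<beta> / 2 * (norm (A *v x - b))\<^sup>2
      + 1 / (2 * \<beta>) * (\<Sum>i\<in>UNIV. (max 0 (z $ i + \<beta> * g x $ i))\<^sup>2))"
    by (intro convex_on_add lin quad ineq)
  thus ?thesis unfolding penalty_terms_eq[OF \<beta>, abs_def] by (simp add: algebra_simps)
qed

section \<open>Boundedness of the multipliers\<close>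

text \<open>Link between the Jacobian in \<open>eps_KKT\<close> and the gradients of the components,
  in which the penalty is expressed.\<close>

lemma jacobian_rows:
  fixes g :: "real^'d \<Rightarrow> real^'m"
  assumes "\<And>i. (\<lambda>x. g x $ i) differentiable (at x)"
  shows "jacobian g (at x) $ i = cgrad g i x"
proof -
  have "g differentiable (at x)"
  proof (rule differentiable_componentwise_within[THEN iffD2], rule ballI)
    fix e :: "real^'m" assume "e \<in> Basis"
    then obtain j where "e = axis j 1" by (auto simp: Basis_vec_def)
    thus "(\<lambda>x. g x \<bullet> e) differentiable (at x)" using assms[of j] by (simp add: inner_axis)
  qed
  hence "(g has_derivative (\<lambda>h. jacobian g (at x) *v h)) (at x)" by (simp add: jacobian_works)
  hence "((\<lambda>x. g x $ i) has_derivative (\<lambda>h. (jacobian g (at x) *v h) $ i)) (at x)"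
    by (rule bounded_linear.has_derivative[OF bounded_linear_vec_nth])
  moreover have "((\<lambda>x. g x $ i) has_derivative (\<lambda>d. cgrad g i x \<bullet> d)) (at x)"
    unfolding cgrad_def by (rule has_derivative_gradient[OF assms])
  ultimately have "(\<lambda>h. (jacobian g (at x) *v h) $ i) = (\<lambda>d. cgrad g i x \<bullet> d)"
    by (rule has_derivative_unique)
  hence "jacobian g (at x) $ i \<bullet> h = cgrad g i x \<bullet> h" for h
    by (metis matrix_vector_mul_component)
  thus ?thesis by (metis vector_eq_rdot)
qed

lemma transpose_mult_rows:
  fixes J :: "real^'d^'m"
  shows "transpose J *v z = (\<Sum>i\<in>UNIV. z $ i *\<^sub>R J $ i)"
proof -
  have "(transpose J *v z) \<bullet> h = (\<Sum>i\<in>UNIV. z $ i *\<^sub>R J $ i) \<bullet> h" for h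
    unfolding inner_transpose by (simp add: inner_vec_def[of z] matrix_vector_mul_component inner_sum_left)
  thus ?thesis by (metis vector_eq_rdot)
qed

text \<open>A segment from \<open>c\<close> to a point outside \<open>X\<close> meets the frontier,
  strictly before its end because \<open>X\<close> is closed. Hence even the closed ball stays
  inside.\<close>

lemma cball_subset_infdist_frontier:
  fixes c :: "'a::euclidean_space"
  assumes "closed X" "c \<in> X" "\<tau> \<le> infdist c (frontier X)"
  shows "cball c \<tau> \<subseteq> X"
proof
  fix p assume p: "p \<in> cball c \<tau>"
  show "p \<in> X"
  proof (rule ccontr)
    assume "p \<notin> X"
    hence "closed_segment c p \<inter> frontier X \<noteq> {}"
      using assms by (intro connected_Int_frontier) (auto intro: connected_segment)
    then obtain q where q: "q \<in> closed_segment c p" "q \<in> frontier X" by blast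
    have "q \<in> X" using q assms(1) frontier_subset_closed by blast
    hence "q \<noteq> p" using \<open>p \<notin> X\<close> by blast
    moreover have "dist c p = dist c q + dist q p"
      using between[of c p q] q(1) by (simp add: between_mem_segment)
    ultimately have "dist c q < dist c p" by simp
    moreover have "infdist c (frontier X) \<le> dist c q" using q(2) by (rule infdist_le)
    ultimately show False using p assms(3) by simp
  qed
qed

text \<open>Used with \<open>p\<close> the updated and \<open>q\<close> the old multiplier: the
  pairing of the new multiplier with a constraint value becomes a difference of squared
  norms.\<close>

lemma inner_diff_ge: "p \<bullet> (p - q) \<ge> ((norm p)\<^sup>2 - (norm q)\<^sup>2) / 2" for p q :: "'a::real_inner"
proof -
  have "0 \<le> (norm (p - q))\<^sup>2" by simp
  also have "\<dots> = 2 * (p \<bullet> (p - q)) - ((norm p)\<^sup>2 - (norm q)\<^sup>2)"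
    by (simp add: power2_norm_eq_inner inner_diff_left inner_diff_right inner_commute)
  finally show ?thesis by simp
qed

text \<open>The hypotheses in the form in which they are used: real functions, with the inequalities
  at points of \<open>X\<close>. The extended-valued \<open>h\<close> is represented by
  \<open>hr\<close>.\<close>

locale constrained_problem =
  fixes f hr :: "real^'d \<Rightarrow> real" and A :: "real^'d^'n" and b :: "real^'n"
    and g :: "real^'d \<Rightarrow> real^'m" and X :: "(real^'d) set" and x_feas :: "real^'d"
    and \<rho> L_f L_g r_h B_g B_f D g_min :: real
  assumes X_compact: "compact X"
    and hr_convex: "convex_on X hr" and hr_cont: "continuous_on X hr"
    and \<rho>_pos: "0 < \<rho>" and f_weakly_convex: "convex_on X (\<lambda>x. f x + \<rho> / 2 * (norm x)\<^sup>2)"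
    and f_diff: "\<And>x. x \<in> X \<Longrightarrow> f differentiable (at x)"
    and f_lip: "\<And>x x'. x \<in> X \<Longrightarrow> x' \<in> X \<Longrightarrow> norm (gradient f x - gradient f x') \<le> L_f * norm (x - x')"
    and L_f_nonneg: "0 \<le> L_f"
    and g_convex: "\<And>i. convex_on X (\<lambda>x. g x $ i)"
    and g_diff: "\<And>x i. x \<in> X \<Longrightarrow> (\<lambda>x. g x $ i) differentiable (at x)"
    and g_lip: "\<And>x x' i. x \<in> X \<Longrightarrow> x' \<in> X \<Longrightarrow> norm (cgrad g i x - cgrad g i x') \<le> L_g * norm (x - x')"
    and L_g_nonneg: "0 \<le> L_g"
    and x_feas_interior: "x_feas \<in> interior X" and x_feas_eq: "A *v x_feas = b"
    and x_feas_ineq: "\<And>i. g x_feas $ i \<le> - g_min" and g_min_pos: "0 < g_min"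
    and hr_subgradient: "\<And>x v. x \<in> X \<Longrightarrow> (\<And>u. u \<in> X \<Longrightarrow> hr x + v \<bullet> (u - x) \<le> hr u) \<Longrightarrow>
          \<exists>p w. v = p + w \<and> p \<in> normal_cone X x \<and> norm w \<le> r_h"
    and B_g_pos: "0 < B_g"
    and g_bound: "\<And>x i. x \<in> X \<Longrightarrow> \<bar>g x $ i\<bar> \<le> B_g" "\<And>x i. x \<in> X \<Longrightarrow> norm (cgrad g i x) \<le> B_g"
    and g_lipschitz: "\<And>x x' i. x \<in> X \<Longrightarrow> x' \<in> X \<Longrightarrow> \<bar>g x $ i - g x' $ i\<bar> \<le> B_g * norm (x - x')"
    and f_bound: "\<And>x. x \<in> X \<Longrightarrow> norm (gradient f x) \<le> B_f"
    and diam: "\<And>x x'. x \<in> X \<Longrightarrow> x' \<in> X \<Longrightarrow> norm (x - x') \<le> D"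
begin

lemma X_convex: "convex X" using hr_convex by (simp add: convex_on_def)

lemma x_feas_in: "x_feas \<in> X" using x_feas_interior interior_subset by blast

section \<open>Stationarity of a subproblem\<close>

abbreviation "pen \<equiv> penalty_terms A b g"
abbreviation "pgrad \<equiv> penalty_grad A b g"

definition subobj :: "real \<Rightarrow> real^'n \<Rightarrow> real^'m \<Rightarrow> real^'d \<Rightarrow> real^'d \<Rightarrow> real" where
  "subobj \<beta> y z xk x = f x + hr x + pen \<beta> y z x + \<rho> * (norm (x - xk))\<^sup>2"

lemma f_has_derivative: "x \<in> X \<Longrightarrow> (f has_derivative (\<lambda>d. gradient f x \<bullet> d)) (at x)"
  by (intro has_derivative_gradient f_diff)

lemma penalty_has_derivative:
  "0 < \<beta> \<Longrightarrow> x \<in> X \<Longrightarrow>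
    (pen \<beta> y z has_derivative (\<lambda>d. pgrad \<beta> y z x \<bullet> d)) (at x)"
  by (intro has_derivative_penalty g_diff)

lemma has_derivative_prox_term:
  "((\<lambda>x. \<rho> * (norm (x - xk))\<^sup>2) has_derivative (\<lambda>d. ((2 * \<rho>) *\<^sub>R (x - xk)) \<bullet> d)) (at x)"
  for x xk :: "real^'d"
  using has_derivative_sq_norm_diff[of "2 * \<rho>" xk x] by simp

lemma objective_wc_convex: "convex_on X (\<lambda>x. f x + hr x + \<rho> / 2 * (norm x)\<^sup>2)"
proof -
  have "convex_on X (\<lambda>x. (f x + \<rho> / 2 * (norm x)\<^sup>2) + hr x)"
    by (intro convex_on_add f_weakly_convex hr_convex)
  thus ?thesis by (simp add: algebra_simps)
qed

text \<open>All summands except \<open>hr\<close> are differentiable and move to the other side; in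
  this form the assumption on normal cones applies.\<close>

lemma subobj_subgradient_h:
  assumes "0 < \<beta>" "x \<in> X" "u \<in> X" "\<And>u. u \<in> X \<Longrightarrow> subobj \<beta> y z xk x + v \<bullet> (u - x) \<le> subobj \<beta> y z xk u"
  shows "hr x + (v - (gradient f x + pgrad \<beta> y z x + (2 * \<rho>) *\<^sub>R (x - xk))) \<bullet> (u - x) \<le> hr u"
proof (rule convex_directional[OF hr_convex _ assms(2,3)])
  show "((\<lambda>x. f x + pen \<beta> y z x + \<rho> * (norm (x - xk))\<^sup>2) has_derivative
     (\<lambda>d. (gradient f x + pgrad \<beta> y z x + (2 * \<rho>) *\<^sub>R (x - xk)) \<bullet> d)) (at x)"
    unfolding inner_add_left
    by (intro has_derivative_add f_has_derivative penalty_has_derivative has_derivative_prox_term assms)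
  fix u assume "u \<in> X"
  from assms(4)[OF this] show "hr x + (f x + pen \<beta> y z x + \<rho> * (norm (x - xk))\<^sup>2) + v \<bullet> (u - x)
      \<le> hr u + (f u + pen \<beta> y z u + \<rho> * (norm (u - xk))\<^sup>2)"
    unfolding subobj_def by simp
qed

text \<open>The square is added to \<open>f + hr\<close> and taken from the smooth terms, because
  the weak subdifferential is defined through the convex function with the square added.\<close>

lemma subobj_subgradient_F:
  assumes "0 < \<beta>" "x \<in> X" "u \<in> X" "\<And>u. u \<in> X \<Longrightarrow> subobj \<beta> y z xk x + v \<bullet> (u - x) \<le> subobj \<beta> y z xk u"
  shows "(f x + hr x + \<rho> / 2 * (norm x)\<^sup>2)
     + (v - (pgrad \<beta> y z x + (2 * \<rho>) *\<^sub>R (x - xk) - \<rho> *\<^sub>R x)) \<bullet> (u - x)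
    \<le> f u + hr u + \<rho> / 2 * (norm u)\<^sup>2"
proof (rule convex_directional[OF objective_wc_convex _ assms(2,3)])
  show "((\<lambda>x. pen \<beta> y z x + \<rho> * (norm (x - xk))\<^sup>2 - \<rho> / 2 * (norm x)\<^sup>2) has_derivative
     (\<lambda>d. (pgrad \<beta> y z x + (2 * \<rho>) *\<^sub>R (x - xk) - \<rho> *\<^sub>R x) \<bullet> d)) (at x)"
    unfolding inner_add_left inner_diff_left[of _ "\<rho> *\<^sub>R x"]
    using has_derivative_sq_norm_diff[of \<rho> 0 x]
    by (intro has_derivative_add has_derivative_diff penalty_has_derivative has_derivative_prox_term assms) simp
  fix u assume "u \<in> X"
  from assms(4)[OF this] show "f x + hr x + \<rho> / 2 * (norm x)\<^sup>2
       + (pen \<beta> y z x + \<rho> * (norm (x - xk))\<^sup>2 - \<rho> / 2 * (norm x)\<^sup>2) + v \<bullet> (u - x)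
      \<le> f u + hr u + \<rho> / 2 * (norm u)\<^sup>2
       + (pen \<beta> y z u + \<rho> * (norm (u - xk))\<^sup>2 - \<rho> / 2 * (norm u)\<^sup>2)"
    unfolding subobj_def by simp
qed

text \<open>The proximal term contributes \<rho> directly. Its modulus \<open>2 * \<rho>\<close>
  exceeds the weak convexity by \<rho>, and the resulting strong convexity of the subproblem
  contributes another \<open>\<rho> / 2\<close>.\<close>

lemma subobj_descent:
  assumes "0 < \<beta>" "x \<in> X" "xk \<in> X" "\<And>u. u \<in> X \<Longrightarrow> subobj \<beta> y z xk x + v \<bullet> (u - x) \<le> subobj \<beta> y z xk u"
  shows "f x + hr x + pen \<beta> y z x + 3 / 2 * \<rho> * (norm (x - xk))\<^sup>2
      \<le> f xk + hr xk + pen \<beta> y z xk + norm v * norm (x - xk)"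
proof -
  let ?c = "\<lambda>x. (f x + hr x + \<rho> / 2 * (norm x)\<^sup>2) + pen \<beta> y z x
      + (\<rho> * (norm xk)\<^sup>2 + (- 2 * \<rho>) *\<^sub>R xk \<bullet> x)"
  have "convex_on X ?c"
    using assms(1) X_convex g_convex
    by (intro convex_on_add objective_wc_convex convex_on_penalty convex_on_affine) auto
  moreover have "?c = (\<lambda>x. subobj \<beta> y z xk x - \<rho> / 2 * (norm x)\<^sup>2)"
    unfolding subobj_def power2_norm_eq_inner
    by (rule HOL.ext) (simp add: inner_diff_left inner_diff_right inner_commute algebra_simps)
  ultimately have "convex_on X (\<lambda>x. subobj \<beta> y z xk x - \<rho> / 2 * (norm x)\<^sup>2)" by (simp only:)
  from strongly_convex_subgradient[OF this assms(2,3,4)]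
  have "subobj \<beta> y z xk x + v \<bullet> (xk - x) + \<rho> / 2 * (norm (x - xk))\<^sup>2 \<le> subobj \<beta> y z xk xk"
    by (simp add: norm_minus_commute)
  moreover have "- (norm v * norm (x - xk)) \<le> v \<bullet> (xk - x)"
    using norm_cauchy_schwarz[of v "x - xk"] by (simp add: inner_diff_right)
  ultimately show ?thesis unfolding subobj_def by simp
qed

text \<open>Testing the stationarity condition against \<open>x_feas\<close>, moved by \<open>\<tau>\<close> in the direction
  \<open>- A\<^sup>T y\<close>, which the Slater point permits.\<close>

lemma multiplier_bound:
  fixes x xk :: "real^'d"
  assumes \<beta>: "0 < \<beta>" and x: "x \<in> X" and xk: "xk \<in> X"
    and stat: "\<And>u. u \<in> X \<Longrightarrow> subobj \<beta> y z xk x + v \<bullet> (u - x) \<le> subobj \<beta> y z xk u"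
    and v: "norm v \<le> 1"
    and \<tau>: "0 \<le> \<tau>" "cball x_feas \<tau> \<subseteq> X" "B_g * \<tau> \<le> g_min / 2"
    and \<kappa>: "0 < \<kappa>" "\<kappa> \<le> g_min / 2" "\<And>y. y \<in> range (\<lambda>x. A *v x) \<Longrightarrow> \<kappa> * norm y \<le> \<tau> * norm (transpose A *v y)"
    and \<Theta>: "D * (1 + r_h + B_f + 2 * \<rho> * D) \<le> \<kappa> * \<Theta>"
    and y: "y \<in> range (\<lambda>x. A *v x)" and z: "0 \<le> z"
  shows "norm (mult_eq A b \<beta> y x, mult_ineq g \<beta> z x) \<le> max (norm (y, z)) \<Theta>"
proof -
  define yb where "yb = mult_eq A b \<beta> y x"
  define zb where "zb = mult_ineq g \<beta> z x"
  have zb_nn: "0 \<le> zb $ i" for i unfolding zb_def mult_ineq_def by simp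
  obtain p w where pw: "v - (gradient f x + pgrad \<beta> y z x + (2 * \<rho>) *\<^sub>R (x - xk)) = p + w"
      "p \<in> normal_cone X x" "norm w \<le> r_h"
    using hr_subgradient[OF x subobj_subgradient_h[OF \<beta> x _ stat]] by blast
  define e where "e = transpose A *v yb"
  define x' where "x' = x_feas - \<tau> *\<^sub>R sgn e"
  have "norm (\<tau> *\<^sub>R sgn e) \<le> \<tau>" using \<tau>(1) by (simp add: norm_sgn)
  hence x': "x' \<in> X" using \<tau>(2) unfolding x'_def by (auto simp: dist_norm)
  have nd: "norm (x' - x) \<le> D" by (rule diam[OF x' x])
  have "p \<bullet> (x' - x) \<le> 0" using pw(2) x' unfolding normal_cone_def by blast
  moreover have "p = v - gradient f x - pgrad \<beta> y z x - (2 * \<rho>) *\<^sub>R (x - xk) - w"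
    using pw(1) by (simp add: algebra_simps)
  ultimately have "(v - gradient f x - (2 * \<rho>) *\<^sub>R (x - xk) - w) \<bullet> (x' - x) \<le> pgrad \<beta> y z x \<bullet> (x' - x)"
    by (simp add: inner_diff_left)
  moreover have "- ((1 + B_f + 2 * \<rho> * D + r_h) * D) \<le> (v - gradient f x - (2 * \<rho>) *\<^sub>R (x - xk) - w) \<bullet> (x' - x)"
  proof -
    let ?q = "v - gradient f x - (2 * \<rho>) *\<^sub>R (x - xk) - w"
    have "norm ((2 * \<rho>) *\<^sub>R (x - xk)) \<le> 2 * \<rho> * D" using diam[OF x xk] \<rho>_pos by simp
    hence "norm ?q \<le> 1 + B_f + 2 * \<rho> * D + r_h"
      using v f_bound[OF x] pw(3)
      by (smt (verit) norm_triangle_ineq4)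
    hence "norm ?q * norm (x' - x) \<le> (1 + B_f + 2 * \<rho> * D + r_h) * D" using nd by (intro mult_mono) (auto intro: order_trans[OF norm_ge_zero])
    moreover have "- (norm ?q * norm (x' - x)) \<le> ?q \<bullet> (x' - x)"
      using Cauchy_Schwarz_ineq2[of ?q "x' - x"] by linarith
    ultimately show ?thesis by linarith
  qed
  ultimately have low: "- (\<kappa> * \<Theta>) \<le> pgrad \<beta> y z x \<bullet> (x' - x)"
    using \<Theta> by (simp add: algebra_simps)
  have pg: "pgrad \<beta> y z x \<bullet> (x' - x) = yb \<bullet> (A *v (x' - x)) + (\<Sum>i\<in>UNIV. zb $ i * (cgrad g i x \<bullet> (x' - x)))"
    unfolding penalty_grad_def yb_def zb_def inner_add_left inner_transpose by (simp add: inner_sum_left)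
  have eq: "A *v (x' - x) = - (\<tau> *\<^sub>R (A *v sgn e)) - (A *v x - b)"
    unfolding x'_def using x_feas_eq
    by (simp add: matrix_vector_mult_diff_distrib matrix_vector_mult_scaleR)
  have "yb \<bullet> (A *v sgn e) = e \<bullet> sgn e" unfolding e_def by (simp only: inner_transpose)
  also have "\<dots> = norm e"
    by (cases "e = 0") (simp_all add: sgn_div_norm power2_norm_eq_inner[symmetric] power2_eq_square)
  finally have ye: "yb \<bullet> (A *v sgn e) = norm e" .
  have ybd: "yb = y + \<beta> *\<^sub>R (A *v x - b)" unfolding yb_def mult_eq_def ..
  \<comment> \<open>Since \<open>b = A x_feas\<close>, the update keeps the multiplier in the range
    of \<open>A\<close>, where \<kappa> gives a lower bound on its image under the
    transpose.\<close>
  have "yb \<in> range (\<lambda>x. A *v x)"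
  proof -
    obtain q where "y = A *v q" using y by blast
    hence "yb = A *v (q + \<beta> *\<^sub>R (x - x_feas))"
      unfolding ybd x_feas_eq[symmetric]
      by (simp add: matrix_vector_mult_add_rdistrib matrix_vector_right_distrib matrix_vector_mult_scaleR matrix_vector_mult_diff_distrib)
    thus ?thesis by blast
  qed
  hence \<kappa>y: "\<kappa> * norm yb \<le> \<tau> * norm e" unfolding e_def by (rule \<kappa>(3))
  have "((norm yb)\<^sup>2 - (norm y)\<^sup>2) / 2 \<le> yb \<bullet> (yb - y)" by (rule inner_diff_ge)
  also have "\<dots> = \<beta> * (yb \<bullet> (A *v x - b))" unfolding ybd by simp
  finally have yAx: "((norm yb)\<^sup>2 - (norm y)\<^sup>2) / (2 * \<beta>) \<le> yb \<bullet> (A *v x - b)"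
    using \<beta> by (simp add: field_simps)
  have z1: "zb $ i * (cgrad g i x \<bullet> (x' - x)) \<le> - \<kappa> * \<bar>zb $ i\<bar> - ((zb $ i)\<^sup>2 - (z $ i)\<^sup>2) / (2 * \<beta>)" for i
  proof -
    have "cgrad g i x \<bullet> (x' - x) \<le> g x' $ i - g x $ i"
      using convex_gradient_le[OF g_convex has_derivative_gradient[OF g_diff[OF x]] x x', of i]
      unfolding cgrad_def by simp
    hence "zb $ i * (cgrad g i x \<bullet> (x' - x)) \<le> zb $ i * (g x' $ i - g x $ i)"
      by (rule mult_left_mono) (rule zb_nn)
    \<comment> \<open>The shift by \<tau> uses up at most half of the Slater margin; the other half
      is at least \<kappa>.\<close>
    moreover have "g x' $ i \<le> - \<kappa>"
    proof -
      have "\<bar>g x' $ i - g x_feas $ i\<bar> \<le> B_g * norm (x' - x_feas)" by (rule g_lipschitz[OF x' x_feas_in])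
      also have "\<dots> \<le> B_g * \<tau>" using \<open>norm (\<tau> *\<^sub>R sgn e) \<le> \<tau>\<close> B_g_pos unfolding x'_def by (intro mult_left_mono) auto
      finally show ?thesis using x_feas_ineq[of i] \<tau>(3) \<kappa>(2) by linarith
    qed
    hence "zb $ i * g x' $ i \<le> - \<kappa> * \<bar>zb $ i\<bar>" using mult_left_mono[OF _ zb_nn, of "g x' $ i" "- \<kappa>" i] zb_nn[of i]
      by (simp add: mult.commute)
    moreover have "((zb $ i)\<^sup>2 - (z $ i)\<^sup>2) / (2 * \<beta>) \<le> zb $ i * g x $ i"
    proof -
      have "((zb $ i)\<^sup>2 - (z $ i)\<^sup>2) / 2 \<le> zb $ i * (zb $ i - z $ i)"
        using inner_diff_ge[of "zb $ i" "z $ i"] by simp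
      \<comment> \<open>Either \<open>zb_i\<close> is zero and so are both sides, or
        \<open>zb_i - z_i = \<beta> g_i(x)\<close>.\<close>
      also have "\<dots> = \<beta> * (zb $ i * g x $ i)"
        unfolding zb_def mult_ineq_def by (auto simp: max_def algebra_simps)
      finally show ?thesis using \<beta> by (simp add: field_simps)
    qed
    ultimately show ?thesis by (simp add: right_diff_distrib)
  qed
  have "(\<Sum>i\<in>UNIV. zb $ i * (cgrad g i x \<bullet> (x' - x)))
      \<le> (\<Sum>i\<in>UNIV. - \<kappa> * \<bar>zb $ i\<bar> - ((zb $ i)\<^sup>2 - (z $ i)\<^sup>2) / (2 * \<beta>))"
    by (rule sum_mono) (rule z1)
  also have "\<dots> = - \<kappa> * (\<Sum>i\<in>UNIV. \<bar>zb $ i\<bar>) - ((norm zb)\<^sup>2 - (norm z)\<^sup>2) / (2 * \<beta>)"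
    unfolding norm_sq_vec by (simp add: sum_subtractf sum_distrib_left sum_divide_distrib[symmetric] sum_negf)
  also have "\<dots> \<le> - \<kappa> * norm zb - ((norm zb)\<^sup>2 - (norm z)\<^sup>2) / (2 * \<beta>)"
    using norm_le_l1_cart[of zb] \<kappa>(1) by simp
  finally have zs: "(\<Sum>i\<in>UNIV. zb $ i * (cgrad g i x \<bullet> (x' - x)))
      \<le> - \<kappa> * norm zb - ((norm zb)\<^sup>2 - (norm z)\<^sup>2) / (2 * \<beta>)" .
  have "pgrad \<beta> y z x \<bullet> (x' - x)
      = - (\<tau> * norm e) - yb \<bullet> (A *v x - b) + (\<Sum>i\<in>UNIV. zb $ i * (cgrad g i x \<bullet> (x' - x)))"
    unfolding pg eq inner_diff_right[of yb "- (\<tau> *\<^sub>R (A *v sgn e))"] inner_minus_right inner_scaleR_right ye ..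
  with low zs \<kappa>y yAx
  have "\<kappa> * norm yb + \<kappa> * norm zb + (((norm yb)\<^sup>2 - (norm y)\<^sup>2) / (2 * \<beta>) + ((norm zb)\<^sup>2 - (norm z)\<^sup>2) / (2 * \<beta>)) \<le> \<kappa> * \<Theta>"
    by linarith
  moreover have "((norm yb)\<^sup>2 - (norm y)\<^sup>2) / (2 * \<beta>) + ((norm zb)\<^sup>2 - (norm z)\<^sup>2) / (2 * \<beta>)
      = ((norm (yb, zb))\<^sup>2 - (norm (y, z))\<^sup>2) / (2 * \<beta>)"
    by (simp add: norm_Pair add_divide_distrib diff_divide_distrib)
  moreover have "\<kappa> * norm (yb, zb) \<le> \<kappa> * norm yb + \<kappa> * norm zb"
    using mult_left_mono[OF norm_Pair_le[of yb zb], of \<kappa>] \<kappa>(1) by (simp add: distrib_left)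
  ultimately have main: "\<kappa> * norm (yb, zb) + ((norm (yb, zb))\<^sup>2 - (norm (y, z))\<^sup>2) / (2 * \<beta>) \<le> \<kappa> * \<Theta>"
    by linarith
  show ?thesis
  proof (cases "norm (yb, zb) \<le> norm (y, z)")
    case False
    hence "(norm (y, z))\<^sup>2 \<le> (norm (yb, zb))\<^sup>2" by (intro power_mono) auto
    hence "0 \<le> ((norm (yb, zb))\<^sup>2 - (norm (y, z))\<^sup>2) / (2 * \<beta>)" using \<beta> by simp
    hence "\<kappa> * norm (yb, zb) \<le> \<kappa> * \<Theta>" using main by linarith
    hence "norm (yb, zb) \<le> \<Theta>" using \<kappa>(1) by simp
    thus ?thesis unfolding yb_def zb_def by simp
  qed (simp add: yb_def zb_def)
qed

end

section \<open>Multiplier updates\<close>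

definition mult_step :: "(real^'d \<Rightarrow> real^'m) \<Rightarrow> real \<Rightarrow> real^'m \<Rightarrow> real^'d \<Rightarrow> real^'m" where
  "mult_step g \<beta> z x = (\<chi> i. max (- (z $ i) / \<beta>) (g x $ i))"

lemma mult_ineq_eq:
  assumes "0 < \<beta>"
  shows "mult_ineq g \<beta> z x = z + \<beta> *\<^sub>R mult_step g \<beta> z x"
  unfolding mult_ineq_def mult_step_def vec_eq_iff using assms by (auto simp: max_def field_simps)

lemma residual_eq: "residual A b g x = norm (A *v x - b, pos (g x))"
  unfolding residual_def norm_Pair ..

text \<open>The inequality part of the penalty is the minimum of
  \<open>z \<bullet> s + \<beta> / 2 * (norm s)^2\<close> over slacks \<open>s \<ge> g(x)\<close>,
  attained at \<open>mult_step\<close>. The second claim admits any such slack, in particular one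
  that belongs to other multipliers.\<close>

lemma penalty_terms_quadratic:
  assumes \<beta>: "0 < \<beta>"
  shows "penalty_terms A b g \<beta> y z x = y \<bullet> (A *v x - b) + \<beta> / 2 * (norm (A *v x - b))\<^sup>2
      + (z \<bullet> mult_step g \<beta> z x + \<beta> / 2 * (norm (mult_step g \<beta> z x))\<^sup>2)" (is "_ = ?l + ?q (mult_step g \<beta> z x)")
    and "(\<And>i. g x $ i \<le> s $ i) \<Longrightarrow> penalty_terms A b g \<beta> y z x
      \<le> y \<bullet> (A *v x - b) + \<beta> / 2 * (norm (A *v x - b))\<^sup>2 + (z \<bullet> s + \<beta> / 2 * (norm s)\<^sup>2)"
proof -
  have q: "?q s = 1 / (2 * \<beta>) * (\<Sum>i\<in>UNIV. (z $ i + \<beta> * s $ i)\<^sup>2) - (norm z)\<^sup>2 / (2 * \<beta>)" for s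
  proof -
    have "z $ i * s $ i + \<beta> / 2 * (s $ i)\<^sup>2 = 1 / (2 * \<beta>) * (z $ i + \<beta> * s $ i)\<^sup>2 - (z $ i)\<^sup>2 / (2 * \<beta>)" for i
      using \<beta> by (simp add: power2_eq_square field_simps)
    hence "(\<Sum>i\<in>UNIV. z $ i * s $ i + \<beta> / 2 * (s $ i)\<^sup>2)
        = (\<Sum>i\<in>UNIV. 1 / (2 * \<beta>) * (z $ i + \<beta> * s $ i)\<^sup>2 - (z $ i)\<^sup>2 / (2 * \<beta>))" by simp
    thus ?thesis unfolding norm_sq_vec inner_vec_def[of z]
      by (simp add: sum.distrib sum_subtractf sum_distrib_left sum_divide_distrib)
  qed
  have "z $ i + \<beta> * mult_step g \<beta> z x $ i = max 0 (z $ i + \<beta> * g x $ i)" for i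
    unfolding mult_step_def using \<beta> by (auto simp: max_def field_simps)
  thus "penalty_terms A b g \<beta> y z x = ?l + ?q (mult_step g \<beta> z x)"
    unfolding penalty_terms_eq[OF \<beta>] q by simp
  assume s: "\<And>i. g x $ i \<le> s $ i"
  have "(\<Sum>i\<in>UNIV. (max 0 (z $ i + \<beta> * g x $ i))\<^sup>2) \<le> (\<Sum>i\<in>UNIV. (z $ i + \<beta> * s $ i)\<^sup>2)"
  proof (rule sum_mono)
    fix i
    show "(max 0 (z $ i + \<beta> * g x $ i))\<^sup>2 \<le> (z $ i + \<beta> * s $ i)\<^sup>2"
    proof (cases "0 \<le> z $ i + \<beta> * g x $ i")
      case True
      moreover have "\<beta> * g x $ i \<le> \<beta> * s $ i" using s[of i] \<beta> by simp
      ultimately show ?thesis by (auto intro!: power_mono)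
    qed simp
  qed
  hence "1 / (2 * \<beta>) * (\<Sum>i\<in>UNIV. (max 0 (z $ i + \<beta> * g x $ i))\<^sup>2) \<le> 1 / (2 * \<beta>) * (\<Sum>i\<in>UNIV. (z $ i + \<beta> * s $ i)\<^sup>2)"
    using \<beta> by (intro mult_left_mono) auto
  thus "penalty_terms A b g \<beta> y z x \<le> ?l + ?q s" unfolding penalty_terms_eq[OF \<beta>] q by simp
qed

lemma quadratic_lower:
  fixes p r :: "'a::real_inner"
  assumes \<beta>: "0 < \<beta>"
  shows "- ((norm p)\<^sup>2 / (2 * \<beta>)) \<le> p \<bullet> r + \<beta> / 2 * (norm r)\<^sup>2"
proof -
  have "0 \<le> (norm (p + \<beta> *\<^sub>R r))\<^sup>2 / (2 * \<beta>)" using \<beta> by simp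
  also have "\<dots> = (norm p)\<^sup>2 / (2 * \<beta>) + (p \<bullet> r + \<beta> / 2 * (norm r)\<^sup>2)"
    unfolding power2_norm_eq_inner using \<beta>
    by (simp add: inner_add_left inner_add_right inner_commute field_simps)
  finally show ?thesis by simp
qed

lemma penalty_terms_lower:
  assumes \<beta>: "0 < \<beta>" and M: "norm (y, z) \<le> M"
  shows "- (M\<^sup>2 / (2 * \<beta>)) \<le> penalty_terms A b g \<beta> y z x"
proof -
  have "(norm (y, z))\<^sup>2 \<le> M\<^sup>2" using M by (intro power_mono) auto
  hence "(norm y)\<^sup>2 / (2 * \<beta>) + (norm z)\<^sup>2 / (2 * \<beta>) \<le> M\<^sup>2 / (2 * \<beta>)"
    using \<beta> by (simp add: norm_Pair add_divide_distrib[symmetric] divide_right_mono)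
  thus ?thesis unfolding penalty_terms_quadratic(1)[OF \<beta>]
    using quadratic_lower[OF \<beta>, of y "A *v x - b"] quadratic_lower[OF \<beta>, of z "mult_step g \<beta> z x"] by linarith
qed

lemma penalty_terms_upper:
  assumes \<beta>: "0 < \<beta>" and M: "norm (y, z) \<le> M"
  shows "penalty_terms A b g \<beta> y z x \<le> M * residual A b g x + \<beta> / 2 * (residual A b g x)\<^sup>2"
proof -
  let ?r = "A *v x - b" and ?p = "pos (g x)"
  have "penalty_terms A b g \<beta> y z x \<le> y \<bullet> ?r + \<beta> / 2 * (norm ?r)\<^sup>2 + (z \<bullet> ?p + \<beta> / 2 * (norm ?p)\<^sup>2)"
    by (rule penalty_terms_quadratic(2)[OF \<beta>]) (simp add: pos_def)
  also have "\<dots> = (y, z) \<bullet> (?r, ?p) + \<beta> / 2 * (residual A b g x)\<^sup>2"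
    unfolding residual_eq by (simp add: norm_Pair distrib_left)
  also have "(y, z) \<bullet> (?r, ?p) \<le> norm (y, z) * residual A b g x"
    unfolding residual_eq by (rule norm_cauchy_schwarz)
  also have "\<dots> \<le> M * residual A b g x" using M unfolding residual_eq by (intro mult_right_mono) auto
  finally show ?thesis by simp
qed

text \<open>One damped update on its own. The two bounds by \<open>M\<close>, on the current and on
  the undamped multipliers, are all it takes from the subproblem.\<close>

locale multiplier_update =
  fixes A :: "real^'d^'n" and b :: "real^'n" and g :: "real^'d \<Rightarrow> real^'m"
    and \<beta> v M :: real and y y' :: "real^'n" and z z' :: "real^'m" and x :: "real^'d"
  assumes \<beta>_pos: "0 < \<beta>" and v_pos: "0 < v" and z_nonneg: "0 \<le> z"
    and y'_def: "y' = y + damped_step A b g \<beta> v x *\<^sub>R (A *v x - b)"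
    and z'_def: "z' = z + damped_step A b g \<beta> v x *\<^sub>R mult_step g \<beta> z x"
    and bound: "norm (y, z) \<le> M" and bound_bar: "norm (mult_eq A b \<beta> y x, mult_ineq g \<beta> z x) \<le> M"
begin

abbreviation "yb \<equiv> mult_eq A b \<beta> y x"
abbreviation "zb \<equiv> mult_ineq g \<beta> z x"
abbreviation "pen \<equiv> penalty_terms A b g"
definition "\<alpha> = damped_step A b g \<beta> v x"
definition "m = mult_step g \<beta> z x"
definition "r = A *v x - b"
definition "res = residual A b g x"

lemma res_nonneg: "0 \<le> res" unfolding res_def residual_eq by simp

lemma \<alpha>: "0 < \<alpha>" "\<alpha> \<le> \<beta>" "\<alpha> * res \<le> v"
proof -
  have "0 < \<alpha> \<and> \<alpha> \<le> \<beta> \<and> \<alpha> * res \<le> v"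
  proof (cases "res = 0")
    case True
    thus ?thesis unfolding \<alpha>_def damped_step_def res_def using \<beta>_pos v_pos by simp
  next
    case False
    hence p: "0 < res" using res_nonneg by simp
    have e: "\<alpha> = min \<beta> (v / res)" unfolding \<alpha>_def damped_step_def using False by (simp add: res_def)
    hence "\<alpha> * res \<le> (v / res) * res" using p by (intro mult_right_mono) auto
    thus ?thesis unfolding e using p \<beta>_pos v_pos by simp
  qed
  thus "0 < \<alpha>" "\<alpha> \<le> \<beta>" "\<alpha> * res \<le> v" by auto
qed

lemma M_nonneg: "0 \<le> M" using bound norm_ge_zero order_trans by blast

lemma y'_eq: "y' = y + \<alpha> *\<^sub>R r" unfolding y'_def \<alpha>_def r_def ..
lemma z'_eq: "z' = z + \<alpha> *\<^sub>R m" unfolding z'_def \<alpha>_def m_def ..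
lemma mult_eq_r: "yb = y + \<beta> *\<^sub>R r" unfolding mult_eq_def r_def ..
lemma mult_ineq_m: "zb = z + \<beta> *\<^sub>R m" unfolding m_def by (rule mult_ineq_eq[OF \<beta>_pos])

lemma convex_comb:
  "(y', z') = (1 - \<alpha> / \<beta>) *\<^sub>R (y, z) + (\<alpha> / \<beta>) *\<^sub>R (yb, zb)"
  unfolding y'_eq z'_eq mult_eq_r mult_ineq_m using \<beta>_pos by (simp add: algebra_simps)

lemma ratio: "0 \<le> \<alpha> / \<beta>" "\<alpha> / \<beta> \<le> 1" using \<alpha> \<beta>_pos by auto

lemma bound': "norm (y', z') \<le> M"
proof -
  have "(1 - \<alpha> / \<beta>) *\<^sub>R (y, z) + (\<alpha> / \<beta>) *\<^sub>R (yb, zb) \<in> cball 0 M"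
    using ratio bound bound_bar by (intro convexD[OF convex_cball]) auto
  thus ?thesis unfolding convex_comb by simp
qed

lemma z_comp: "0 \<le> z $ i" using z_nonneg by (simp add: less_eq_vec_def)

lemma z'_nonneg: "0 \<le> z'"
proof -
  have "z' $ i = (1 - \<alpha> / \<beta>) * z $ i + (\<alpha> / \<beta>) * zb $ i" for i
    unfolding z'_eq mult_ineq_m using \<beta>_pos by (simp add: algebra_simps)
  moreover have "0 \<le> zb $ i" for i unfolding mult_ineq_def by simp
  ultimately have "0 \<le> z' $ i" for i
    using ratio z_comp by (metis add_nonneg_nonneg diff_ge_0_iff_ge mult_nonneg_nonneg)
  thus ?thesis by (simp add: less_eq_vec_def)
qed

text \<open>The step \<open>(r, m)\<close> scaled by \<beta> is the difference of two points of the
  ball of radius \<open>M\<close>.\<close>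

lemma rm_bound: "\<beta> * norm (r, m) \<le> 2 * M"
proof -
  have "\<beta> * norm (r, m) = norm (\<beta> *\<^sub>R (r, m))" using \<beta>_pos by (simp only: norm_scaleR abs_of_pos)
  also have "\<beta> *\<^sub>R (r, m) = (yb, zb) - (y, z)"
    unfolding mult_eq_r mult_ineq_m by simp
  also have "norm \<dots> \<le> M + M" using norm_triangle_ineq4 bound bound_bar by (smt (verit))
  finally show ?thesis by simp
qed

lemma m_comp: "m $ i = max (- (z $ i) / \<beta>) (g x $ i)" unfolding m_def mult_step_def by simp

text \<open>Where a constraint is violated, \<open>m\<close> equals its value, since the other entry
  of the maximum is nonpositive.\<close>

lemma res_le: "res \<le> norm (r, m)"
proof -
  have "(norm (pos (g x)))\<^sup>2 \<le> (norm m)\<^sup>2"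
    unfolding norm_sq_vec
  proof (rule sum_mono)
    fix i
    have "- (z $ i) / \<beta> \<le> 0" using z_comp[of i] \<beta>_pos by simp
    thus "(pos (g x) $ i)\<^sup>2 \<le> (m $ i)\<^sup>2"
      unfolding pos_def m_comp by (cases "0 \<le> g x $ i") (simp_all add: max_def)
  qed
  thus ?thesis unfolding res_def residual_eq r_def norm_Pair by simp
qed

lemma res_bound: "\<beta> * res \<le> 2 * M"
  using mult_left_mono[OF res_le, of \<beta>] rm_bound \<beta>_pos by linarith

text \<open>A nonzero entry of \<open>zb\<close> means that the maximum in \<open>m\<close> is
  attained by \<open>g\<close>, so \<open>g\<close> may be replaced by \<open>m\<close>, which has
  norm at most \<open>2 * M / \<beta>\<close>.\<close>

lemma complementarity: "(\<Sum>i\<in>UNIV. \<bar>zb $ i * g x $ i\<bar>) \<le> 2 * M\<^sup>2 / \<beta>"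
proof -
  have "\<bar>zb $ i * g x $ i\<bar> \<le> \<bar>zb $ i\<bar> * \<bar>m $ i\<bar>" for i
  proof (cases "zb $ i = 0")
    case False
    hence "g x $ i = m $ i" unfolding mult_ineq_def m_comp using \<beta>_pos
      by (auto simp: max_def field_simps split: if_splits)
    thus ?thesis by (simp add: abs_mult)
  qed simp
  hence "(\<Sum>i\<in>UNIV. \<bar>zb $ i * g x $ i\<bar>) \<le> (\<Sum>i\<in>UNIV. \<bar>zb $ i\<bar> * \<bar>m $ i\<bar>)" by (rule sum_mono)
  also have "\<dots> = (\<chi> i. \<bar>zb $ i\<bar>) \<bullet> (\<chi> i. \<bar>m $ i\<bar>)" by (simp add: inner_vec_def)
  also have "\<dots> \<le> norm (\<chi> i. \<bar>zb $ i\<bar>) * norm (\<chi> i. \<bar>m $ i\<bar>)" by (rule norm_cauchy_schwarz)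
  also have "\<dots> = norm zb * norm m" by (simp add: norm_vec_def)
  also have "\<dots> \<le> M * (2 * M / \<beta>)"
  proof (intro mult_mono)
    show "norm zb \<le> M" using norm_snd_le[of zb "yb"] bound_bar by linarith
    have "norm m \<le> norm (r, m)" by (rule norm_snd_le)
    also have "\<dots> \<le> 2 * M / \<beta>" using rm_bound \<beta>_pos by (simp add: field_simps)
    finally show "norm m \<le> 2 * M / \<beta>" .
  qed (use M_nonneg in auto)
  finally show ?thesis by (simp add: power2_eq_square mult.left_commute)
qed

text \<open>The negative part of the step is not controlled by the residual, hence not by \<open>v\<close>; but
  such steps shrink \<open>z\<close>, so their contribution telescopes.\<close>

lemma step_sq_le: "\<alpha> * (norm m)\<^sup>2 \<le> \<alpha> * (norm (pos (g x)))\<^sup>2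
    + ((norm z)\<^sup>2 - (norm z')\<^sup>2) / \<beta> + (\<alpha> / \<beta>) * (pos (g x) \<bullet> (z + z'))"
proof -
  have i: "\<alpha> * (m $ i)\<^sup>2 \<le> \<alpha> * (pos (g x) $ i)\<^sup>2 + ((z $ i)\<^sup>2 - (z' $ i)\<^sup>2) / \<beta>
      + (\<alpha> / \<beta>) * (pos (g x) $ i * (z $ i + z' $ i))" for i
  proof -
    have z': "z' $ i = z $ i + \<alpha> * m $ i" unfolding z'_eq by simp
    have nn: "0 \<le> z $ i" "0 \<le> z' $ i" "- (z $ i) / \<beta> \<le> 0"
      using z_comp[of i] z'_nonneg \<beta>_pos by (auto simp: less_eq_vec_def)
    have sq: "((z $ i)\<^sup>2 - (z' $ i)\<^sup>2) / \<beta> = - (\<alpha> / \<beta>) * (m $ i * (z $ i + z' $ i))"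
      unfolding z' using \<beta>_pos by (simp add: power2_eq_square field_simps)
    show ?thesis
    proof (cases "0 \<le> g x $ i")
      case True
      hence "m $ i = pos (g x) $ i" unfolding m_comp pos_def using nn by (simp add: max_def)
      thus ?thesis unfolding sq by simp
    next
      case False
      hence p: "pos (g x) $ i = 0" and m: "m $ i \<le> 0" "- (z $ i) / \<beta> \<le> m $ i"
        unfolding m_comp pos_def using nn by (auto simp: max_def)
      \<comment> \<open>By the other entry of the maximum, \<open>- m_i\<close> is at most
        \<open>z_i / \<beta>\<close>; adding \<open>z'_i \<ge> 0\<close> creates the factor of the
        telescoping difference.\<close>
      have "- m $ i \<le> (z $ i + z' $ i) / \<beta>"
        using m(2) nn \<beta>_pos divide_right_mono[of "z $ i" "z $ i + z' $ i" \<beta>] by simp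
      hence "\<alpha> * (- m $ i) * (- m $ i) \<le> \<alpha> * (- m $ i) * ((z $ i + z' $ i) / \<beta>)"
        using m \<alpha> by (intro mult_left_mono mult_nonneg_nonneg) auto
      thus ?thesis unfolding sq p by (simp add: power2_eq_square)
    qed
  qed
  have "\<alpha> * (norm m)\<^sup>2 = (\<Sum>i\<in>UNIV. \<alpha> * (m $ i)\<^sup>2)" by (simp add: norm_sq_vec sum_distrib_left)
  also have "\<dots> \<le> (\<Sum>i\<in>UNIV. \<alpha> * (pos (g x) $ i)\<^sup>2 + ((z $ i)\<^sup>2 - (z' $ i)\<^sup>2) / \<beta>
      + (\<alpha> / \<beta>) * (pos (g x) $ i * (z $ i + z' $ i)))" by (rule sum_mono) (rule i)
  also have "\<dots> = \<alpha> * (norm (pos (g x)))\<^sup>2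
    + ((norm z)\<^sup>2 - (norm z')\<^sup>2) / \<beta> + (\<alpha> / \<beta>) * (pos (g x) \<bullet> (z + z'))"
    unfolding norm_sq_vec inner_vec_def
    by (simp add: sum.distrib sum_subtractf sum_divide_distrib[symmetric] sum_distrib_left)
  finally show ?thesis .
qed

text \<open>The new penalty is estimated with the old slack \<open>m\<close>, so only the
  coefficients of one quadratic change. Of the three errors, the first and the last telescope along
  nondecreasing \<beta>, and the middle one is summable for the chosen damping.\<close>

lemma penalty_increase:
  assumes \<beta>': "\<beta> \<le> \<beta>'" "\<beta>' \<le> 2 * \<beta>"
  shows "pen \<beta>' y' z' x \<le> pen \<beta> y z x
    + 4 * M\<^sup>2 * (1 / \<beta> - 1 / \<beta>') + 4 * M * (v / \<beta>) + ((norm z)\<^sup>2 - (norm z')\<^sup>2) / \<beta>"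
proof -
  have \<beta>'_pos: "0 < \<beta>'" using \<beta>' \<beta>_pos by simp
  have "pen \<beta>' y' z' x \<le> y' \<bullet> r + \<beta>' / 2 * (norm r)\<^sup>2 + (z' \<bullet> m + \<beta>' / 2 * (norm m)\<^sup>2)"
    unfolding r_def by (rule penalty_terms_quadratic(2)[OF \<beta>'_pos]) (simp add: m_comp)
  also have "\<dots> = (y \<bullet> r + \<beta> / 2 * (norm r)\<^sup>2 + (z \<bullet> m + \<beta> / 2 * (norm m)\<^sup>2))
      + (\<alpha> * (norm r)\<^sup>2 + \<alpha> * (norm m)\<^sup>2) + (\<beta>' - \<beta>) / 2 * ((norm r)\<^sup>2 + (norm m)\<^sup>2)"
    unfolding y'_eq z'_eq inner_add_left inner_scaleR_left power2_norm_eq_inner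
    by (simp add: algebra_simps diff_divide_distrib add_divide_distrib)
  also have "y \<bullet> r + \<beta> / 2 * (norm r)\<^sup>2 + (z \<bullet> m + \<beta> / 2 * (norm m)\<^sup>2) = pen \<beta> y z x"
    unfolding penalty_terms_quadratic(1)[OF \<beta>_pos] r_def m_def ..
  finally have 1: "pen \<beta>' y' z' x \<le> pen \<beta> y z x
      + (\<alpha> * (norm r)\<^sup>2 + \<alpha> * (norm m)\<^sup>2) + (\<beta>' - \<beta>) / 2 * ((norm r)\<^sup>2 + (norm m)\<^sup>2)" .
  have 2: "(\<beta>' - \<beta>) / 2 * ((norm r)\<^sup>2 + (norm m)\<^sup>2) \<le> 4 * M\<^sup>2 * (1 / \<beta> - 1 / \<beta>')"
  proof -
    have "(\<beta> * norm (r, m))\<^sup>2 \<le> (2 * M)\<^sup>2" using rm_bound \<beta>_pos by (intro power_mono) auto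
    hence "(norm r)\<^sup>2 + (norm m)\<^sup>2 \<le> 4 * M\<^sup>2 / \<beta>\<^sup>2"
      using \<beta>_pos by (simp add: norm_Pair power_mult_distrib field_simps)
    hence "(\<beta>' - \<beta>) / 2 * ((norm r)\<^sup>2 + (norm m)\<^sup>2) \<le> (\<beta>' - \<beta>) / 2 * (4 * M\<^sup>2 / \<beta>\<^sup>2)"
      using \<beta>' by (intro mult_left_mono) auto
    also have "\<dots> = 4 * M\<^sup>2 * ((\<beta>' - \<beta>) / (\<beta> * (2 * \<beta>)))" by (simp add: power2_eq_square)
    \<comment> \<open>\<open>\<beta>' \<le> 2 * \<beta>\<close> turns \<open>1 / \<beta>^2\<close>
      into a telescoping difference.\<close>
    also have "\<dots> \<le> 4 * M\<^sup>2 * ((\<beta>' - \<beta>) / (\<beta> * \<beta>'))"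
      using \<beta>' \<beta>_pos \<beta>'_pos by (intro mult_left_mono divide_left_mono) auto
    also have "(\<beta>' - \<beta>) / (\<beta> * \<beta>') = 1 / \<beta> - 1 / \<beta>'" using \<beta>_pos \<beta>'_pos by (simp add: field_simps)
    finally show ?thesis .
  qed
  have vb: "v * res \<le> 2 * M * (v / \<beta>)"
  proof -
    have "v * (\<beta> * res) \<le> v * (2 * M)" using res_bound v_pos by (intro mult_left_mono) auto
    thus ?thesis using \<beta>_pos by (simp add: field_simps)
  qed
  have "\<alpha> * (norm r)\<^sup>2 + \<alpha> * (norm (pos (g x)))\<^sup>2 = (\<alpha> * res) * res"
    unfolding res_def residual_eq r_def by (simp add: norm_Pair power2_eq_square[symmetric] algebra_simps)
  also have "\<dots> \<le> v * res" using \<alpha> res_nonneg by (intro mult_right_mono)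
  finally have 3: "\<alpha> * (norm r)\<^sup>2 + \<alpha> * (norm (pos (g x)))\<^sup>2 \<le> 2 * M * (v / \<beta>)" using vb by linarith
  have "pos (g x) \<bullet> (z + z') \<le> norm (pos (g x)) * norm (z + z')" by (rule norm_cauchy_schwarz)
  also have "\<dots> \<le> res * (2 * M)"
  proof (intro mult_mono)
    show "norm (pos (g x)) \<le> res" unfolding res_def residual_eq by (rule norm_snd_le)
    have "norm z \<le> M" "norm z' \<le> M" using norm_snd_le[of z y] norm_snd_le[of z' y'] bound bound' by linarith+
    thus "norm (z + z') \<le> 2 * M" using norm_triangle_ineq[of z z'] by linarith
  qed (use res_nonneg in auto)
  finally have "(\<alpha> / \<beta>) * (pos (g x) \<bullet> (z + z')) \<le> (\<alpha> / \<beta>) * (res * (2 * M))"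
    using ratio by (intro mult_left_mono) auto
  also have "\<dots> = (\<alpha> * res) * (2 * M / \<beta>)" by simp
  also have "\<dots> \<le> v * (2 * M / \<beta>)" using \<alpha> M_nonneg \<beta>_pos by (intro mult_right_mono) auto
  finally have 4: "(\<alpha> / \<beta>) * (pos (g x) \<bullet> (z + z')) \<le> 2 * M * (v / \<beta>)" by (simp add: mult.commute)
  \<comment> \<open>The coefficient \<open>4 * M\<close> adds up from 3, the violated constraints,
    and 4, the cross term of \<open>step_sq_le\<close>.\<close>
  show ?thesis using 1 2 3 4 step_sq_le by linarith
qed

text \<open>Starting value for the telescoping sum: the residual is at most
  \<open>2 * M / \<beta>\<close>, so the penalty is small even with the next parameters. The 6 is
  \<open>2 + 4\<close>, from the linear and the quadratic part.\<close>

lemma penalty_next_upper: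
  assumes \<beta>': "0 < \<beta>'" "\<beta>' \<le> 2 * \<beta>"
  shows "pen \<beta>' y' z' x \<le> 6 * M\<^sup>2 / \<beta>"
proof -
  have res: "res \<le> 2 * M / \<beta>" using res_bound \<beta>_pos by (simp add: field_simps)
  have "pen \<beta>' y' z' x \<le> M * res + \<beta>' / 2 * res\<^sup>2"
    unfolding res_def by (rule penalty_terms_upper[OF \<beta>'(1) bound'])
  also have "\<dots> \<le> M * (2 * M / \<beta>) + (2 * \<beta>) / 2 * (2 * M / \<beta>)\<^sup>2"
    using res res_nonneg M_nonneg \<beta>' \<beta>_pos by (intro add_mono mult_mono power_mono) auto
  also have "\<dots> = 6 * M\<^sup>2 / \<beta>" using \<beta>_pos by (simp add: power2_eq_square field_simps)
  finally show ?thesis .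
qed

end

section \<open>Smallest positive eigenvalue and damping\<close>

text \<open>A majorant of the tails of the series of \<open>1 / ((k + 1) (ln (k + 1))\<^sup>2)\<close>. At \<open>k = 1\<close>, where
  \<open>1 / ln k\<close> is the junk value \<open>0\<close>, it is any sufficiently large number.\<close>

definition damp_tail :: "nat \<Rightarrow> real" where
  "damp_tail k = (if k = 1 then 4 else 1 / ln (real k))"

lemma damp_tail:
  fixes k :: nat
  assumes "1 \<le> k"
  shows "1 / (real (k + 1) * (ln (real (k + 1)))\<^sup>2) \<le> damp_tail k - damp_tail (k + 1)" and "0 \<le> damp_tail k" "damp_tail k \<le> 4"
proof -
  have ln2: "2 / 3 \<le> ln (2::real)" using ln_one_plus_ge[of 1] by simp
  have lnk: "2 / 3 \<le> ln (real k)" if "k \<noteq> 1"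
  proof -
    have "ln 2 \<le> ln (real k)" using that assms(1) by (intro ln_mono) auto
    thus ?thesis using ln2 by simp
  qed
  show "0 \<le> damp_tail k" "damp_tail k \<le> 4" unfolding damp_tail_def using lnk by (auto simp: field_simps)
  show "1 / (real (k + 1) * (ln (real (k + 1)))\<^sup>2) \<le> damp_tail k - damp_tail (k + 1)"
  proof (cases "k = 1")
    case True
    \<comment> \<open>At \<open>k = 1\<close> the left side is at most \<open>9 / 8\<close> and
      \<open>1 / ln 2\<close> at most \<open>3 / 2\<close>, which the value 4 covers.\<close>
    have "(2 / 3)\<^sup>2 \<le> (ln (2::real))\<^sup>2" using ln2 by (intro power_mono) auto
    hence "1 / (2 * (ln (2::real))\<^sup>2) \<le> 1 / (2 * (2 / 3)\<^sup>2)" by (intro divide_left_mono) auto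
    moreover have "1 / ln (2::real) \<le> 3 / 2" using ln2 by (simp add: field_simps)
    ultimately show ?thesis using True unfolding damp_tail_def by (simp add: power2_eq_square)
  next
    case False
    define p where "p = ln (real k)"
    define q where "q = ln (real (k + 1))"
    have p: "0 < p" using lnk[OF False] unfolding p_def by linarith
    have pq: "p \<le> q" unfolding p_def q_def using assms(1) by (intro ln_mono) auto
    \<comment> \<open>For \<open>k \<ge> 2\<close>, \<open>1 / (k + 1)\<close> is at most the
      increment of the logarithm, and \<open>(q - p) / (p q)\<close> is a difference of
      reciprocals.\<close>
    have "p - q = ln (real k / real (k + 1))" unfolding p_def q_def using assms(1) by (simp add: ln_div)
    also have "\<dots> \<le> real k / real (k + 1) - 1" using assms(1) by (intro ln_le_minus_one) auto
    also have "\<dots> = - (1 / real (k + 1))" by (simp add: field_simps)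
    finally have d: "1 / real (k + 1) \<le> q - p" by linarith
    have "1 / (real (k + 1) * q\<^sup>2) = (1 / real (k + 1)) / (q * q)" by (simp add: power2_eq_square)
    also have "\<dots> \<le> (q - p) / (q * q)" using d by (intro divide_right_mono) auto
    also have "\<dots> \<le> (q - p) / (p * q)" using p pq by (intro divide_left_mono mult_right_mono) auto
    also have "\<dots> = 1 / p - 1 / q" using p pq by (simp add: field_simps)
    finally show ?thesis using False assms(1) unfolding damp_tail_def p_def q_def by simp
  qed
qed

text \<open>The smallest value of \<open>\<parallel>A\<^sup>T y\<parallel>\<^sup>2\<close> on the unit sphere of the range of \<open>A\<close> is attained
  at an eigenvector of \<open>A A\<^sup>T\<close>, and every positive eigenvalue has its eigenvectors in the range.\<close>

lemma lambda_min_pos_bound: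
  fixes A :: "real^'d^'n"
  assumes "A \<noteq> 0"
  shows "0 < lambda_min_pos (A ** transpose A)"
    and "y \<in> range (\<lambda>x. A *v x) \<Longrightarrow>
      sqrt (lambda_min_pos (A ** transpose A)) * norm y \<le> norm (transpose A *v y)"
proof -
  let ?R = "range (\<lambda>x. A *v x)"
  let ?M = "A ** transpose A"
  have sub: "subspace ?R" by (rule linear_subspace_image[OF matrix_vector_mul_linear subspace_UNIV])
  have MR: "?M *v y \<in> ?R" for y by (simp add: matrix_vector_mul_assoc[symmetric])
  have Minner: "(?M *v y) \<bullet> w = (transpose A *v y) \<bullet> (transpose A *v w)" for y w
  proof -
    have "(transpose A *v y) \<bullet> (transpose A *v w) = (transpose A *v w) \<bullet> (transpose A *v y)"
      by (rule inner_commute)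
    also have "\<dots> = w \<bullet> (A *v (transpose A *v y))" by (rule inner_transpose)
    finally show ?thesis by (simp only: matrix_vector_mul_assoc inner_commute)
  qed
  obtain a where a: "A *v a \<noteq> 0" using assms by (metis matrix_eq matrix_vector_mult_0)
  define S where "S = ?R \<inter> sphere 0 1"
  have "compact S" unfolding S_def by (intro closed_Int_compact closed_subspace sub compact_sphere)
  moreover have "sgn (A *v a) \<in> S"
    unfolding S_def using a subspace_scale[OF sub, of "A *v a"] by (simp add: sgn_div_norm norm_sgn)
  hence "S \<noteq> {}" by blast
  moreover have "continuous_on S (\<lambda>y. (norm (transpose A *v y))\<^sup>2)"
    by (intro continuous_intros linear_continuous_on matrix_vector_mul_bounded_linear)
  ultimately obtain ys where ys: "ys \<in> S" "\<And>y. y \<in> S \<Longrightarrow> (norm (transpose A *v ys))\<^sup>2 \<le> (norm (transpose A *v y))\<^sup>2"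
    using continuous_attains_inf by metis
  define l where "l = (norm (transpose A *v ys))\<^sup>2"
  have ysR: "ys \<in> ?R" "norm ys = 1" using ys(1) unfolding S_def by auto
  have ray: "l * (norm y)\<^sup>2 \<le> (norm (transpose A *v y))\<^sup>2" if "y \<in> ?R" for y
  proof (cases "y = 0")
    case False
    define s where "s = (1 / norm y) *\<^sub>R y"
    have "s \<in> S" unfolding S_def s_def using subspace_scale[OF sub that] False by simp
    from ys(2)[OF this] have "l \<le> (norm (transpose A *v s))\<^sup>2" unfolding l_def .
    also have "\<dots> = (norm (transpose A *v y))\<^sup>2 / (norm y)\<^sup>2"
      unfolding s_def matrix_vector_mult_scaleR by (simp add: power_divide)
    finally show ?thesis using False by (simp add: field_simps)
  qed simp
  define w where "w = ?M *v ys - l *\<^sub>R ys"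
  have wR: "w \<in> ?R" unfolding w_def by (intro subspace_diff subspace_scale sub MR ysR)
  \<comment> \<open>First-order optimality: moving \<open>ys\<close> along \<open>w\<close> inside
    the range gives \<open>0 \<le> 2 t (w \<bullet> w) + t^2 c\<close> for every \<open>t\<close>,
    which fails for small negative \<open>t\<close> unless \<open>w\<close> vanishes.\<close>
  have "w = 0"
  proof -
    define c where "c = (norm (transpose A *v w))\<^sup>2 - l * (norm w)\<^sup>2"
    have key: "0 \<le> 2 * t * (w \<bullet> w) + t\<^sup>2 * c" for t
    proof -
      have "ys + t *\<^sub>R w \<in> ?R" by (intro subspace_add subspace_scale sub ysR wR)
      from ray[OF this]
      have "0 \<le> (norm (transpose A *v ys + t *\<^sub>R (transpose A *v w)))\<^sup>2 - l * (norm (ys + t *\<^sub>R w))\<^sup>2"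
        by (simp only: matrix_vector_right_distrib matrix_vector_mult_scaleR diff_ge_0_iff_ge)
      also have "\<dots> = (l - l * (norm ys)\<^sup>2) + 2 * t * ((transpose A *v ys) \<bullet> (transpose A *v w) - l * (ys \<bullet> w)) + t\<^sup>2 * c"
        unfolding c_def l_def power2_norm_eq_inner
        by (simp add: inner_add_left inner_add_right inner_commute power2_eq_square algebra_simps)
      also have "(transpose A *v ys) \<bullet> (transpose A *v w) - l * (ys \<bullet> w) = w \<bullet> w"
        unfolding Minner[symmetric] by (simp add: w_def inner_diff_left inner_diff_right inner_commute right_diff_distrib)
      finally show ?thesis using ysR by simp
    qed
    have "w \<bullet> w \<le> 0"
    proof (rule ccontr)
      assume "\<not> ?thesis"
      hence p: "0 < w \<bullet> w" by linarith
      define t where "t = - (w \<bullet> w) / (1 + \<bar>c\<bar>)"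
      have t: "t < 0" unfolding t_def using p by (simp add: field_simps)
      have "0 \<le> t * (2 * (w \<bullet> w) + t * c)" using key[of t] by (simp add: power2_eq_square algebra_simps)
      hence "2 * (w \<bullet> w) + t * c \<le> 0" using t by (simp add: zero_le_mult_iff)
      moreover have "- (w \<bullet> w) \<le> t * c"
      proof -
        have "(w \<bullet> w) * c \<le> (w \<bullet> w) * (1 + \<bar>c\<bar>)" using p by (intro mult_left_mono) auto
        thus ?thesis unfolding t_def by (simp add: field_simps)
      qed
      ultimately show False using p by linarith
    qed
    thus ?thesis by (metis antisym inner_eq_zero_iff inner_ge_zero)
  qed
  hence eig: "?M *v ys = l *\<^sub>R ys" unfolding w_def by simp
  have ys0: "ys \<noteq> 0" using ysR by auto
  have lpos: "0 < l"
  proof -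
    \<comment> \<open>The kernel of the transpose is orthogonal to the range of \<open>A\<close>,
      which contains \<open>ys\<close>.\<close>
    have "transpose A *v ys \<noteq> 0"
    proof
      assume z: "transpose A *v ys = 0"
      obtain x where x: "ys = A *v x" using ysR by blast
      have "ys \<bullet> ys = (transpose A *v ys) \<bullet> x" by (subst (2) x) (simp only: inner_transpose)
      thus False using z ys0 by simp
    qed
    thus ?thesis unfolding l_def by simp
  qed
  have "lambda_min_pos ?M = l"
    unfolding lambda_min_pos_def
  proof (rule Least_equality)
    show "0 < l \<and> (\<exists>v. v \<noteq> 0 \<and> ?M *v v = l *\<^sub>R v)" using lpos eig ys0 by blast
    fix l' assume "0 < l' \<and> (\<exists>v. v \<noteq> 0 \<and> ?M *v v = l' *\<^sub>R v)"
    then obtain v where l': "0 < l'" and v: "v \<noteq> 0" "?M *v v = l' *\<^sub>R v" by blast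
    have "v = (1 / l') *\<^sub>R (?M *v v)" using v l' by simp
    hence vR: "v \<in> ?R" using subspace_scale[OF sub MR] by metis
    have "(norm (transpose A *v v))\<^sup>2 = l' * (norm v)\<^sup>2"
      unfolding power2_norm_eq_inner Minner[symmetric] v(2) by simp
    with ray[OF vR] show "l \<le> l'" using v(1) by simp
  qed
  thus "0 < lambda_min_pos ?M" using lpos by simp
  assume y: "y \<in> ?R"
  have "(sqrt l * norm y)\<^sup>2 \<le> (norm (transpose A *v y))\<^sup>2"
    using ray[OF y] lpos by (simp add: power_mult_distrib)
  hence "sqrt l * norm y \<le> norm (transpose A *v y)" by (rule power2_le_imp_le) simp
  thus "sqrt (lambda_min_pos ?M) * norm y \<le> norm (transpose A *v y)" unfolding \<open>lambda_min_pos ?M = l\<close> .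
qed

section \<open>The subproblems and the KKT conditions\<close>

context constrained_problem
begin

lemma prox_aug_lagrangian_eq:
  "prox_aug_lagrangian f (extend_inf X hr) A b g \<rho> \<beta> y z xk = extend_inf X (subobj \<beta> y z xk)"
  unfolding prox_aug_lagrangian_def aug_lagrangian_def objective_def subobj_def extend_inf_def
  by (auto simp: fun_eq_iff)

lemma composite_part_eq:
  "composite_part (extend_inf X hr) \<rho> xk = extend_inf X (\<lambda>x. hr x + \<rho> / 2 * (norm (x - xk))\<^sup>2)"
  unfolding composite_part_def extend_inf_def by (auto simp: fun_eq_iff)

text \<open>The undamped multipliers fit: with them the gradient of the penalty is the multiplier
  part of the KKT sum, and stationarity of the subproblem leaves
  \<open>v - (2 * \<rho>) *\<^sub>R (x - xk)\<close>.\<close>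

lemma eps_KKTI:
  fixes x xk :: "real^'d"
  assumes \<beta>: "0 < \<beta>" and x: "x \<in> X"
    and stat: "\<And>u. u \<in> X \<Longrightarrow> subobj \<beta> y z xk x + v \<bullet> (u - x) \<le> subobj \<beta> y z xk u"
    and v: "norm v + 2 * \<rho> * norm (x - xk) \<le> \<epsilon>"
    and feas: "residual A b g x \<le> \<epsilon>"
    and compl: "(\<Sum>i\<in>UNIV. \<bar>mult_ineq g \<beta> z x $ i * g x $ i\<bar>) \<le> \<epsilon>"
  shows "eps_KKT \<rho> (objective f (extend_inf X hr)) A b g \<epsilon> x"
proof -
  let ?F = "objective f (extend_inf X hr)"
  let ?y = "mult_eq A b \<beta> y x" and ?z = "mult_ineq g \<beta> z x"
  let ?pg = "pgrad \<beta> y z x"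
  have F: "(\<lambda>u. ?F u + ereal (\<rho> / 2 * (norm u)\<^sup>2)) = extend_inf X (\<lambda>u. f u + hr u + \<rho> / 2 * (norm u)\<^sup>2)"
    unfolding objective_def extend_inf_def by (auto simp: fun_eq_iff)
  have "x \<in> edom ?F" using x unfolding edom_def objective_def extend_inf_def by simp
  moreover have "0 \<le> ?z" unfolding mult_ineq_def by (simp add: less_eq_vec_def)
  moreover have "dist0 ((\<lambda>v. v + transpose (jacobian g (at x)) *v ?z + transpose A *v ?y) ` weak_subdiff \<rho> ?F x) \<le> ereal \<epsilon>"
  proof (rule dist0_leI)
    define s where "s = v - (?pg + (2 * \<rho>) *\<^sub>R (x - xk) - \<rho> *\<^sub>R x)"
    have "s \<in> subdiff (\<lambda>u. ?F u + ereal (\<rho> / 2 * (norm u)\<^sup>2)) x"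
      unfolding F subdiff_extend_inf_iff s_def using subobj_subgradient_F[OF \<beta> x _ stat] x by blast
    hence "s - \<rho> *\<^sub>R x \<in> weak_subdiff \<rho> ?F x" unfolding weak_subdiff_def by blast
    moreover have J: "transpose (jacobian g (at x)) *v ?z = (\<Sum>i\<in>UNIV. ?z $ i *\<^sub>R cgrad g i x)"
      unfolding transpose_mult_rows jacobian_rows[OF g_diff[OF x]] ..
    have "v - (2 * \<rho>) *\<^sub>R (x - xk) = (s - \<rho> *\<^sub>R x) + transpose (jacobian g (at x)) *v ?z + transpose A *v ?y"
      unfolding J s_def penalty_grad_def by (simp add: algebra_simps)
    ultimately show "v - (2 * \<rho>) *\<^sub>R (x - xk) \<in> (\<lambda>v. v + transpose (jacobian g (at x)) *v ?z + transpose A *v ?y) ` weak_subdiff \<rho> ?F x"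
      by blast
    show "norm (v - (2 * \<rho>) *\<^sub>R (x - xk)) \<le> \<epsilon>"
      using norm_triangle_ineq4[of v "(2 * \<rho>) *\<^sub>R (x - xk)"] v \<rho>_pos by simp
  qed
  ultimately show ?thesis unfolding eps_KKT_def using feas compl
    by (intro conjI exI[of _ ?y] exI[of _ ?z]) auto
qed

section \<open>Convexity and smoothness of the subproblem; approximate KKT points of the outer
  method\<close>

lemma smooth_part_has_derivative:
  fixes x :: "real^'d"
  assumes \<beta>: "0 < \<beta>" and x: "x \<in> X"
  shows "(smooth_part f A b g \<rho> \<beta> y z xk has_derivative
    (\<lambda>d. (gradient f x + pgrad \<beta> y z x + \<rho> *\<^sub>R (x - xk)) \<bullet> d)) (at x)"
  unfolding smooth_part_def[abs_def] inner_add_left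
  by (intro has_derivative_add f_has_derivative penalty_has_derivative has_derivative_sq_norm_diff \<beta> x)

lemma composite_subproblem:
  assumes \<beta>: "0 < \<beta>" and z: "0 \<le> z" and zB: "norm z \<le> M" and xk: "xk \<in> X"
    and Lc: "L_f + \<rho> + sqrt (real CARD('m)) * L_g * M
      + \<beta> * (matrix_norm (transpose A ** A) + real CARD('m) * B_g * (B_g + L_g)) \<le> Lc"
  shows "composite_problem X (smooth_part f A b g \<rho> \<beta> y z xk) (\<lambda>x. hr x + \<rho> / 2 * (norm (x - xk))\<^sup>2) \<rho> Lc D"
proof
  let ?ft = "smooth_part f A b g \<rho> \<beta> y z xk"
  let ?C2 = "matrix_norm (transpose A ** A) + real CARD('m) * B_g * (B_g + L_g)"
  have C2: "0 \<le> ?C2" unfolding matrix_norm_def using B_g_pos L_g_nonneg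
    by (intro add_nonneg_nonneg mult_nonneg_nonneg onorm_pos_le matrix_vector_mul_bounded_linear) auto
  have M: "0 \<le> M" using zB norm_ge_zero order_trans by blast
  show rho_le: "\<rho> \<le> Lc"
  proof -
    have "0 \<le> sqrt (real CARD('m)) * L_g * M" "0 \<le> \<beta> * ?C2" using L_g_nonneg M C2 \<beta> by auto
    thus ?thesis using Lc L_f_nonneg by linarith
  qed
  have lin: "convex_on X (\<lambda>x. \<rho> / 2 * (norm xk)\<^sup>2 + (- \<rho>) *\<^sub>R xk \<bullet> x)" by (rule convex_on_affine[OF X_convex])
  \<comment> \<open>The shifted square is the centred one plus an affine function, so it supplies
    the convexity that \<open>f\<close> lacks and the modulus \<rho> of the composite part.\<close>
  have sq: "\<rho> / 2 * (norm (x - xk))\<^sup>2 = \<rho> / 2 * (norm x)\<^sup>2 + (\<rho> / 2 * (norm xk)\<^sup>2 + (- \<rho>) *\<^sub>R xk \<bullet> x)" for x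
    unfolding power2_norm_eq_inner by (simp add: inner_diff_left inner_diff_right inner_commute algebra_simps)
  show ftc: "convex_on X ?ft"
  proof -
    let ?c = "\<lambda>x. (f x + \<rho> / 2 * (norm x)\<^sup>2) + pen \<beta> y z x
        + (\<rho> / 2 * (norm xk)\<^sup>2 + (- \<rho>) *\<^sub>R xk \<bullet> x)"
    have "convex_on X ?c"
      by (intro convex_on_add f_weakly_convex convex_on_penalty[OF \<beta> X_convex] g_convex lin)
    moreover have "?c = ?ft"
      unfolding smooth_part_def[abs_def] sq by (rule HOL.ext) simp
    ultimately show ?thesis by (simp only:)
  qed
  show "convex_on X (\<lambda>x. hr x + \<rho> / 2 * (norm (x - xk))\<^sup>2 - \<rho> / 2 * (norm x)\<^sup>2)"
  proof -
    let ?c = "\<lambda>x. hr x + (\<rho> / 2 * (norm xk)\<^sup>2 + (- \<rho>) *\<^sub>R xk \<bullet> x)"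
    have "convex_on X ?c"
      by (intro convex_on_add hr_convex lin)
    moreover have "?c
        = (\<lambda>x. hr x + \<rho> / 2 * (norm (x - xk))\<^sup>2 - \<rho> / 2 * (norm x)\<^sup>2)"
      unfolding sq by (rule HOL.ext) simp
    ultimately show ?thesis by (simp only:)
  qed
  show "X \<noteq> {}" using x_feas_in by blast
  show "?ft differentiable (at x)" if "x \<in> X" for x
    using smooth_part_has_derivative[OF \<beta> that] unfolding differentiable_def by blast
  have grad: "gradient ?ft x = gradient f x + pgrad \<beta> y z x + \<rho> *\<^sub>R (x - xk)" if "x \<in> X" for x
    by (rule gradient_eq_derivative[OF smooth_part_has_derivative[OF \<beta> that]])
  have lip: "norm (gradient ?ft x - gradient ?ft x') \<le> Lc * norm (x - x')" if x: "x \<in> X" and x': "x' \<in> X" for x x'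
  proof -
    let ?p = "\<lambda>x. pgrad \<beta> y z x"
    let ?N = "norm (x - x')"
    have "gradient ?ft x - gradient ?ft x' = (gradient f x - gradient f x') + (?p x - ?p x') + \<rho> *\<^sub>R (x - x')"
      unfolding grad[OF x] grad[OF x'] by (simp add: algebra_simps)
    hence "norm (gradient ?ft x - gradient ?ft x')
        \<le> norm (gradient f x - gradient f x') + norm (?p x - ?p x') + norm (\<rho> *\<^sub>R (x - x'))"
      by (metis norm_triangle_mono norm_triangle_ineq order_refl)
    moreover have "norm (gradient f x - gradient f x') \<le> L_f * ?N" by (rule f_lip[OF x x'])
    moreover have "norm (?p x - ?p x') \<le> (\<beta> * ?C2 + sqrt (real CARD('m)) * L_g * norm z) * ?N"
      by (rule penalty_grad_lipschitz[OF \<beta> z x x' g_bound g_lipschitz g_lip L_g_nonneg B_g_pos])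
    moreover have "(\<beta> * ?C2 + sqrt (real CARD('m)) * L_g * norm z) * ?N
        \<le> (\<beta> * ?C2 + sqrt (real CARD('m)) * L_g * M) * ?N"
      using zB L_g_nonneg by (intro mult_right_mono add_left_mono mult_left_mono) auto
    moreover have "norm (\<rho> *\<^sub>R (x - x')) = \<rho> * ?N" using \<rho>_pos by simp
    moreover have "(L_f + \<rho> + sqrt (real CARD('m)) * L_g * M + \<beta> * ?C2) * ?N \<le> Lc * ?N"
      by (rule mult_right_mono[OF Lc]) simp
    ultimately show ?thesis by (simp only: distrib_right)
  qed
  show "1 / Lc * (norm (gradient ?ft x - gradient ?ft x'))\<^sup>2 \<le> (gradient ?ft x - gradient ?ft x') \<bullet> (x - x')"
    if "x \<in> X" "x' \<in> X" for x x'
  proof (rule cocoercive_closed[OF X_convex ftc _ _ _ lip that])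
    show "interior X \<noteq> {}" using x_feas_interior by blast
    show "0 < Lc" using rho_le \<rho>_pos by simp
    show "(?ft has_derivative (\<lambda>d. gradient ?ft x \<bullet> d)) (at x)" if "x \<in> X" for x
      unfolding grad[OF that] by (rule smooth_part_has_derivative[OF \<beta> that])
  qed
  show "continuous_on X (\<lambda>x. hr x + \<rho> / 2 * (norm (x - xk))\<^sup>2)" by (intro continuous_intros hr_cont)
qed (use X_compact \<rho>_pos diam in auto)

text \<open>Were no iterate of the window an approximate KKT point, \<open>E + P\<close> would fall
  by \<open>\<epsilon>\<^sup>2 / (5 * \<rho>)\<close> at each iteration from \<open>K1\<close> on,
  and \<open>K2\<close> such steps would exceed its total variation, which is below
  \<open>C\<close>.\<close>

lemma dpalm_kkt:
  fixes x :: "nat \<Rightarrow> real^'d" and y :: "nat \<Rightarrow> real^'n" and z :: "nat \<Rightarrow> real^'m"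
    and w :: "nat \<Rightarrow> real^'d" and K1 K2 :: nat
  assumes \<beta>\<^sub>0: "0 < \<beta>\<^sub>0" and v\<^sub>0: "0 < v\<^sub>0" and \<epsilon>: "0 < \<epsilon>"
    and \<beta>_eq: "\<And>k. \<beta> k = \<beta>\<^sub>0 * sqrt (real (k + 1))"
    and v_eq: "\<And>k. 1 \<le> k \<Longrightarrow> v k = v\<^sub>0 / (sqrt (real (k + 1)) * (ln (real (k + 1)))\<^sup>2)"
    and xX: "\<And>k. x k \<in> X"
    and stat: "\<And>k u. u \<in> X \<Longrightarrow> subobj (\<beta> k) (y k) (z k) (x k) (x (Suc k)) + w k \<bullet> (u - x (Suc k))
        \<le> subobj (\<beta> k) (y k) (z k) (x k) u"
    and w: "\<And>k. norm (w k) \<le> \<epsilon> / 8"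
    and upd: "\<And>k. multiplier_update A b g (\<beta> k) (v k) M (y k) (y (Suc k)) (z k) (z (Suc k)) (x (Suc k))"
    and K1: "1 \<le> K1" "\<And>k. K1 \<le> k \<Longrightarrow> 2 * M \<le> \<epsilon> * \<beta> k" "\<And>k. K1 \<le> k \<Longrightarrow> 2 * M\<^sup>2 \<le> \<epsilon> * \<beta> k"
    and K2: "5 * C * \<rho> / \<epsilon>\<^sup>2 \<le> real K2"
    and Fm: "\<And>x. x \<in> X \<Longrightarrow> \<bar>f x + hr x\<bar> \<le> Fm"
    and C: "2 * Fm + 12 * M\<^sup>2 / \<beta>\<^sub>0 + 16 * M * (v\<^sub>0 / \<beta>\<^sub>0) < C"
  shows "\<exists>k<K1 + K2. eps_KKT \<rho> (objective f (extend_inf X hr)) A b g \<epsilon> (x (Suc k))"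
proof (rule ccontr)
  assume none: "\<not> ?thesis"
  have \<beta>_pos: "0 < \<beta> k" and \<beta>_ge: "\<beta>\<^sub>0 \<le> \<beta> k" for k unfolding \<beta>_eq using \<beta>\<^sub>0 by auto
  have \<beta>_mono: "\<beta> k \<le> \<beta> (Suc k)" and \<beta>_double: "\<beta> (Suc k) \<le> 2 * \<beta> k" for k
  proof -
    show "\<beta> k \<le> \<beta> (Suc k)" unfolding \<beta>_eq using \<beta>\<^sub>0 by simp
    have "sqrt (real (Suc k + 1)) \<le> sqrt (4 * real (k + 1))" by (rule real_sqrt_le_mono) simp
    also have "\<dots> = 2 * sqrt (real (k + 1))" by (subst real_sqrt_mult) simp
    finally show "\<beta> (Suc k) \<le> 2 * \<beta> k" unfolding \<beta>_eq using \<beta>\<^sub>0 by simp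
  qed
  have M_nonneg: "0 \<le> M" using multiplier_update.M_nonneg[OF upd] .
  have bound: "norm (y k, z k) \<le> M" for k using multiplier_update.bound[OF upd] .
  define E where "E k = f (x k) + hr (x k) + pen (\<beta> k) (y k) (z k) (x k)" for k
  define R where "R k = f (x (Suc k)) + hr (x (Suc k)) + pen (\<beta> k) (y k) (z k) (x (Suc k))" for k
  \<comment> \<open>Each summand matches one error of \<open>penalty_increase\<close>, so that the
    multiplier update cannot raise the sum of augmented Lagrangian and \<open>P\<close>.\<close>
  define P where "P k = 4 * M\<^sup>2 / \<beta> k + (norm (z k))\<^sup>2 / \<beta> k + 4 * M * (v\<^sub>0 / \<beta>\<^sub>0) * damp_tail k" for k
  have desc: "R k + \<epsilon>\<^sup>2 / (5 * \<rho>) \<le> E k" if k: "K1 \<le> k" "k < K1 + K2" for k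
  proof -
    define d where "d = norm (x (Suc k) - x k)"
    have "\<not> norm (w k) + 2 * \<rho> * d \<le> \<epsilon>"
    proof
      assume a: "norm (w k) + 2 * \<rho> * d \<le> \<epsilon>"
      have "residual A b g (x (Suc k)) \<le> 2 * M / \<beta> k"
        using multiplier_update.res_bound[OF upd] multiplier_update.res_def[OF upd] \<beta>_pos[of k]
        by (simp add: pos_le_divide_eq mult.commute)
      also have "\<dots> \<le> \<epsilon>" using K1(2)[OF k(1)] \<beta>_pos[of k] by (simp add: pos_divide_le_eq)
      finally have res: "residual A b g (x (Suc k)) \<le> \<epsilon>" .
      have "2 * M\<^sup>2 / \<beta> k \<le> \<epsilon>" using K1(3)[OF k(1)] \<beta>_pos[of k] by (simp add: pos_divide_le_eq)
      hence "(\<Sum>i\<in>UNIV. \<bar>mult_ineq g (\<beta> k) (z k) (x (Suc k)) $ i * g (x (Suc k)) $ i\<bar>) \<le> \<epsilon>"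
        using multiplier_update.complementarity[OF upd] order_trans by blast
      from eps_KKTI[OF \<beta>_pos xX stat a[unfolded d_def] res this] none k show False by blast
    qed
    \<comment> \<open>The error \<open>w\<close> takes \<open>\<epsilon> / 8\<close>, hence the
      \<open>7 / 8\<close>. In what follows, \<open>3 / 2 - 2 / 7 = 17 / 14\<close> times
      \<open>49 / 256\<close> exceeds \<open>1 / 5\<close>, the source of the 5 in the bound on
      \<open>K2\<close>.\<close>
    hence big: "7 / 8 * \<epsilon> < 2 * \<rho> * d" using w[of k] by linarith
    have d: "0 \<le> d" unfolding d_def by simp
    have "R k + 3 / 2 * \<rho> * d\<^sup>2 \<le> E k + norm (w k) * d"
      using subobj_descent[OF \<beta>_pos xX xX stat] unfolding R_def E_def d_def by simp
    moreover have "norm (w k) * d \<le> (2 / 7 * \<rho> * d) * d"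
      using w[of k] big d by (intro mult_right_mono) auto
    moreover have "(2 / 7 * \<rho> * d) * d = 2 / 7 * (\<rho> * d\<^sup>2)" "3 / 2 * \<rho> * d\<^sup>2 = 3 / 2 * (\<rho> * d\<^sup>2)"
      by (simp_all add: power2_eq_square)
    moreover have "49 / 256 * (\<epsilon>\<^sup>2 / \<rho>) \<le> \<rho> * d\<^sup>2"
    proof -
      have "(7 / 16 * \<epsilon>)\<^sup>2 \<le> (\<rho> * d)\<^sup>2" using big \<epsilon> by (intro power_mono) auto
      thus ?thesis using \<rho>_pos by (simp add: power2_eq_square field_simps)
    qed
    moreover have "\<epsilon>\<^sup>2 / (5 * \<rho>) = 1 / 5 * (\<epsilon>\<^sup>2 / \<rho>)" "0 \<le> \<epsilon>\<^sup>2 / \<rho>" using \<rho>_pos by auto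
    ultimately show ?thesis by linarith
  qed
  have incr: "E (Suc k) + P (Suc k) \<le> R k + P k" if k: "1 \<le> k" for k
  proof -
    have "pen (\<beta> (Suc k)) (y (Suc k)) (z (Suc k)) (x (Suc k))
      \<le> pen (\<beta> k) (y k) (z k) (x (Suc k))
        + 4 * M\<^sup>2 * (1 / \<beta> k - 1 / \<beta> (Suc k)) + 4 * M * (v k / \<beta> k) + ((norm (z k))\<^sup>2 - (norm (z (Suc k)))\<^sup>2) / \<beta> k"
      by (rule multiplier_update.penalty_increase[OF upd \<beta>_mono \<beta>_double])
    moreover have "v k / \<beta> k \<le> (v\<^sub>0 / \<beta>\<^sub>0) * (damp_tail k - damp_tail (Suc k))"
    proof -
      have "v k / \<beta> k = (v\<^sub>0 / \<beta>\<^sub>0) * (1 / ((sqrt (real (k + 1)) * sqrt (real (k + 1))) * (ln (real (k + 1)))\<^sup>2))"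
        unfolding v_eq[OF k] \<beta>_eq by simp
      also have "\<dots> = (v\<^sub>0 / \<beta>\<^sub>0) * (1 / (real (k + 1) * (ln (real (k + 1)))\<^sup>2))" by simp
      also have "\<dots> \<le> (v\<^sub>0 / \<beta>\<^sub>0) * (damp_tail k - damp_tail (k + 1))"
        using v\<^sub>0 \<beta>\<^sub>0 by (intro mult_left_mono damp_tail(1) k) auto
      finally show ?thesis by simp
    qed
    hence "4 * M * (v k / \<beta> k) \<le> 4 * M * ((v\<^sub>0 / \<beta>\<^sub>0) * (damp_tail k - damp_tail (Suc k)))"
      using M_nonneg by (intro mult_left_mono) auto
    moreover have "(norm (z (Suc k)))\<^sup>2 / \<beta> (Suc k) \<le> (norm (z (Suc k)))\<^sup>2 / \<beta> k"
      using \<beta>_mono[of k] \<beta>_pos[of k] \<beta>_pos[of "Suc k"] by (intro divide_left_mono) auto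
    ultimately show ?thesis unfolding E_def R_def P_def by (simp add: right_diff_distrib diff_divide_distrib)
  qed
  have P_nonneg: "0 \<le> P k" if "1 \<le> k" for k
    unfolding P_def using damp_tail(2)[OF that] M_nonneg v\<^sub>0 \<beta>\<^sub>0 \<beta>_pos[of k]
    by (intro add_nonneg_nonneg mult_nonneg_nonneg divide_nonneg_pos) auto
  have tele: "E (K1 + n) + P (K1 + n) + real n * (\<epsilon>\<^sup>2 / (5 * \<rho>)) \<le> E K1 + P K1" if "n \<le> K2" for n
    using that
  proof (induction n)
    case (Suc n)
    moreover have "real (Suc n) * (\<epsilon>\<^sup>2 / (5 * \<rho>)) = real n * (\<epsilon>\<^sup>2 / (5 * \<rho>)) + \<epsilon>\<^sup>2 / (5 * \<rho>)"
      by (simp add: algebra_simps add_divide_distrib)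
    ultimately show ?case using desc[of "K1 + n"] incr[of "K1 + n"] K1(1) unfolding add_Suc_right by linarith
  qed simp
  have "E (K1 + K2) \<ge> - Fm - M\<^sup>2 / (2 * \<beta>\<^sub>0)"
  proof -
    have "- (M\<^sup>2 / (2 * \<beta> (K1 + K2))) \<le> pen (\<beta> (K1 + K2)) (y (K1 + K2)) (z (K1 + K2)) (x (K1 + K2))"
      by (rule penalty_terms_lower[OF \<beta>_pos bound])
    moreover have "M\<^sup>2 / (2 * \<beta> (K1 + K2)) \<le> M\<^sup>2 / (2 * \<beta>\<^sub>0)"
      using \<beta>_ge[of "K1 + K2"] \<beta>\<^sub>0 \<beta>_pos[of "K1 + K2"] by (intro divide_left_mono) auto
    ultimately show ?thesis unfolding E_def using Fm[OF xX, of "K1 + K2"] by linarith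
  qed
  \<comment> \<open>\<open>K1 \<ge> 1\<close> makes \<open>x K1\<close> the result of an update, so
    the penalty there is small.\<close>
  moreover have "E K1 \<le> Fm + 6 * M\<^sup>2 / \<beta>\<^sub>0"
  proof -
    obtain j where j: "K1 = Suc j" using K1(1) by (cases K1) auto
    have "pen (\<beta> K1) (y K1) (z K1) (x K1) \<le> 6 * M\<^sup>2 / \<beta> j"
      unfolding j by (rule multiplier_update.penalty_next_upper[OF upd \<beta>_pos \<beta>_double])
    also have "\<dots> \<le> 6 * M\<^sup>2 / \<beta>\<^sub>0" using \<beta>_ge[of j] \<beta>\<^sub>0 \<beta>_pos[of j] by (intro divide_left_mono) auto
    finally show ?thesis unfolding E_def using Fm[OF xX, of K1] by linarith
  qed
  moreover have "P K1 \<le> 5 * M\<^sup>2 / \<beta>\<^sub>0 + 16 * M * (v\<^sub>0 / \<beta>\<^sub>0)"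
  proof -
    have "norm (z K1) \<le> M" using norm_snd_le[of "z K1" "y K1"] bound[of K1] by linarith
    hence "(norm (z K1))\<^sup>2 \<le> M\<^sup>2" by (intro power_mono) auto
    hence "4 * M\<^sup>2 / \<beta> K1 + (norm (z K1))\<^sup>2 / \<beta> K1 \<le> 5 * M\<^sup>2 / \<beta> K1"
      using \<beta>_pos[of K1] by (simp add: add_divide_distrib[symmetric] divide_right_mono)
    also have "\<dots> \<le> 5 * M\<^sup>2 / \<beta>\<^sub>0" using \<beta>_ge[of K1] \<beta>\<^sub>0 \<beta>_pos[of K1] by (intro divide_left_mono) auto
    finally have "4 * M\<^sup>2 / \<beta> K1 + (norm (z K1))\<^sup>2 / \<beta> K1 \<le> 5 * M\<^sup>2 / \<beta>\<^sub>0" .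
    moreover have "4 * M * (v\<^sub>0 / \<beta>\<^sub>0) * damp_tail K1 \<le> 4 * M * (v\<^sub>0 / \<beta>\<^sub>0) * 4"
      using damp_tail(3)[OF K1(1)] M_nonneg v\<^sub>0 \<beta>\<^sub>0 by (intro mult_left_mono) auto
    ultimately show ?thesis unfolding P_def by simp
  qed
  moreover have "C \<le> real K2 * (\<epsilon>\<^sup>2 / (5 * \<rho>))"
    using K2 \<epsilon> \<rho>_pos by (simp add: field_simps)
  moreover have "M\<^sup>2 / (2 * \<beta>\<^sub>0) \<le> M\<^sup>2 / \<beta>\<^sub>0" using \<beta>\<^sub>0 by (intro divide_left_mono) auto
  \<comment> \<open>6 from the start of \<open>E\<close>, 5 from the start of \<open>P\<close>, and
    1 for the lower bound of \<open>E\<close>, where the exact share is one half.\<close>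
  moreover have "12 * M\<^sup>2 / \<beta>\<^sub>0 = 6 * M\<^sup>2 / \<beta>\<^sub>0 + 5 * M\<^sup>2 / \<beta>\<^sub>0 + M\<^sup>2 / \<beta>\<^sub>0" by (simp add: add_divide_distrib[symmetric])
  moreover have "0 \<le> P (K1 + K2)" using K1(1) by (intro P_nonneg) simp
  ultimately show False using tele[of K2] C by linarith
qed

end

section \<open>Runs of DPALM\<close>

lemma apg_out_stationary:
  assumes "apg ft ht \<mu> \<gamma>u \<gamma>d \<Delta> w0 L0 T out"
  shows "dist0 (subdiff (\<lambda>x. ereal (ft x) + ht x) out) \<le> ereal \<Delta>"
proof -
  obtain w where T: "1 \<le> T" and out: "out = w T" and
    "\<forall>t<T. dist0 (subdiff (\<lambda>x. ereal (ft x) + ht x) (w (Suc t))) \<le> ereal \<Delta> \<longleftrightarrow> Suc t = T"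
    using assms unfolding apg_def by blast
  moreover have "T - 1 < T" "Suc (T - 1) = T" using T by simp_all
  ultimately show ?thesis unfolding out by metis
qed

text \<open>In the theorem \<kappa> is the denominator of \<theta>, \<Theta> is \<theta> itself and
  \<open>M\<close> is \<open>B_p\<close>.\<close>

locale multiplier_bounded_problem = constrained_problem f hr A b g X x_feas \<rho> L_f L_g r_h B_g B_f D g_min
  for f hr :: "real^'d \<Rightarrow> real" and A :: "real^'d^'n" and b and g :: "real^'d \<Rightarrow> real^'m"
    and X x_feas \<rho> L_f L_g r_h B_g B_f D g_min +
  fixes \<tau> \<kappa> \<Theta> M :: real
  assumes \<tau>: "0 \<le> \<tau>" "cball x_feas \<tau> \<subseteq> X" "B_g * \<tau> \<le> g_min / 2"
    and \<kappa>: "0 < \<kappa>" "\<kappa> \<le> g_min / 2" "\<And>y. y \<in> range (\<lambda>x. A *v x) \<Longrightarrow> \<kappa> * norm y \<le> \<tau> * norm (transpose A *v y)"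
    and \<Theta>: "D * (1 + r_h + B_f + 2 * \<rho> * D) \<le> \<kappa> * \<Theta>" "\<Theta> \<le> M"
begin

abbreviation "hx \<equiv> extend_inf X hr"

abbreviation "inner_run \<gamma>d \<delta> w0 L0 \<beta> y z x T x' \<equiv>
   apg (smooth_part f A b g \<rho> \<beta> y z x) (composite_part hx \<rho> x) \<rho> 2 \<gamma>d \<delta> w0 L0 T x'"

abbreviation "inner_approx \<delta> \<beta> y z x x' \<equiv>
   dist0 (subdiff (prox_aug_lagrangian f hx A b g \<rho> \<beta> y z x) x') \<le> ereal \<delta>"

definition dpalm_inv :: "real^'d \<Rightarrow> real^'n \<Rightarrow> real^'m \<Rightarrow> bool" where
  "dpalm_inv x y z \<longleftrightarrow> x \<in> X \<and> y \<in> range (\<lambda>x. A *v x) \<and> 0 \<le> z \<and> norm (y, z) \<le> M"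

lemma dpalm_step:
  fixes x x' :: "real^'d"
  assumes inv: "dpalm_inv x y z" and \<beta>: "0 < \<beta>" and v: "0 < v" and \<delta>: "\<delta> \<le> 1"
    and stat: "inner_approx \<delta> \<beta> y z x x'"
    and y': "y' = y + damped_step A b g \<beta> v x' *\<^sub>R (A *v x' - b)"
    and z': "z' = z + damped_step A b g \<beta> v x' *\<^sub>R mult_step g \<beta> z x'"
  shows "dpalm_inv x' y' z'" and "multiplier_update A b g \<beta> v M y y' z z' x'"
    and "\<exists>w. norm w \<le> \<delta> \<and> (\<forall>u\<in>X. subobj \<beta> y z x x' + w \<bullet> (u - x') \<le> subobj \<beta> y z x u)"
proof -
  have x: "x \<in> X" and y: "y \<in> range (\<lambda>x. A *v x)" and z: "0 \<le> z" and M: "norm (y, z) \<le> M"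
    using inv unfolding dpalm_inv_def by auto
  obtain w where x': "x' \<in> X" and w: "\<And>u. u \<in> X \<Longrightarrow> subobj \<beta> y z x x' + w \<bullet> (u - x') \<le> subobj \<beta> y z x u"
      "norm w \<le> \<delta>"
    using dist0_subdiff_extend_inf_leD[OF stat[unfolded prox_aug_lagrangian_eq]] by blast
  thus "\<exists>w. norm w \<le> \<delta> \<and> (\<forall>u\<in>X. subobj \<beta> y z x x' + w \<bullet> (u - x') \<le> subobj \<beta> y z x u)" by blast
  have "norm w \<le> 1" using w(2) \<delta> by simp
  have "norm (mult_eq A b \<beta> y x', mult_ineq g \<beta> z x') \<le> max (norm (y, z)) \<Theta>"
    by (rule multiplier_bound[OF \<beta> x' x w(1) \<open>norm w \<le> 1\<close> \<tau> \<kappa> \<Theta>(1) y z])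
  hence "norm (mult_eq A b \<beta> y x', mult_ineq g \<beta> z x') \<le> M" using M \<Theta>(2) by simp
  thus mu: "multiplier_update A b g \<beta> v M y y' z z' x'" by unfold_locales (use \<beta> v z y' z' M in auto)
  have "y' \<in> range (\<lambda>x. A *v x)"
  proof -
    obtain q where "y = A *v q" using y by blast
    hence "y' = A *v (q + damped_step A b g \<beta> v x' *\<^sub>R (x' - x_feas))"
      unfolding y' x_feas_eq[symmetric]
      by (simp add: matrix_vector_right_distrib matrix_vector_mult_scaleR matrix_vector_mult_diff_distrib)
    thus ?thesis by blast
  qed
  thus "dpalm_inv x' y' z'" unfolding dpalm_inv_def
    using x' multiplier_update.bound'[OF mu] multiplier_update.z'_nonneg[OF mu] by blast
qed

lemma dpalm_subproblem:
  fixes x :: "real^'d"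
  assumes inv: "dpalm_inv x y z" and \<beta>: "0 < \<beta>" and \<delta>: "0 < \<delta>" and \<gamma>d: "2 \<le> \<gamma>d"
    and w0: "w0 \<in> X" and L0: "0 < L0" "L0 \<le> Lc"
    and Lc: "L_f + \<rho> + sqrt (real CARD('m)) * L_g * M
      + \<beta> * (matrix_norm (transpose A ** A) + real CARD('m) * B_g * (B_g + L_g)) \<le> Lc"
  shows "\<exists>x' T. inner_run \<gamma>d \<delta> w0 L0 \<beta> y z x T x'
    \<and> inner_approx \<delta> \<beta> y z x x'"
    and "\<And>x' T. inner_run \<gamma>d \<delta> w0 L0 \<beta> y z x T x' \<Longrightarrow>
      real T \<le> 2 + (2 * sqrt (Lc / \<rho>) + 1 / ln 2) * max 0 (ln (9 / \<delta> * D * sqrt (1 / \<rho>) * Lc powr (3 / 2)))"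
proof -
  have "norm z \<le> M" using norm_snd_le[of z y] inv unfolding dpalm_inv_def by linarith
  then interpret sub: composite_problem X "smooth_part f A b g \<rho> \<beta> y z x" "\<lambda>u. hr u + \<rho> / 2 * (norm (u - x))\<^sup>2" \<rho> Lc D
    using inv Lc \<beta> unfolding dpalm_inv_def by (intro composite_subproblem) auto
  \<comment> \<open>The two parts sum to the objective of the outer method, so the stopping test of
    the inner scheme is the accuracy required there.\<close>
  have "sub.phi u = subobj \<beta> y z x u" for u
    unfolding sub.phi_def subobj_def smooth_part_def by simp
  hence "sub.phi = subobj \<beta> y z x" by (rule HOL.ext)
  hence split: "(\<lambda>u. ereal (smooth_part f A b g \<rho> \<beta> y z x u) + composite_part hx \<rho> x u)
      = prox_aug_lagrangian f hx A b g \<rho> \<beta> y z x"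
    unfolding prox_aug_lagrangian_eq composite_part_eq sub.phi_extend_inf by (simp only:)
  obtain T x' where run: "inner_run \<gamma>d \<delta> w0 L0 \<beta> y z x T x'"
    using sub.apg_exists[OF w0 L0 \<gamma>d \<delta>] unfolding composite_part_eq by blast
  from apg_out_stationary[OF run] run
  show "\<exists>x' T. inner_run \<gamma>d \<delta> w0 L0 \<beta> y z x T x'
    \<and> inner_approx \<delta> \<beta> y z x x'"
    unfolding split by blast
  show "real T \<le> 2 + (2 * sqrt (Lc / \<rho>) + 1 / ln 2) * max 0 (ln (9 / \<delta> * D * sqrt (1 / \<rho>) * Lc powr (3 / 2)))"
    if "inner_run \<gamma>d \<delta> w0 L0 \<beta> y z x T x'" for x' T
    using sub.apg_complexity[OF w0 L0 \<gamma>d \<delta>] that unfolding composite_part_eq by blast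
qed

lemma dpalm_inv_run:
  assumes inv0: "dpalm_inv x0 y0 z0" and \<beta>: "\<And>k. 0 < \<beta> k" and v: "\<And>k. 0 < v k" and \<delta>: "\<And>k. \<delta> k \<le> 1"
    and run: "dpalm f hx A b g \<rho> \<beta> v \<delta> x0 y0 z0 x y z"
  shows "dpalm_inv (x k) (y k) (z k)"
    and "multiplier_update A b g (\<beta> k) (v k) M (y k) (y (Suc k)) (z k) (z (Suc k)) (x (Suc k))"
    and "\<exists>w. norm w \<le> \<delta> k \<and> (\<forall>u\<in>X. subobj (\<beta> k) (y k) (z k) (x k) (x (Suc k)) + w \<bullet> (u - x (Suc k))
            \<le> subobj (\<beta> k) (y k) (z k) (x k) u)"
proof -
  have stat: "inner_approx (\<delta> k) (\<beta> k) (y k) (z k) (x k) (x (Suc k))"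
    and y': "y (Suc k) = y k + damped_step A b g (\<beta> k) (v k) (x (Suc k)) *\<^sub>R (A *v x (Suc k) - b)"
    and z': "z (Suc k) = z k + damped_step A b g (\<beta> k) (v k) (x (Suc k)) *\<^sub>R mult_step g (\<beta> k) (z k) (x (Suc k))" for k
    using run unfolding dpalm_def mult_step_def Let_def by auto
  show inv: "dpalm_inv (x k) (y k) (z k)" for k
  proof (induction k)
    case 0
    show ?case using run inv0 unfolding dpalm_def by simp
  next
    case (Suc k)
    show ?case by (rule dpalm_step(1)[OF Suc \<beta> v \<delta> stat y' z'])
  qed
  show "multiplier_update A b g (\<beta> k) (v k) M (y k) (y (Suc k)) (z k) (z (Suc k)) (x (Suc k))"
    by (rule dpalm_step(2)[OF inv \<beta> v \<delta> stat y' z'])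
  show "\<exists>w. norm w \<le> \<delta> k \<and> (\<forall>u\<in>X. subobj (\<beta> k) (y k) (z k) (x k) (x (Suc k)) + w \<bullet> (u - x (Suc k))
            \<le> subobj (\<beta> k) (y k) (z k) (x k) u)"
    by (rule dpalm_step(3)[OF inv \<beta> v \<delta> stat y' z'])
qed

text \<open>Inner runs are known to exist but not given as a function of the data, so the outer
  sequence comes from dependent choice; by \<open>dpalm_step\<close> the next state again admits an
  inner run.\<close>

lemma dpalm_apg_exists:
  assumes inv0: "dpalm_inv x0 y0 z0" and \<beta>: "\<And>k. 0 < \<beta> k" and v: "\<And>k. 0 < v k"
    and \<delta>: "\<And>k. 0 < \<delta> k" "\<And>k. \<delta> k \<le> 1" and \<gamma>d: "2 \<le> \<gamma>d"
    and w0: "\<And>k. w0 k \<in> X" and L0: "\<And>k. 0 < L0 k" "\<And>k. L0 k \<le> Lc k"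
    and Lc: "\<And>k. L_f + \<rho> + sqrt (real CARD('m)) * L_g * M
      + \<beta> k * (matrix_norm (transpose A ** A) + real CARD('m) * B_g * (B_g + L_g)) \<le> Lc k"
  shows "\<exists>x y z T. dpalm_apg f hx A b g \<rho> \<beta> v \<delta> x0 y0 z0 2 \<gamma>d w0 L0 x y z T"
proof -
  define px where "px = (fst :: (real^'d) \<times> (real^'n) \<times> (real^'m) \<Rightarrow> real^'d)"
  define py where "py s = fst (snd s)" for s :: "(real^'d) \<times> (real^'n) \<times> (real^'m)"
  define pz where "pz s = snd (snd s)" for s :: "(real^'d) \<times> (real^'n) \<times> (real^'m)"
  define P where "P n s \<longleftrightarrow> dpalm_inv (px s) (py s) (pz s) \<and> (n = 0 \<longrightarrow> s = (x0, y0, z0))" for n :: nat and s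
  define Q where "Q k s s' \<longleftrightarrow>
      inner_approx (\<delta> k) (\<beta> k) (py s) (pz s) (px s) (px s') \<and>
      py s' = py s + damped_step A b g (\<beta> k) (v k) (px s') *\<^sub>R (A *v px s' - b) \<and>
      pz s' = pz s + damped_step A b g (\<beta> k) (v k) (px s') *\<^sub>R mult_step g (\<beta> k) (pz s) (px s') \<and>
      (\<exists>T. inner_run \<gamma>d (\<delta> k) (w0 k) (L0 k) (\<beta> k) (py s) (pz s) (px s) T (px s'))" for k s s'
  have "\<exists>s. \<forall>n. P n (s n) \<and> Q n (s n) (s (Suc n))"
  proof (rule dependent_nat_choice)
    show "\<exists>s. P 0 s"
      using inv0 unfolding P_def px_def py_def pz_def by (intro exI[of _ "(x0, y0, z0)"]) simp
  next
    fix s and k :: nat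
    assume "P k s"
    hence inv: "dpalm_inv (px s) (py s) (pz s)" unfolding P_def by blast
    obtain x' T where x': "inner_run \<gamma>d (\<delta> k) (w0 k) (L0 k) (\<beta> k) (py s) (pz s) (px s) T x'"
        "inner_approx (\<delta> k) (\<beta> k) (py s) (pz s) (px s) x'"
      using dpalm_subproblem(1)[OF inv \<beta> \<delta>(1) \<gamma>d w0 L0 Lc] by blast
    define s' where "s' = (x', py s + damped_step A b g (\<beta> k) (v k) x' *\<^sub>R (A *v x' - b),
        pz s + damped_step A b g (\<beta> k) (v k) x' *\<^sub>R mult_step g (\<beta> k) (pz s) x')"
    have s': "px s' = x'" "py s' = py s + damped_step A b g (\<beta> k) (v k) x' *\<^sub>R (A *v x' - b)"
        "pz s' = pz s + damped_step A b g (\<beta> k) (v k) x' *\<^sub>R mult_step g (\<beta> k) (pz s) x'"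
      unfolding s'_def by (simp_all add: px_def py_def pz_def)
    have "P (Suc k) s'"
      using dpalm_step(1)[OF inv \<beta> v \<delta>(2) x'(2) s'(2,3)] s'(1) unfolding P_def by simp
    moreover have "Q k s s'" unfolding Q_def s'(1) using x' s'(2,3) by blast
    ultimately show "\<exists>s'. P (Suc k) s' \<and> Q k s s'" by blast
  qed
  then obtain s where P: "\<And>n. P n (s n)" and Q: "\<And>n. Q n (s n) (s (Suc n))" by blast
  have s0: "s 0 = (x0, y0, z0)" using P[of 0] unfolding P_def by blast
  obtain T where T: "\<And>k. inner_run \<gamma>d (\<delta> k) (w0 k) (L0 k) (\<beta> k) (py (s k)) (pz (s k)) (px (s k)) (T k) (px (s (Suc k)))"
    using Q unfolding Q_def by metis
  have "dpalm f hx A b g \<rho> \<beta> v \<delta> x0 y0 z0 (\<lambda>k. px (s k)) (\<lambda>k. py (s k)) (\<lambda>k. pz (s k))"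
    unfolding dpalm_def Let_def using s0 Q unfolding Q_def mult_step_def by (simp add: px_def py_def pz_def)
  with T show ?thesis unfolding dpalm_apg_def by blast
qed

end

section \<open>The main result\<close>

theorem theorem2:
  fixes f :: "real^'d \<Rightarrow> real" and h :: "real^'d \<Rightarrow> ereal"
    and A :: "real^'d^'n" and b :: "real^'n" and g :: "real^'d \<Rightarrow> real^'m"
    and F :: "real^'d \<Rightarrow> ereal" and X :: "(real^'d) set" and x_feas :: "real^'d"
    and \<rho> L_f L_g r_h B_g B_f D g_min :: real
    and \<epsilon> \<beta>\<^sub>0 v\<^sub>0 \<gamma>\<^sub>d :: real
    and x0 :: "real^'d" and y0 :: "real^'n" and z0 :: "real^'m"
    and w0 :: "nat \<Rightarrow> real^'d" and L0 :: "nat \<Rightarrow> real"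
    and \<beta> v \<epsilon>s :: "nat \<Rightarrow> real"
    and \<tau> B \<theta> B_p Q C\<^sub>1 C_p_hat C_p C_x C\<^sub>2 C\<^sub>3 :: real and K\<^sub>1 K\<^sub>2 K :: nat
  assumes F_def: "F = objective f h"
    and X_def: "X = edom F"
    and h_proper: "\<And>x. h x \<noteq> -\<infinity>"
    and F_cont: "continuous_on X F"
    and X_compact: "compact X"
    and D_def: "D = diameter X"
    and \<rho>_pos: "0 < \<rho>"
    and f_weakly_convex: "convex_on X (\<lambda>x. f x + \<rho> / 2 * (norm x)\<^sup>2)"
    and h_closed_convex: "closed_convex h"
    and g_convex_smooth: "\<And>i. \<exists>U. open U \<and> X \<subseteq> U \<and>
          convex_on U (\<lambda>x. g x $ i) \<and> L_smooth_on L_g U (\<lambda>x. g x $ i)"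
    and x_feas_interior: "x_feas \<in> interior X"
    and x_feas_eq: "A *v x_feas = b"
    and g_min_def: "g_min = Min (range (\<lambda>i. - (g x_feas $ i)))"
    and g_min_pos: "0 < g_min"
    and r_h_pos: "0 < r_h"
    and h_subdiff: "\<And>x. x \<in> X \<Longrightarrow>
          subdiff h x \<noteq> {} \<and> subdiff h x \<subseteq> {p + u |p u. p \<in> normal_cone X x \<and> norm u \<le> r_h}"
    and f_smooth: "\<exists>U. open U \<and> X \<subseteq> U \<and> L_smooth_on L_f U f"
    and B_g_pos: "0 < B_g"
    and B_g_bound: "\<And>x i. x \<in> X \<Longrightarrow> max \<bar>g x $ i\<bar> (norm (gradient (\<lambda>x. g x $ i) x)) \<le> B_g"
    and B_g_lipschitz: "\<And>x x' i. x \<in> X \<Longrightarrow> x' \<in> X \<Longrightarrow> \<bar>g x $ i - g x' $ i\<bar> \<le> B_g * norm (x - x')"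
    and B_f_pos: "0 < B_f"
    and B_f_bound: "\<And>x. x \<in> X \<Longrightarrow> norm (gradient f x) \<le> B_f"
    and \<epsilon>_pos: "0 < \<epsilon>" and \<beta>\<^sub>0_pos: "0 < \<beta>\<^sub>0" and v\<^sub>0_pos: "0 < v\<^sub>0"
    and x0_in: "x0 \<in> X" and y0_in: "y0 \<in> range (\<lambda>x. A *v x)" and z0_nonneg: "0 \<le> z0"
    and \<beta>_def: "\<beta> = (\<lambda>k. \<beta>\<^sub>0 * sqrt (real (k + 1)))"
    and v_def: "v = (\<lambda>k. if k = 0 then v\<^sub>0 else v\<^sub>0 / (sqrt (real (k + 1)) * (ln (real (k + 1)))\<^sup>2))"
    and \<epsilon>s_def: "\<epsilon>s = (\<lambda>k. Min {\<epsilon> / 8, sqrt (\<rho> / (2 * \<beta> k)), 1})"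
    and \<tau>_def: "\<tau> = min (g_min / (2 * sqrt (real CARD('m)) * B_g)) (infdist x_feas (frontier X))"
    and B_def: "B = D * (r_h + B_f) + 2 * \<rho> * D\<^sup>2 + D + \<tau> * (1 + r_h + B_f + 2 * \<rho> * D)"
    \<comment> \<open>for \<open>A = 0\<close> there is no positive eigenvalue, and its term is dropped from the minimum\<close>
    and \<theta>_def: "\<theta> = B / (if A = 0 then g_min / 2
                        else min (\<tau> * sqrt (lambda_min_pos (A ** transpose A))) (g_min / 2))"
    and B_p_def: "B_p = max (norm (y0, z0)) \<theta>"
    and Q_def: "Q = D * (B_f + 2 * \<rho> * D + r_h)"
    and C\<^sub>1_def: "C\<^sub>1 = 1 / D + 1 / infdist x_feas (frontier X) + B_g / g_min"
    and C_p_hat_def: "C_p_hat = 2 * (B_p + sqrt (Q\<^sup>2 / g_min\<^sup>2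
          + Q\<^sup>2 * (matrix_norm (pseudoinverse (A ** transpose A) ** A))\<^sup>2 * C\<^sub>1\<^sup>2)) + 1"
    and C_p_def: "C_p = 2 * C_p_hat"
    and C_x_def: "C_x = 2 * (SUP x\<in>X. \<bar>real_of_ereal (F x)\<bar>)
          + 1 / (4 * \<beta>\<^sub>0) * (14 * C_p\<^sup>2 + 8 * B_p * C_p + 7 * B_p\<^sup>2)
          + (10 * C_p + 4 * B_p) * (v\<^sub>0 / \<beta>\<^sub>0)
          + \<beta>\<^sub>0 / 2 * ((norm (A *v x0 - b))\<^sup>2 + (norm (pos (g x0 + z0 /\<^sub>R \<beta>\<^sub>0)))\<^sup>2)
          + \<bar>y0 \<bullet> (A *v x0 - b)\<bar>"
    and C\<^sub>2_def: "C\<^sub>2 = matrix_norm (transpose A ** A) + real CARD('m) * B_g * (B_g + L_g)"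
    and C\<^sub>3_def: "C\<^sub>3 = L_f + \<rho> + sqrt (real CARD('m)) * L_g * B_p"
    and K\<^sub>1_def: "K\<^sub>1 = nat \<lceil>max (C_p\<^sup>2 / (\<beta>\<^sub>0\<^sup>2 * \<epsilon>\<^sup>2))
                            ((4 * B_p\<^sup>2 + 5 * C_p\<^sup>2)\<^sup>2 / (16 * \<beta>\<^sub>0\<^sup>2 * \<epsilon>\<^sup>2))\<rceil>"
    and K\<^sub>2_def: "K\<^sub>2 = nat \<lceil>5 * C_x * \<rho> / \<epsilon>\<^sup>2\<rceil>"
    and K_def: "K = K\<^sub>1 + K\<^sub>2"
    \<comment> \<open>inputs of the APG calls: starting points in the domain, and starting values at most the
        smoothness constant of the smooth part of the subproblem\<close>
    and \<gamma>\<^sub>d_ge: "2 \<le> \<gamma>\<^sub>d"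
    and w0_in: "\<And>k. w0 k \<in> X"
    and L0_bounds: "\<And>k. 0 < L0 k \<and> L0 k \<le> C\<^sub>3 + sqrt (real (k + 1)) * \<beta>\<^sub>0 * C\<^sub>2"
  \<comment> \<open>the logarithm enters through its positive part: it is negative in degenerate cases,
        where the bound without positive part can be below zero\<close>
  shows "(\<exists>x y z T. dpalm_apg f h A b g \<rho> \<beta> v \<epsilon>s x0 y0 z0 2 \<gamma>\<^sub>d w0 L0 x y z T) \<and>
    (\<forall>x y z T. dpalm_apg f h A b g \<rho> \<beta> v \<epsilon>s x0 y0 z0 2 \<gamma>\<^sub>d w0 L0 x y z T \<longrightarrow>
       (\<exists>k<K. eps_KKT \<rho> F A b g \<epsilon> (x (Suc k))) \<and>
       real (\<Sum>k<K. T k) \<le> 2 * real K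
         + real K * (2 * sqrt (C\<^sub>3 / \<rho>) + 2 * sqrt (sqrt (real K) * \<beta>\<^sub>0 * C\<^sub>2 / \<rho>) + 1 / ln 2)
           * max 0 (ln (9 / \<epsilon>s K * D * sqrt (1 / \<rho>)
                         * (C\<^sub>3 + sqrt (real K) * \<beta>\<^sub>0 * C\<^sub>2) powr (3 / 2))))"
proof -
  define hr where "hr = (\<lambda>x. real_of_ereal (h x))"
  have X_eq: "X = {x. h x < \<infinity>}"
  proof -
    have "ereal (f x) + h x < \<infinity> \<longleftrightarrow> h x < \<infinity>" for x by (cases "h x") auto
    thus ?thesis unfolding X_def F_def edom_def objective_def by simp
  qed
  have h_fin: "h x = ereal (hr x)" if "x \<in> X" for x
    using that h_proper[of x] unfolding X_eq hr_def by (cases "h x") auto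
  have h_eq: "h = extend_inf X hr"
  proof
    fix x
    show "h x = extend_inf X hr x"
      using h_fin[of x] unfolding extend_inf_def by (cases "x \<in> X") (auto simp: X_eq)
  qed
  have F_fin: "F x = ereal (f x + hr x)" if "x \<in> X" for x
    using h_fin[OF that] unfolding F_def objective_def by simp
  have hr_convex: "convex_on X hr"
  proof -
    have epi: "convex {(x, t::real). h x \<le> ereal t}" using h_closed_convex unfolding closed_convex_def Let_def by blast
    have comb: "h ((1 - t) *\<^sub>R x + t *\<^sub>R u) \<le> ereal ((1 - t) * hr x + t * hr u)"
      if t: "0 < t" "t < 1" and x: "x \<in> X" and u: "u \<in> X" for t x u
    proof -
      have "(1 - t) *\<^sub>R (x, hr x) + t *\<^sub>R (u, hr u) \<in> {(x, t::real). h x \<le> ereal t}"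
        by (rule convexD[OF epi]) (use t h_fin x u in auto)
      thus ?thesis by simp
    qed
    have "(1 - t) *\<^sub>R x + t *\<^sub>R u \<in> X" if "0 < t" "t < 1" "x \<in> X" "u \<in> X" for t x u
      using comb[OF that] unfolding X_eq by (auto intro: le_less_trans)
    hence "convex X" unfolding convex_alt by (metis add.left_neutral add.right_neutral diff_zero le_less
        right_minus_eq scaleR_one scaleR_zero_left)
    show ?thesis
    proof (rule convex_onI[OF _ \<open>convex X\<close>])
      fix t :: real and x u assume t: "0 < t" "t < 1" and x: "x \<in> X" and u: "u \<in> X"
      have "(1 - t) *\<^sub>R x + t *\<^sub>R u \<in> X" using convexD_alt[OF \<open>convex X\<close> x u, of t] t by simp
      from comb[OF t x u] h_fin[OF this] show "hr ((1 - t) *\<^sub>R x + t *\<^sub>R u) \<le> (1 - t) * hr x + t * hr u" by simp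
    qed
  qed
  obtain U where U: "X \<subseteq> U" "L_smooth_on L_f U f" using f_smooth by blast
  have f_diff: "f differentiable (at x)" if "x \<in> X" for x using U that unfolding L_smooth_on_def by blast
  have f_lips: "L_f-lipschitz_on X (gradient f)" using U unfolding L_smooth_on_def by (blast intro: lipschitz_on_subset)
  have g_smooth: "convex_on X (\<lambda>x. g x $ i)" "\<And>x. x \<in> X \<Longrightarrow> (\<lambda>x. g x $ i) differentiable (at x)"
      "L_g-lipschitz_on X (cgrad g i)" for i
  proof -
    obtain V where V: "X \<subseteq> V" "convex_on V (\<lambda>x. g x $ i)" "L_smooth_on L_g V (\<lambda>x. g x $ i)"
      using g_convex_smooth by blast
    have "convex X" using hr_convex by (simp add: convex_on_def)
    thus "convex_on X (\<lambda>x. g x $ i)" by (rule convex_on_subset[OF V(2,1)])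
    show "(\<lambda>x. g x $ i) differentiable (at x)" if "x \<in> X" for x
      using V that unfolding L_smooth_on_def by blast
    have "cgrad g i = gradient (\<lambda>x. g x $ i)" by (rule HOL.ext) (rule cgrad_def)
    thus "L_g-lipschitz_on X (cgrad g i)" using V unfolding L_smooth_on_def by (auto intro: lipschitz_on_subset)
  qed
  have f_cont: "continuous_on X f"
    using f_diff by (intro differentiable_imp_continuous_on) (auto simp: differentiable_on_def differentiable_at_withinI)
  have Fr_cont: "continuous_on X (\<lambda>x. f x + hr x)"
  proof -
    have "continuous_on X (real_of_ereal \<circ> F)"
      using F_cont F_fin by (subst continuous_on_iff_real[symmetric]) auto
    moreover have "(real_of_ereal \<circ> F) x = f x + hr x" if "x \<in> X" for x using F_fin[OF that] by simp
    ultimately show ?thesis using continuous_on_cong by (metis (no_types, lifting))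
  qed
  \<comment> \<open>Continuity is given for \<open>F\<close>; subtracting \<open>f\<close>, which is
    differentiable at the points of \<open>X\<close>, leaves that of \<open>hr\<close>.\<close>
  have hr_cont: "continuous_on X hr"
    using continuous_on_diff[OF Fr_cont f_cont] by simp
  have X_bounded: "bounded X" using X_compact compact_imp_bounded by blast
  have diam: "norm (x - x') \<le> D" if "x \<in> X" "x' \<in> X" for x x'
    using diameter_bounded_bound[OF X_bounded that] unfolding D_def dist_norm .
  have x_feas_in: "x_feas \<in> X" using x_feas_interior interior_subset by blast
  interpret cp: constrained_problem f hr A b g X x_feas \<rho> L_f L_g r_h B_g B_f D g_min
  proof
    show "g x_feas $ i \<le> - g_min" for i
    proof -
      have "g_min \<le> - (g x_feas $ i)" unfolding g_min_def by (intro Min_le) auto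
      thus ?thesis by simp
    qed
    show "\<exists>p w. v = p + w \<and> p \<in> normal_cone X x \<and> norm w \<le> r_h"
      if "x \<in> X" "\<And>u. u \<in> X \<Longrightarrow> hr x + v \<bullet> (u - x) \<le> hr u" for x v
    proof -
      have "v \<in> subdiff h x" unfolding h_eq subdiff_extend_inf_iff using that by blast
      thus ?thesis using h_subdiff[OF that(1)] by blast
    qed
    show "norm (gradient f x - gradient f x') \<le> L_f * norm (x - x')" if "x \<in> X" "x' \<in> X" for x x'
      using lipschitz_onD[OF f_lips that] unfolding dist_norm .
    show "norm (cgrad g i x - cgrad g i x') \<le> L_g * norm (x - x')" if "x \<in> X" "x' \<in> X" for x x' i
      using lipschitz_onD[OF g_smooth(3) that] unfolding dist_norm .
    show "0 \<le> L_f" "0 \<le> L_g" using lipschitz_on_nonneg f_lips g_smooth(3) by blast+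
    show "\<bar>g x $ i\<bar> \<le> B_g" "norm (cgrad g i x) \<le> B_g" if "x \<in> X" for x i
      using B_g_bound[OF that, of i] unfolding cgrad_def by auto
  qed (use X_compact hr_convex hr_cont \<rho>_pos f_weakly_convex f_diff g_smooth x_feas_interior x_feas_eq
      g_min_pos B_g_pos B_g_lipschitz B_f_bound diam in auto)

  define r\<^sub>0 where "r\<^sub>0 = infdist x_feas (frontier X)"
  \<comment> \<open>\<open>infdist\<close> to the empty set is 0, so positivity of the distance
    depends on a nonempty frontier; boundedness of \<open>X\<close> provides it.\<close>
  have "frontier X \<noteq> {}"
    using x_feas_in X_bounded by (auto simp: frontier_eq_empty not_bounded_UNIV)
  moreover have "x_feas \<notin> frontier X" using x_feas_interior by (auto simp: frontier_def)
  ultimately have r\<^sub>0: "0 < r\<^sub>0" unfolding r\<^sub>0_def by (intro infdist_pos_not_in_closed frontier_closed)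
  have m1: "1 \<le> sqrt (real CARD('m))" by (simp add: Suc_leI)
  have \<tau>_pos: "0 < \<tau>" unfolding \<tau>_def r\<^sub>0_def[symmetric] using r\<^sub>0 g_min_pos B_g_pos m1 by (auto intro!: divide_pos_pos mult_pos_pos)
  have \<tau>_ball: "cball x_feas \<tau> \<subseteq> X"
    using X_compact x_feas_in by (intro cball_subset_infdist_frontier compact_imp_closed) (auto simp: \<tau>_def)
  have \<tau>_small: "B_g * \<tau> \<le> g_min / 2"
  proof -
    have "\<tau> \<le> g_min / (2 * sqrt (real CARD('m)) * B_g)" unfolding \<tau>_def by simp
    also have "\<dots> \<le> g_min / (2 * B_g)"
      using m1 B_g_pos g_min_pos by (intro divide_left_mono) auto
    finally show ?thesis using B_g_pos by (simp add: field_simps)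
  qed
  have D_pos: "0 < D"
  proof -
    obtain e :: "real^'d" where e: "norm e = \<tau>" using vector_choose_size[of \<tau>] \<tau>_pos by auto
    have "x_feas + e \<in> X" using \<tau>_ball e by (auto simp: dist_norm)
    from diam[OF this x_feas_in] show ?thesis using e \<tau>_pos by simp
  qed
  define \<kappa> where "\<kappa> = (if A = 0 then g_min / 2 else min (\<tau> * sqrt (lambda_min_pos (A ** transpose A))) (g_min / 2))"
  have \<kappa>_pos: "0 < \<kappa>" unfolding \<kappa>_def using g_min_pos \<tau>_pos lambda_min_pos_bound(1)[of A] by auto
  have \<theta>: "\<theta> = B / \<kappa>" unfolding \<theta>_def \<kappa>_def ..
  have B_ge: "D * (1 + r_h + B_f + 2 * \<rho> * D) \<le> B"
  proof -
    have "0 \<le> \<tau> * (1 + r_h + B_f + 2 * \<rho> * D)" using \<tau>_pos r_h_pos B_f_pos \<rho>_pos D_pos by (intro mult_nonneg_nonneg add_nonneg_nonneg) auto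
    thus ?thesis unfolding B_def by (simp add: power2_eq_square algebra_simps)
  qed
  interpret mp: multiplier_bounded_problem f hr A b g X x_feas \<rho> L_f L_g r_h B_g B_f D g_min \<tau> \<kappa> \<theta> B_p
  proof
    show "\<kappa> * norm y \<le> \<tau> * norm (transpose A *v y)" if "y \<in> range (\<lambda>x. A *v x)" for y
    proof (cases "A = 0")
      \<comment> \<open>The range of the zero matrix is \<open>{0}\<close>.\<close>
      case True
      thus ?thesis using that \<tau>_pos by auto
    next
      case False
      have "\<kappa> * norm y \<le> \<tau> * sqrt (lambda_min_pos (A ** transpose A)) * norm y"
        unfolding \<kappa>_def using False by (intro mult_right_mono) auto
      also have "\<dots> \<le> \<tau> * norm (transpose A *v y)"
        using lambda_min_pos_bound(2)[OF False that] \<tau>_pos by (simp add: mult.assoc)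
      finally show ?thesis .
    qed
    show "\<kappa> \<le> g_min / 2"
      unfolding \<kappa>_def by (cases "A = 0") (simp_all only: if_True if_False refl min.cobounded2 order_refl simp_thms)
    show "D * (1 + r_h + B_f + 2 * \<rho> * D) \<le> \<kappa> * \<theta>" using B_ge \<kappa>_pos unfolding \<theta> by simp
  qed (use \<tau>_pos \<tau>_ball \<tau>_small \<kappa>_pos in \<open>auto simp: B_p_def\<close>)

  have \<beta>_pos: "0 < \<beta> k" for k unfolding \<beta>_def using \<beta>\<^sub>0_pos by simp
  have v_pos: "0 < v k" for k unfolding v_def using v\<^sub>0_pos by simp
  have \<epsilon>s_pos: "0 < \<epsilon>s k" and \<epsilon>s_le: "\<epsilon>s k \<le> 1" "\<epsilon>s k \<le> \<epsilon> / 8" for k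
    unfolding \<epsilon>s_def using \<epsilon>_pos \<rho>_pos \<beta>_pos[of k] by auto
  have \<epsilon>s_anti: "\<epsilon>s k' \<le> \<epsilon>s k" if "k \<le> k'" for k k'
  proof -
    have "\<beta> k \<le> \<beta> k'" unfolding \<beta>_def using \<beta>\<^sub>0_pos that by simp
    hence le: "sqrt (\<rho> / (2 * \<beta> k')) \<le> sqrt (\<rho> / (2 * \<beta> k))"
      using \<rho>_pos \<beta>_pos[of k] \<beta>_pos[of k'] by (intro real_sqrt_le_mono divide_left_mono) auto
    have eq: "\<epsilon>s k = min (\<epsilon> / 8) (min (sqrt (\<rho> / (2 * \<beta> k))) 1)" for k
      unfolding \<epsilon>s_def by simp
    show ?thesis unfolding eq by (intro min.mono order_refl le)
  qed
  have inv0: "mp.dpalm_inv x0 y0 z0" unfolding mp.dpalm_inv_def using x0_in y0_in z0_nonneg by (simp add: B_p_def)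
  define Lc where "Lc k = C\<^sub>3 + sqrt (real (k + 1)) * \<beta>\<^sub>0 * C\<^sub>2" for k :: nat
  have Lc: "L_f + \<rho> + sqrt (real CARD('m)) * L_g * B_p
      + \<beta> k * (matrix_norm (transpose A ** A) + real CARD('m) * B_g * (B_g + L_g)) \<le> Lc k" for k
    unfolding Lc_def C\<^sub>3_def C\<^sub>2_def \<beta>_def by (simp add: mult_ac)
  have L0: "0 < L0 k" "L0 k \<le> Lc k" for k using L0_bounds[of k] unfolding Lc_def by auto
  have B_p_nonneg: "0 \<le> B_p" unfolding B_p_def by (simp add: le_max_iff_disj)
  have C\<^sub>2_nonneg: "0 \<le> C\<^sub>2" unfolding C\<^sub>2_def matrix_norm_def using B_g_pos cp.L_g_nonneg
    by (intro add_nonneg_nonneg mult_nonneg_nonneg onorm_pos_le matrix_vector_mul_bounded_linear) auto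
  have C\<^sub>3_pos: "0 < C\<^sub>3" unfolding C\<^sub>3_def using \<rho>_pos cp.L_f_nonneg cp.L_g_nonneg B_p_nonneg
    by (intro add_pos_nonneg add_nonneg_pos mult_nonneg_nonneg) auto
  \<comment> \<open>The square root in \<open>C_p_hat\<close> is nonnegative, which leaves
    \<open>2 * (2 * B_p + 1)\<close>; this is the comparison between \<open>C_p\<close> and
    \<open>B_p\<close> used below.\<close>
  have C_p_ge: "4 * B_p + 2 \<le> C_p" unfolding C_p_def C_p_hat_def by simp
  have C_p_sq: "16 * B_p\<^sup>2 + 4 \<le> C_p\<^sup>2"
  proof -
    have "(4 * B_p + 2)\<^sup>2 \<le> C_p\<^sup>2" using C_p_ge B_p_nonneg by (intro power_mono) auto
    moreover have "(4 * B_p + 2)\<^sup>2 = 16 * B_p\<^sup>2 + 16 * B_p + 4" by (simp add: power2_eq_square algebra_simps)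
    ultimately show ?thesis using B_p_nonneg by linarith
  qed

  have exists_run: "\<exists>x y z T. dpalm_apg f h A b g \<rho> \<beta> v \<epsilon>s x0 y0 z0 2 \<gamma>\<^sub>d w0 L0 x y z T"
    unfolding h_eq by (rule mp.dpalm_apg_exists[OF inv0 \<beta>_pos v_pos \<epsilon>s_pos \<epsilon>s_le(1) \<gamma>\<^sub>d_ge w0_in L0 Lc])

  have K\<^sub>1: "1 \<le> K\<^sub>1" "2 * B_p \<le> \<epsilon> * \<beta> k" "2 * B_p\<^sup>2 \<le> \<epsilon> * \<beta> k" if "K\<^sub>1 \<le> k" for k
  proof -
    define c\<^sub>0 where "c\<^sub>0 = 4 * B_p\<^sup>2 + 5 * C_p\<^sup>2"
    have C_p_pos: "0 < C_p" using C_p_ge B_p_nonneg by linarith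
    have "max (C_p\<^sup>2 / (\<beta>\<^sub>0\<^sup>2 * \<epsilon>\<^sup>2)) (c\<^sub>0\<^sup>2 / (16 * \<beta>\<^sub>0\<^sup>2 * \<epsilon>\<^sup>2)) \<le> real K\<^sub>1"
      unfolding K\<^sub>1_def c\<^sub>0_def by (rule real_nat_ceiling_ge)
    hence a: "C_p\<^sup>2 / (\<beta>\<^sub>0\<^sup>2 * \<epsilon>\<^sup>2) \<le> real K\<^sub>1" "c\<^sub>0\<^sup>2 / (16 * \<beta>\<^sub>0\<^sup>2 * \<epsilon>\<^sup>2) \<le> real K\<^sub>1"
      by simp_all
    have "0 < C_p\<^sup>2 / (\<beta>\<^sub>0\<^sup>2 * \<epsilon>\<^sup>2)" using C_p_pos \<beta>\<^sub>0_pos \<epsilon>_pos by simp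
    hence "0 < real K\<^sub>1" using a(1) by linarith
    thus "1 \<le> K\<^sub>1" by simp
    \<comment> \<open>Applied to both entries of the maximum in \<open>K\<^sub>1\<close>: the first
      serves the residual, the second the complementarity error.\<close>
    have ge: "c \<le> \<epsilon> * \<beta> k" if "0 \<le> c" "c\<^sup>2 / (\<beta>\<^sub>0\<^sup>2 * \<epsilon>\<^sup>2) \<le> real K\<^sub>1" for c
    proof -
      have "c\<^sup>2 \<le> real K\<^sub>1 * (\<beta>\<^sub>0\<^sup>2 * \<epsilon>\<^sup>2)" using that(2) \<beta>\<^sub>0_pos \<epsilon>_pos by (simp add: pos_divide_le_eq)
      also have "\<dots> \<le> real (k + 1) * (\<beta>\<^sub>0\<^sup>2 * \<epsilon>\<^sup>2)" using \<open>K\<^sub>1 \<le> k\<close> by (intro mult_right_mono) auto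
      also have "\<dots> = (\<epsilon> * \<beta> k)\<^sup>2" unfolding \<beta>_def by (simp add: power_mult_distrib)
      finally have "c\<^sup>2 \<le> (\<epsilon> * \<beta> k)\<^sup>2" .
      moreover have "0 \<le> \<epsilon> * \<beta> k" using \<epsilon>_pos \<beta>_pos[of k] by simp
      ultimately show ?thesis by (rule power2_le_imp_le)
    qed
    show "2 * B_p \<le> \<epsilon> * \<beta> k" using ge[OF _ a(1)] C_p_pos C_p_ge B_p_nonneg by linarith
    have "(c\<^sub>0 / 4)\<^sup>2 / (\<beta>\<^sub>0\<^sup>2 * \<epsilon>\<^sup>2) = c\<^sub>0\<^sup>2 / (16 * \<beta>\<^sub>0\<^sup>2 * \<epsilon>\<^sup>2)"
      by (simp add: power_divide)
    hence "c\<^sub>0 / 4 \<le> \<epsilon> * \<beta> k" using ge[of "c\<^sub>0 / 4"] a(2) by (simp add: c\<^sub>0_def)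
    moreover have "2 * B_p\<^sup>2 \<le> c\<^sub>0 / 4"
    proof -
      define p where "p = B_p\<^sup>2"
      have "0 \<le> p" "16 * p + 4 \<le> C_p\<^sup>2" using C_p_sq unfolding p_def by auto
      thus ?thesis unfolding p_def[symmetric] c\<^sub>0_def by (simp add: field_simps)
    qed
    ultimately show "2 * B_p\<^sup>2 \<le> \<epsilon> * \<beta> k" by (rule order_trans[rotated])
  qed
  define Fm where "Fm = (SUP x\<in>X. \<bar>real_of_ereal (F x)\<bar>)"
  have Fm: "\<bar>f x + hr x\<bar> \<le> Fm" if "x \<in> X" for x
  proof -
    have "bdd_above ((\<lambda>x. \<bar>f x + hr x\<bar>) ` X)"
      by (intro bounded_imp_bdd_above compact_imp_bounded compact_continuous_image continuous_intros Fr_cont X_compact)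
    moreover have "(\<lambda>x. \<bar>real_of_ereal (F x)\<bar>) ` X = (\<lambda>x. \<bar>f x + hr x\<bar>) ` X"
      by (rule image_cong) (simp_all add: F_fin)
    ultimately show ?thesis unfolding Fm_def using that by (auto intro: cSUP_upper)
  qed
  have C_x: "2 * Fm + 12 * B_p\<^sup>2 / \<beta>\<^sub>0 + 16 * B_p * (v\<^sub>0 / \<beta>\<^sub>0) < C_x"
  proof -
    define p where "p = B_p\<^sup>2"
    have nn: "0 \<le> 8 * B_p * C_p" "0 \<le> p" "16 * p + 4 \<le> C_p\<^sup>2"
      using B_p_nonneg C_p_ge C_p_sq unfolding p_def by auto
    \<comment> \<open>\<open>14 * C_p^2\<close> is at least \<open>224 * B_p^2 + 56\<close>; the 48
      on the left is 12 times the 4 in the denominator.\<close>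
    have less: "48 * p < 14 * C_p\<^sup>2 + 8 * B_p * C_p + 7 * p" using nn by linarith
    have "12 * B_p\<^sup>2 / \<beta>\<^sub>0 = 1 / (4 * \<beta>\<^sub>0) * (48 * B_p\<^sup>2)" by simp
    also have "\<dots> < 1 / (4 * \<beta>\<^sub>0) * (14 * C_p\<^sup>2 + 8 * B_p * C_p + 7 * B_p\<^sup>2)"
      using \<beta>\<^sub>0_pos less unfolding p_def by (intro mult_strict_left_mono) simp_all
    finally have "12 * B_p\<^sup>2 / \<beta>\<^sub>0 < 1 / (4 * \<beta>\<^sub>0) * (14 * C_p\<^sup>2 + 8 * B_p * C_p + 7 * B_p\<^sup>2)" .
    moreover have "16 * B_p * (v\<^sub>0 / \<beta>\<^sub>0) \<le> (10 * C_p + 4 * B_p) * (v\<^sub>0 / \<beta>\<^sub>0)"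
      using C_p_ge B_p_nonneg v\<^sub>0_pos \<beta>\<^sub>0_pos by (intro mult_right_mono) auto
    moreover have "0 \<le> \<beta>\<^sub>0 / 2 * ((norm (A *v x0 - b))\<^sup>2 + (norm (pos (g x0 + z0 /\<^sub>R \<beta>\<^sub>0)))\<^sup>2)" using \<beta>\<^sub>0_pos by simp
    ultimately show ?thesis unfolding C_x_def Fm_def[symmetric] by linarith
  qed
  have K\<^sub>2: "5 * C_x * \<rho> / \<epsilon>\<^sup>2 \<le> real K\<^sub>2" unfolding K\<^sub>2_def by (rule real_nat_ceiling_ge)

  \<comment> \<open>Common bounds for all inner runs: \<open>k < K\<close> gives
    \<open>k + 1 \<le> K\<close>, hence \<open>sqrt K\<close> in \<open>L\<close>, and the tolerance
    is nonincreasing, so its value at \<open>K\<close> is the strictest.\<close>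
  define L where "L = C\<^sub>3 + sqrt (real K) * \<beta>\<^sub>0 * C\<^sub>2"
  define G where "G = 9 / \<epsilon>s K * D * sqrt (1 / \<rho>) * L powr (3 / 2)"
  define c where "c = 2 * sqrt (C\<^sub>3 / \<rho>) + 2 * sqrt (sqrt (real K) * \<beta>\<^sub>0 * C\<^sub>2 / \<rho>) + 1 / ln 2"
  have "(\<exists>k<K. eps_KKT \<rho> F A b g \<epsilon> (x (Suc k))) \<and> real (\<Sum>k<K. T k) \<le> 2 * real K + real K * c * max 0 (ln G)"
    if run: "dpalm_apg f h A b g \<rho> \<beta> v \<epsilon>s x0 y0 z0 2 \<gamma>\<^sub>d w0 L0 x y z T" for x y z T
  proof
    have outer: "dpalm f (extend_inf X hr) A b g \<rho> \<beta> v \<epsilon>s x0 y0 z0 x y z"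
      and inner: "\<And>k. apg (smooth_part f A b g \<rho> (\<beta> k) (y k) (z k) (x k)) (composite_part (extend_inf X hr) \<rho> (x k))
            \<rho> 2 \<gamma>\<^sub>d (\<epsilon>s k) (w0 k) (L0 k) (T k) (x (Suc k))"
      using run unfolding dpalm_apg_def h_eq[symmetric] by auto
    note inv = mp.dpalm_inv_run[OF inv0 \<beta>_pos v_pos \<epsilon>s_le(1) outer]
    obtain w where w: "\<And>k. norm (w k) \<le> \<epsilon>s k"
        "\<And>k u. u \<in> X \<Longrightarrow> cp.subobj (\<beta> k) (y k) (z k) (x k) (x (Suc k)) + w k \<bullet> (u - x (Suc k))
            \<le> cp.subobj (\<beta> k) (y k) (z k) (x k) u"
      using inv(3) by metis
    show "\<exists>k<K. eps_KKT \<rho> F A b g \<epsilon> (x (Suc k))"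
      unfolding K_def F_def h_eq
    proof (rule cp.dpalm_kkt[where \<beta> = \<beta> and v = v and w = w and M = B_p and C = C_x and Fm = Fm, OF \<beta>\<^sub>0_pos v\<^sub>0_pos \<epsilon>_pos])
      show "x k \<in> X" for k using inv(1)[of k] unfolding mp.dpalm_inv_def by blast
      show "norm (w k) \<le> \<epsilon> / 8" for k using w(1)[of k] \<epsilon>s_le(2)[of k] by linarith
      show "\<beta> k = \<beta>\<^sub>0 * sqrt (real (k + 1))" for k unfolding \<beta>_def ..
      show "v k = v\<^sub>0 / (sqrt (real (k + 1)) * (ln (real (k + 1)))\<^sup>2)" if "1 \<le> k" for k
        using that unfolding v_def by simp
    qed (use w(2) inv(2) K\<^sub>1 K\<^sub>2 Fm C_x in blast)+
    have "real (T k) \<le> 2 + c * max 0 (ln G)" if k: "k < K" for k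
    proof -
      have Lk: "0 < Lc k" "Lc k \<le> L"
      proof -
        show "0 < Lc k" using L0[of k] by linarith
        have "sqrt (real (k + 1)) \<le> sqrt (real K)" using k by (intro real_sqrt_le_mono) auto
        hence "sqrt (real (k + 1)) * \<beta>\<^sub>0 * C\<^sub>2 \<le> sqrt (real K) * \<beta>\<^sub>0 * C\<^sub>2"
          using \<beta>\<^sub>0_pos C\<^sub>2_nonneg by (intro mult_right_mono) auto
        thus "Lc k \<le> L" unfolding Lc_def L_def by simp
      qed
      define Gk where "Gk = 9 / \<epsilon>s k * D * sqrt (1 / \<rho>) * Lc k powr (3 / 2)"
      have Gk: "0 < Gk" unfolding Gk_def using \<epsilon>s_pos[of k] D_pos \<rho>_pos Lk by simp
      have "Gk \<le> G" unfolding Gk_def G_def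
      proof (rule mult_mono)
        show "9 / \<epsilon>s k * D * sqrt (1 / \<rho>) \<le> 9 / \<epsilon>s K * D * sqrt (1 / \<rho>)"
          using \<epsilon>s_anti[of k K] k \<epsilon>s_pos[of k] \<epsilon>s_pos[of K] D_pos \<rho>_pos
          by (intro mult_right_mono divide_left_mono) auto
        show "Lc k powr (3 / 2) \<le> L powr (3 / 2)" using Lk by (intro powr_mono2) auto
      qed (use \<epsilon>s_pos[of K] D_pos \<rho>_pos in auto)
      hence lnG: "max 0 (ln Gk) \<le> max 0 (ln G)" using Gk by (intro max.mono) auto
      \<comment> \<open>Subadditivity of the root separates \<open>C\<^sub>3\<close> from
        \<open>C\<^sub>2\<close> in the final coefficient.\<close>
      have "sqrt (Lc k / \<rho>) \<le> sqrt (C\<^sub>3 / \<rho> + sqrt (real K) * \<beta>\<^sub>0 * C\<^sub>2 / \<rho>)"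
        using Lk \<rho>_pos unfolding L_def add_divide_distrib[symmetric] by (intro real_sqrt_le_mono divide_right_mono) auto
      also have "\<dots> \<le> sqrt (C\<^sub>3 / \<rho>) + sqrt (sqrt (real K) * \<beta>\<^sub>0 * C\<^sub>2 / \<rho>)"
        using C\<^sub>3_pos \<rho>_pos \<beta>\<^sub>0_pos C\<^sub>2_nonneg by (intro sqrt_add_le_add_sqrt) auto
      finally have ck: "2 * sqrt (Lc k / \<rho>) + 1 / ln 2 \<le> c" unfolding c_def by simp
      have "real (T k) \<le> 2 + (2 * sqrt (Lc k / \<rho>) + 1 / ln 2) * max 0 (ln Gk)"
        unfolding Gk_def by (rule mp.dpalm_subproblem(2)[OF inv(1) \<beta>_pos \<epsilon>s_pos \<gamma>\<^sub>d_ge w0_in L0 Lc inner])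
      also have "\<dots> \<le> 2 + c * max 0 (ln G)"
        using ck lnG Lk \<rho>_pos by (intro add_left_mono mult_mono) (auto intro: order_trans[OF _ ck])
      finally show ?thesis .
    qed
    hence "(\<Sum>k<K. real (T k)) \<le> (\<Sum>k<K. 2 + c * max 0 (ln G))" by (intro sum_mono) auto
    also have "\<dots> = 2 * real K + real K * c * max 0 (ln G)" by (simp add: algebra_simps)
    finally show "real (\<Sum>k<K. T k) \<le> 2 * real K + real K * c * max 0 (ln G)" by simp
  qed
  with exists_run show ?thesis unfolding c_def G_def L_def by blast
qed

end
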